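(* Let $\mathbb F$ be a field of characteristic zero, let $\mathfrak k$ be a differential graded $\mathbb F$-Lie algebra concentrated in degrees $-1$ and $-2$, and fix a contraction $(\nabla,\pi,h)$ of $\mathfrak k$ onto its homology $\mathrm H(\mathfrak k)$. Use the notation of the context: $V=s\mathfrak k$, $\mathbf v=s\mathrm H(\mathfrak k)$, the twisting cochain $\tau\colon \mathrm S^{\mathrm c}[\mathbf v]\to\mathfrak k_{\mathrm a}$, its adjoint $\overline\tau\colon \mathrm S^{\mathrm c}[\mathbf v]\to \mathrm S^{\mathrm c}[V]$, the coalgebra differential $\mathcal D$ on $\mathrm S^{\mathrm c}[\mathbf v]$, the $\mathbb F$-varieties $\mathcal V_{\mathfrak k}\subseteq\mathcal M_{\mathfrak k}\subseteq V_0$ with their coordinate coalgebras $C[\mathcal V_{\mathfrak k}]\subseteq C[\mathcal M_{\mathfrak k}]\subseteq \mathrm S^{\mathrm c}[V_0]$, and the Kuranishi coalgebra $C_{\mathfrak k}\subseteq \mathrm S^{\mathrm c}[\mathbf v_0]$. (1) The constituent $$\overline\tau\colon \mathrm S^{\mathrm c}[\mathbf v_0]\longrightarrow C[\mathcal M_{\mathfrak k}]\subseteq \mathrm S^{\mathrm c}[V_0]$$ of the adjoint $\overline\tau$ of $\tau$ is the inverse of $$\mathrm S^{\mathrm c}[\pi]_*\colon C[\mathcal M_{\mathfrak k}]\subseteq \mathrm S^{\mathrm c}[V_0]\xrightarrow{\ \mathrm S^{\mathrm c}[\pi]\ }\mathrm S^{\mathrm c}[\mathbf v_0],$$ and these two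 maps are mutually inverse isomorphisms of coalgebras. In other words, the morphism $\overline\tau\colon \mathrm S^{\mathrm c}[\mathbf v_0]\to C[\mathcal M_{\mathfrak k}]$ of coalgebras is the formal inverse of the projection from $\mathcal M_{\mathfrak k}$ to its tangent space $\mathbf v_0$ at the origin. (2) This formal inverse restricts to an isomorphism of $\mathbb F$-coalgebras $$\overline\tau\colon C_{\mathfrak k}\longrightarrow C[\mathcal V_{\mathfrak k}]\subseteq \mathrm S^{\mathrm c}[V_0].$$
   Context: Gradings are homological: differentials have degree $-1$; the Koszul sign rule is in force. $s$ denotes suspension, $(sC)_{j+1}=C_j$, with $ds+sd=0$. Symmetric coalgebra. For a (graded) vector space $U$, $\mathrm S^{\mathrm c}[U]=\bigoplus_{j\ge0}\mathrm S^{\mathrm c}_j[U]$ is the (graded) symmetric coalgebra cogenerated by $U$: $\mathrm S^{\mathrm c}_j[U]\subseteq U^{\otimes j}$ is the space of (graded) symmetric-group invariants, $\mathrm S^{\mathrm c}_0[U]=\mathbb F$, $\mathrm S^{\mathrm c}_1[U]=U$, a subcoalgebra of the tensor coalgebra. A degree zero linear map $U\to W$ induces a coalgebra morphism $\mathrm S^{\mathrm c}[U]\to \mathrm S^{\mathrm c}[W]$. Morphisms from a cocomplete coaugmented (graded) cocommutative coalgebra to $\mathrm S^{\mathrm c}[U]$ correspond, by composition with the projection $\mathrm S^{\mathrm c}[U]\to U$, to degree zero linear maps to $U$ vanishing on the coaugmentation; coderivations of $\mathrm S^{\mathrm c}[U]$ likewise correspond to linear maps $\mathrm S^{\mathrm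 c}[U]\to U$. Contraction. A contraction of $\mathfrak k$ onto $\mathrm H(\mathfrak k)$ (zero differential) consists of chain maps $\nabla\colon \mathrm H(\mathfrak k)\to\mathfrak k$, $\pi\colon\mathfrak k\to \mathrm H(\mathfrak k)$ and a degree $1$ map $h\colon\mathfrak k\to\mathfrak k$ with $\pi\nabla=\mathrm{Id}$, $dh+hd=\mathrm{Id}-\nabla\pi$, $\pi h=0$, $h\nabla=0$, $hh=0$. Put $V=s\mathfrak k$ (degrees $0$ and $-1$) and $\mathbf v=s\mathrm H(\mathfrak k)$, with the induced contraction of $V$ onto $\mathbf v$, still written $(\nabla,\pi,h)$ (on $V$: $d=-s\,d\,s^{-1}$, $h=-s\,h\,s^{-1}$, $\nabla$ and $\pi$ conjugated by $s$). Identify $\mathbf v$ with $\nabla(\mathbf v)\subseteq V$. Then $V_0=\mathbf v_0\oplus A_0$, $V_{-1}=B_{-1}\oplus\mathbf v_{-1}$, where $\mathbf v_0=\ker(d|_{V_0})$, $A_0=hdV_0$, $B_{-1}=dV_0$; $d\colon A_0\to B_{-1}$ is an isomorphism with inverse $h|_{B_{-1}}$. Bracket as quadratic map. The Lie bracket corresponds to the linear map $Q\colon \mathrm S^{\mathrm c}[V_0]\to V_{-1}$ that vanishes on $\mathrm S^{\mathrm c}_j[V_0]$ for $j\neq2$ and satisfies $Q(v\otimes v)=q(v)$ with $q(v)=\tfrac12 s[s^{-1}v,s^{-1}v]$, $v\in V_0$. Write $q=(q_B,q_{\mathbf v})$, $Q=(Q_B,Q_{\mathbf v})$ relative to $V_{-1}=B_{-1}\oplus\mathbf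 v_{-1}$. Let $d$ also denote the coderivation of $\mathrm S^{\mathrm c}[V]$ induced by $d$ on $V$, and let $\partial$, $\partial_B$ be the coderivations of $\mathrm S^{\mathrm c}[V]$ of degree $-1$ whose corestrictions to $V$ are $Q$, resp. $Q_B$, on $\mathrm S^{\mathrm c}[V_0]$ (and zero in the other degrees). $\mathcal C[\mathfrak k]=\mathrm S^{\mathrm c}_{d+\partial}[V]$ (that is, $\mathrm S^{\mathrm c}[V]$ with differential $d+\partial$) is the classifying (Cartan-Chevalley-Eilenberg) coalgebra of $\mathfrak k$. Let $\mathfrak k_{\mathrm a}$ be the differential graded Lie algebra with the same underlying chain complex as $\mathfrak k$ and bracket determined by $Q_B$ only, i.e. $[x,y]_{\mathrm a}=dh[x,y]$ for $x,y\in\mathfrak k_{-1}$; so $\mathcal C[\mathfrak k_{\mathrm a}]=\mathrm S^{\mathrm c}_{d+\partial_B}[V]$. Recursive construction. Let $\mathfrak l$ be $\mathfrak k$ or $\mathfrak k_{\mathrm a}$, with the contraction $(\nabla,\pi,h)$. Let $\tau_{\mathrm H}\colon \mathrm S^{\mathrm c}[\mathbf v]\to \mathrm H(\mathfrak k)$ be the projection to $\mathbf v$ followed by $s^{-1}$. For linear maps $a,b\colon \mathrm S^{\mathrm c}[\mathbf v]\to\mathfrak l$ let $[a,b]$ be the composite of the diagonal, $a\otimes b$, and the bracket of $\mathfrak l$. Put $\tau^1=\nabla\tau_{\mathrm H}$ and, for $\ell\ge2$, $\tau^\ell=\tfrac12h([\tau^1,\tau^{\ell-1}]+\dots+[\tau^{\ell-1},\tau^1])$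 on $\mathrm S^{\mathrm c}_\ell[\mathbf v]$ (zero on $\mathrm S^{\mathrm c}_j[\mathbf v]$, $j\ne\ell$); let $\mathcal D^{\ell-1}$ be the coderivation of $\mathrm S^{\mathrm c}[\mathbf v]$ with $\tau_{\mathrm H}\mathcal D^{\ell-1}=\tfrac12\pi([\tau^1,\tau^{\ell-1}]+\dots+[\tau^{\ell-1},\tau^1])$ on $\mathrm S^{\mathrm c}_\ell[\mathbf v]$ and zero on the other $\mathrm S^{\mathrm c}_j[\mathbf v]$. The construction yields the coderivation $\sum_{j\ge1}\mathcal D^j$ and the degree $-1$ map $\sum_{j\ge1}\tau^j$ (only finitely many terms are non-zero on each element). Here: - $\tau\colon \mathrm S^{\mathrm c}[\mathbf v]\to\mathfrak k_{\mathrm a}$ is the map $\sum\tau^j$ obtained for $\mathfrak l=\mathfrak k_{\mathrm a}$ (for $\mathfrak l=\mathfrak k$ one obtains the same linear map); - $\mathcal D$ is the differential $\sum\mathcal D^j$ obtained for $\mathfrak l=\mathfrak k$ (it satisfies $\mathcal D\mathcal D=0$); $\mathrm S^{\mathrm c}_{\mathcal D}[\mathbf v]$ is $\mathrm S^{\mathrm c}[\mathbf v]$ with differential $\mathcal D$. The adjoint $\overline\tau\colon \mathrm S^{\mathrm c}[\mathbf v]\to \mathrm S^{\mathrm c}[V]$ is the unique morphism of coaugmented graded coalgebras whose composite with the projection to $V$ is $s\circ\tau$. Its degree zero constituent is a map $\mathrm S^{\mathrm c}[\mathbf v_0]\to \mathrm S^{\mathrm c}[V_0]$. Coordinate coalgebras.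 Let $U$ be a finite-dimensional $\mathbb F$-vector space and $\mathcal V\subseteq U$ an affine $\mathbb F$-variety with vanishing ideal $I_{\mathcal V}\subseteq \mathrm S[U^*]$ in the symmetric algebra $\mathrm S[U^*]$, the coordinate ring of $U$. Choose a finite set $y_1,\dots,y_\ell$ of generators of $I_{\mathcal V}$. A polynomial $y\in\mathrm S[U^*]$ with homogeneous parts $y_{(j)}$ is viewed as the linear form on $\mathrm S^{\mathrm c}[U]$ with $v^{\otimes j}\mapsto y_{(j)}(v)$; thus the generators yield a linear map $y\colon \mathrm S^{\mathrm c}[U]\to\mathbb F^\ell$. The coordinate coalgebra of $\mathcal V$ is $$C[\mathcal V]=\ker\big((\mathrm{Id}\otimes y)\Delta\colon \mathrm S^{\mathrm c}[U]\to \mathrm S^{\mathrm c}[U]\otimes\mathbb F^\ell\big),$$ a subcoalgebra of $\mathrm S^{\mathrm c}[U]$. The varieties. $\mathcal M_{\mathfrak k}\subseteq V_0$ is the non-singular $\mathbb F$-variety of all $x=(x_1,x_2)\in V_0=\mathbf v_0\oplus A_0$ with $x_2+h(q_B(x))=0$, equivalently $(d+q_B)(x)=0$; it contains the origin, and its tangent space there is $\mathbf v_0$ (given by $x_2=0$). $\mathcal V_{\mathfrak k}=J^{-1}(0)\subseteq\mathcal M_{\mathfrak k}$ is the zero locus of $J=d+q\colon V_0\to V_{-1}$, an $\mathbb F$-subvariety of $V_0$, not necessarily non-singular. Their coordinate coalgebras are those just defined, with $U=V_0$. (Just before the theorem the source also asserts that the homology coalgebras $\mathrm H_0(\mathrm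 S^{\mathrm c}_{d+\partial_B}[V])\subseteq\mathrm S^{\mathrm c}[V_0]$ and $\mathrm H_0(\mathrm S^{\mathrm c}_{d+\partial}[V])\subseteq\mathrm S^{\mathrm c}[V_0]$ are canonically isomorphic to $C[\mathcal M_{\mathfrak k}]$ and $C[\mathcal V_{\mathfrak k}]$, respectively; this is an assertion, not the definition.) The map $\mathrm S^{\mathrm c}[\pi]_*$ is the restriction to $C[\mathcal M_{\mathfrak k}]$ of the coalgebra morphism $\mathrm S^{\mathrm c}[V_0]\to \mathrm S^{\mathrm c}[\mathbf v_0]$ induced by $\pi\colon V_0\to\mathbf v_0$; it is the formal map associated with the projection from $\mathcal M_{\mathfrak k}$ to its tangent space at the origin. The Kuranishi coalgebra is $C_{\mathfrak k}=\mathrm H_0(\mathrm S^{\mathrm c}_{\mathcal D}[\mathbf v])=\ker(\mathcal D|_{\mathrm S^{\mathrm c}[\mathbf v_0]})\subseteq \mathrm S^{\mathrm c}[\mathbf v_0]$.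
   Formalization: The ideals of M_k and V_k are taken to be generated by the components of x_2+h(q_B(x)) and of J, not all polynomials vanishing on the point sets; with the latter (2) fails for d=0, q(v)=v^2 on a line, where C_k has dimension 2 but C[V_k] has dimension 1. *)

theory Defs
  imports Complex_Main "HOL-Library.Function_Algebras" "HOL-Library.Groups_Big_Fun"
begin

section \<open>Graded vector spaces, dg Lie algebras, contractions\<close>

text \<open>
  A vector space over the field \<open>'f\<close> is a type with a scalar multiplication satisfying
  \<^locale>\<open>vector_space\<close>. A grading is a family \<open>G\<close> of subspaces, of which the whole space is the
  (internal) direct sum; \<open>G n\<close> is the component of degree \<open>n\<close>.
\<close>

definition graded_space :: "('f::field \<Rightarrow> 'a::ab_group_add \<Rightarrow> 'a) \<Rightarrow> (int \<Rightarrow> 'a set) \<Rightarrow> bool" where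
  "graded_space s G \<longleftrightarrow>
     vector_space s \<and> (\<forall>n. module.subspace s (G n)) \<and>
     (\<forall>v. \<exists>!c. (\<forall>n. c n \<in> G n) \<and> finite {n. c n \<noteq> 0} \<and> v = Sum_any c)"

definition degree_map :: "(int \<Rightarrow> 'a set) \<Rightarrow> (int \<Rightarrow> 'b set) \<Rightarrow> int \<Rightarrow> ('a \<Rightarrow> 'b) \<Rightarrow> bool" where
  "degree_map G G' k f \<longleftrightarrow> (\<forall>n. f ` G n \<subseteq> G' (n + k))"

definition concentrated :: "(int \<Rightarrow> 'a::zero set) \<Rightarrow> int set \<Rightarrow> bool" where
  "concentrated G N \<longleftrightarrow> (\<forall>n. n \<notin> N \<longrightarrow> G n = {0})"

definition koszul :: "int \<Rightarrow> 'f::comm_ring_1" where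
  "koszul n = (if even n then 1 else - 1)"

definition dg_lie ::
  "('f::field \<Rightarrow> 'a::ab_group_add \<Rightarrow> 'a) \<Rightarrow> (int \<Rightarrow> 'a set) \<Rightarrow> ('a \<Rightarrow> 'a) \<Rightarrow> ('a \<Rightarrow> 'a \<Rightarrow> 'a) \<Rightarrow> bool" where
  "dg_lie s G d br \<longleftrightarrow>
     graded_space s G \<and>
     Vector_Spaces.linear s s d \<and> degree_map G G (-1) d \<and> (\<forall>x. d (d x) = 0) \<and>
     (\<forall>x. Vector_Spaces.linear s s (br x)) \<and> (\<forall>y. Vector_Spaces.linear s s (\<lambda>x. br x y)) \<and>
     (\<forall>m n. \<forall>x\<in>G m. \<forall>y\<in>G n.
        br x y \<in> G (m + n) \<and>
        br x y = - s (koszul (m * n)) (br y x) \<and>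
        d (br x y) = br (d x) y + s (koszul m) (br x (d y)) \<and>
        (\<forall>z. br x (br y z) = br (br x y) z + s (koszul (m * n)) (br y (br x z))))"

text \<open>
  \<open>contraction s G d s' G' nab p h\<close>: a contraction of the chain complex \<open>(s, G, d)\<close> onto the graded
  vector space \<open>(s', G')\<close> with zero differential. The identities force \<open>nab\<close> to induce an isomorphism
  of \<open>(s', G')\<close> with the homology of \<open>d\<close> (next lemma), so this is a contraction onto the homology.
\<close>

definition contraction ::
  "('f::field \<Rightarrow> 'a::ab_group_add \<Rightarrow> 'a) \<Rightarrow> (int \<Rightarrow> 'a set) \<Rightarrow> ('a \<Rightarrow> 'a) \<Rightarrow>
   ('f \<Rightarrow> 'b::ab_group_add \<Rightarrow> 'b) \<Rightarrow> (int \<Rightarrow> 'b set) \<Rightarrow>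
   ('b \<Rightarrow> 'a) \<Rightarrow> ('a \<Rightarrow> 'b) \<Rightarrow> ('a \<Rightarrow> 'a) \<Rightarrow> bool" where
  "contraction s G d s' G' nab p h \<longleftrightarrow>
     graded_space s' G' \<and>
     Vector_Spaces.linear s' s nab \<and> degree_map G' G 0 nab \<and> (\<forall>u. d (nab u) = 0) \<and>
     Vector_Spaces.linear s s' p \<and> degree_map G G' 0 p \<and> (\<forall>x. p (d x) = 0) \<and>
     Vector_Spaces.linear s s h \<and> degree_map G G 1 h \<and>
     (\<forall>u. p (nab u) = u) \<and> (\<forall>x. d (h x) + h (d x) = x - nab (p x)) \<and>
     (\<forall>x. p (h x) = 0) \<and> (\<forall>u. h (nab u) = 0) \<and> (\<forall>x. h (h x) = 0)"

lemma contraction_homology: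
  assumes "contraction s G d s' G' nab p h"
  shows "d (nab u) = 0" and "d x = 0 \<Longrightarrow> \<exists>!u. x - nab u \<in> range d"
proof -
  note c = assms[unfolded contraction_def]
  have lin: "Vector_Spaces.linear s s h" "Vector_Spaces.linear s s' p" using c by auto
  show "d (nab u) = 0" using c by blast
  assume x: "d x = 0"
  have h0: "h 0 = 0"
    using lin(1) unfolding Vector_Spaces.linear_def module_hom_iff_linear[symmetric]
    by (metis lin(1) module_hom.zero module_hom_iff_linear)
  show "\<exists>!u. x - nab u \<in> range d"
  proof
    have "d (h x) = x - nab (p x)" using c x h0 by (metis add.right_neutral)
    then show "x - nab (p x) \<in> range d" by (metis rangeI)
  next
    fix u assume "x - nab u \<in> range d"
    then have "p (x - nab u) = 0" using c by auto
    moreover have "p (x - nab u) = p x - p (nab u)"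
      using lin(2) by (metis module_hom.diff module_hom_iff_linear)
    ultimately show "u = p x" using c by simp
  qed
qed

text \<open>
  The suspension of a graded vector space has the same underlying vector space, with the degrees
  raised by one; the suspension map is then the identity on underlying vectors. A map \<open>f\<close> of odd
  degree becomes \<open>- f\<close>, by the sign rule; a map of degree zero is left unchanged.
\<close>

definition susp :: "(int \<Rightarrow> 'a set) \<Rightarrow> int \<Rightarrow> 'a set" where
  "susp G n = G (n - 1)"

definition susp_odd :: "('a \<Rightarrow> 'b::ab_group_add) \<Rightarrow> 'a \<Rightarrow> 'b" where
  "susp_odd f x = - f x"


section \<open>Tensors\<close>

text \<open>
  A tensor over a graded vector space \<open>V = (s, G)\<close> is represented by its values on words of
  homogeneous linear functionals: \<open>v\<^sub>1 \<otimes> \<dots> \<otimes> v\<^sub>j\<close> is the function whose value on a word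
  \<open>(\<phi>\<^sub>1, \<dots>, \<phi>\<^sub>j)\<close> is the product of the \<open>\<phi>\<^sub>i(v\<^sub>i)\<close> (no sign), and whose value on words of other
  lengths is zero. Since homogeneous functionals separate points, this embeds the tensor coalgebra
  on \<open>V\<close> (in any dimension) into functions on words; likewise the tensor product of two spaces of
  functions embeds into functions on the product. Letters carry the degree \<open>n\<close> of the component on
  which the functional is supported.
\<close>

type_synonym ('f, 'a) word = "(int \<times> ('a \<Rightarrow> 'f)) list"
type_synonym ('f, 'a) tens = "('f, 'a) word \<Rightarrow> 'f"
type_synonym ('f, 'a) tens2 = "('f, 'a) word \<times> ('f, 'a) word \<Rightarrow> 'f"

definition hdual :: "('f::field \<Rightarrow> 'a::ab_group_add \<Rightarrow> 'a) \<Rightarrow> (int \<Rightarrow> 'a set) \<Rightarrow> int \<Rightarrow> ('a \<Rightarrow> 'f) set" where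
  "hdual s G n = {\<phi>. Vector_Spaces.linear s (*) \<phi> \<and> (\<forall>m. m \<noteq> n \<longrightarrow> (\<forall>v\<in>G m. \<phi> v = 0))}"

definition hword :: "('f::field \<Rightarrow> 'a::ab_group_add \<Rightarrow> 'a) \<Rightarrow> (int \<Rightarrow> 'a set) \<Rightarrow> ('f, 'a) word \<Rightarrow> bool" where
  "hword s G w \<longleftrightarrow> (\<forall>(n, \<phi>)\<in>set w. \<phi> \<in> hdual s G n)"

definition wdeg :: "('f, 'a) word \<Rightarrow> int" where
  "wdeg w = sum_list (map fst w)"

definition pure_tensor ::
  "('f::field \<Rightarrow> 'a::ab_group_add \<Rightarrow> 'a) \<Rightarrow> (int \<Rightarrow> 'a set) \<Rightarrow> 'a list \<Rightarrow> ('f, 'a) tens" where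
  "pure_tensor s G us = (\<lambda>w. if hword s G w \<and> length w = length us
                             then prod_list (map2 (\<lambda>u (n, \<phi>). \<phi> u) us w) else 0)"

definition fscale :: "'f::field \<Rightarrow> ('x \<Rightarrow> 'f) \<Rightarrow> 'x \<Rightarrow> 'f" where
  "fscale c t = (\<lambda>x. c * t x)"

lemma vector_space_fscale: "vector_space fscale"
  by unfold_locales (auto simp: fscale_def fun_eq_iff algebra_simps)

text \<open>
  Invariance under the symmetric groups, for the action by permutations with Koszul signs. It is
  enough to consider adjacent transpositions; on homogeneous vectors of degrees \<open>m\<close>, \<open>n\<close> these act by
  \<open>u \<otimes> v \<mapsto> (-1)\<^sup>m\<^sup>n v \<otimes> u\<close>.
\<close>

definition graded_symmetric :: "('f::field, 'a) tens \<Rightarrow> bool" where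
  "graded_symmetric t \<longleftrightarrow>
     (\<forall>w w' m n \<phi> \<psi>. t (w @ (m, \<phi>) # (n, \<psi>) # w') = koszul (m * n) * t (w @ (n, \<psi>) # (m, \<phi>) # w'))"

text \<open>
  \<open>Sc s G U\<close> is the symmetric coalgebra cogenerated by the graded subspace \<open>U\<close> of \<open>(s, G)\<close>;
  \<open>Sc s G UNIV\<close> is the symmetric coalgebra cogenerated by \<open>(s, G)\<close>.
\<close>

definition Sc :: "('f::field \<Rightarrow> 'a::ab_group_add \<Rightarrow> 'a) \<Rightarrow> (int \<Rightarrow> 'a set) \<Rightarrow> 'a set \<Rightarrow> ('f, 'a) tens set" where
  "Sc s G U = {t \<in> module.span fscale {pure_tensor s G us | us. set us \<subseteq> U}. graded_symmetric t}"

definition tensor_length :: "nat \<Rightarrow> ('f::zero, 'a) tens \<Rightarrow> ('f, 'a) tens" where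
  "tensor_length l t = (\<lambda>w. if length w = l then t w else 0)"

definition homogeneous :: "int \<Rightarrow> ('f::zero, 'a) tens \<Rightarrow> bool" where
  "homogeneous n t \<longleftrightarrow> (\<forall>w. t w \<noteq> 0 \<longrightarrow> wdeg w = n)"

text \<open>\<open>parity t = (-1)\<^sup>|\<^sup>t\<^sup>| t\<close> for homogeneous \<open>t\<close>.\<close>

definition parity :: "('f::field, 'a) tens \<Rightarrow> ('f, 'a) tens" where
  "parity t = (\<lambda>w. koszul (wdeg w) * t w)"

definition lin_on ::
  "('f \<Rightarrow> 'a \<Rightarrow> 'a) \<Rightarrow> ('f \<Rightarrow> 'b \<Rightarrow> 'b) \<Rightarrow> 'a::plus set \<Rightarrow> ('a \<Rightarrow> 'b::plus) \<Rightarrow> bool" where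
  "lin_on s s' S f \<longleftrightarrow> (\<forall>x\<in>S. \<forall>y\<in>S. f (x + y) = f x + f y) \<and> (\<forall>c. \<forall>x\<in>S. f (s c x) = s' c (f x))"

definition tprod :: "('x \<Rightarrow> 'f::times) \<Rightarrow> ('y \<Rightarrow> 'f) \<Rightarrow> 'x \<times> 'y \<Rightarrow> 'f" where
  "tprod p q = (\<lambda>(x, y). p x * q y)"

text \<open>
  The linear map \<open>P \<otimes> Q \<rightarrow> W\<close> with \<open>p \<otimes> q \<mapsto> \<beta> p q\<close>, for a bilinear map \<open>\<beta>\<close> on \<open>P \<times> Q\<close>.
\<close>

definition tlift ::
  "('x \<Rightarrow> 'f::field) set \<Rightarrow> ('y \<Rightarrow> 'f) set \<Rightarrow>
   (('x \<Rightarrow> 'f) \<Rightarrow> ('y \<Rightarrow> 'f) \<Rightarrow> 'w::ab_group_add) \<Rightarrow> ('x \<times> 'y \<Rightarrow> 'f) \<Rightarrow> 'w" where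
  "tlift P Q \<beta> z = (THE w. \<exists>xs. set xs \<subseteq> P \<times> Q \<and>
      z = sum_list (map (\<lambda>(p, q). tprod p q) xs) \<and> w = sum_list (map (\<lambda>(p, q). \<beta> p q) xs))"


section \<open>Coalgebras of tensors\<close>

text \<open>The diagonal of the tensor coalgebra is deconcatenation.\<close>

definition diag :: "('f, 'a) tens \<Rightarrow> ('f, 'a) tens2" where
  "diag t = (\<lambda>(x, y). t (x @ y))"

definition counit :: "('f, 'a) tens \<Rightarrow> 'f" where
  "counit t = t []"

definition subcoalgebra :: "('f::field, 'a) tens set \<Rightarrow> bool" where
  "subcoalgebra C \<longleftrightarrow> module.subspace fscale C \<and>
     (\<forall>t\<in>C. diag t \<in> module.span fscale {tprod p q | p q. p \<in> C \<and> q \<in> C})"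

definition coalgebra_map ::
  "('f::field, 'a) tens set \<Rightarrow> ('f, 'b) tens set \<Rightarrow> (('f, 'a) tens \<Rightarrow> ('f, 'b) tens) \<Rightarrow> bool" where
  "coalgebra_map C C' F \<longleftrightarrow>
     lin_on fscale fscale C F \<and> F ` C \<subseteq> C' \<and>
     (\<forall>t\<in>C. diag (F t) = tlift C C (\<lambda>p q. tprod (F p) (F q)) (diag t)) \<and>
     (\<forall>t\<in>C. counit (F t) = counit t)"

definition coalgebra_iso ::
  "('f::field, 'a) tens set \<Rightarrow> ('f, 'b) tens set \<Rightarrow> (('f, 'a) tens \<Rightarrow> ('f, 'b) tens) \<Rightarrow> bool" where
  "coalgebra_iso C C' F \<longleftrightarrow>
     subcoalgebra C \<and> subcoalgebra C' \<and> coalgebra_map C C' F \<and> bij_betw F C C'"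

text \<open>A coderivation of degree \<open>-1\<close>: \<open>\<Delta> D = (D \<otimes> Id + Id \<otimes> D) \<Delta>\<close>, with the Koszul sign in \<open>Id \<otimes> D\<close>.\<close>

definition coderivation :: "('f::field, 'a) tens set \<Rightarrow> (('f, 'a) tens \<Rightarrow> ('f, 'a) tens) \<Rightarrow> bool" where
  "coderivation C D \<longleftrightarrow>
     lin_on fscale fscale C D \<and> D ` C \<subseteq> C \<and>
     (\<forall>n. \<forall>t\<in>C. homogeneous n t \<longrightarrow> homogeneous (n - 1) (D t)) \<and>
     (\<forall>t\<in>C. diag (D t) = tlift C C (\<lambda>p q. tprod (D p) q + tprod (parity p) (D q)) (diag t))"

text \<open>The projection of the tensor coalgebra to its cogenerators.\<close>

definition corestrict ::
  "('f::field \<Rightarrow> 'a::ab_group_add \<Rightarrow> 'a) \<Rightarrow> (int \<Rightarrow> 'a set) \<Rightarrow> ('f, 'a) tens \<Rightarrow> 'a" where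
  "corestrict s G t = (THE v. \<forall>n. \<forall>\<phi>\<in>hdual s G n. t [(n, \<phi>)] = \<phi> v)"

text \<open>
  The morphism of coaugmented graded coalgebras from \<open>Sc\<close> on \<open>(s, G)\<close> to \<open>Sc\<close> on \<open>(s', G')\<close> with
  corestriction \<open>f\<close>. It is unique on \<open>Sc s G UNIV\<close>; its values elsewhere play no role.
\<close>

definition coalgebra_lift ::
  "('f::field \<Rightarrow> 'a::ab_group_add \<Rightarrow> 'a) \<Rightarrow> (int \<Rightarrow> 'a set) \<Rightarrow>
   ('f \<Rightarrow> 'b::ab_group_add \<Rightarrow> 'b) \<Rightarrow> (int \<Rightarrow> 'b set) \<Rightarrow>
   (('f, 'a) tens \<Rightarrow> 'b) \<Rightarrow> ('f, 'a) tens \<Rightarrow> ('f, 'b) tens" where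
  "coalgebra_lift s G s' G' f = (SOME F.
     coalgebra_map (Sc s G UNIV) (Sc s' G' UNIV) F \<and>
     (\<forall>n. \<forall>t\<in>Sc s G UNIV. homogeneous n t \<longrightarrow> homogeneous n (F t)) \<and>
     F (pure_tensor s G []) = pure_tensor s' G' [] \<and>
     (\<forall>t\<in>Sc s G UNIV. corestrict s' G' (F t) = f t))"

text \<open>
  The coderivation of degree \<open>-1\<close> with corestriction \<open>\<theta>\<close>; again unique on \<open>Sc s G UNIV\<close>.
\<close>

definition coder_lift ::
  "('f::field \<Rightarrow> 'a::ab_group_add \<Rightarrow> 'a) \<Rightarrow> (int \<Rightarrow> 'a set) \<Rightarrow>
   (('f, 'a) tens \<Rightarrow> 'a) \<Rightarrow> ('f, 'a) tens \<Rightarrow> ('f, 'a) tens" where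
  "coder_lift s G \<theta> = (SOME D.
     coderivation (Sc s G UNIV) D \<and> (\<forall>t\<in>Sc s G UNIV. corestrict s G (D t) = \<theta> t))"

text \<open>
  The map of tensors \<open>v\<^sub>1 \<otimes> \<dots> \<otimes> v\<^sub>j \<mapsto> f v\<^sub>1 \<otimes> \<dots> \<otimes> f v\<^sub>j\<close> induced by a degree zero linear map \<open>f\<close> to
  \<open>(s', G')\<close>; on functionals it is precomposition with \<open>f\<close>.
\<close>

definition Sc_map ::
  "('f::field \<Rightarrow> 'b::ab_group_add \<Rightarrow> 'b) \<Rightarrow> (int \<Rightarrow> 'b set) \<Rightarrow>
   ('a \<Rightarrow> 'b) \<Rightarrow> ('f, 'a) tens \<Rightarrow> ('f, 'b) tens" where
  "Sc_map s' G' f t = (\<lambda>w. if hword s' G' w then t (map (\<lambda>(n, \<psi>). (n, \<psi> \<circ> f)) w) else 0)"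

lemma Sc_map_pure_tensor:
  assumes "Vector_Spaces.linear s s' f" "degree_map G G' 0 f"
  shows "Sc_map s' G' f (pure_tensor s G us) = pure_tensor s' G' (map f us)"
proof
  fix w
  have *: "\<psi> \<circ> f \<in> hdual s G n" if "\<psi> \<in> hdual s' G' n" for n \<psi>
    using that assms unfolding hdual_def degree_map_def
    by (auto simp: image_subset_iff intro: Vector_Spaces.linear_compose)
  have "hword s G (map (\<lambda>(n, \<psi>). (n, \<psi> \<circ> f)) w)" if "hword s' G' w"
    using that * unfolding hword_def by auto
  moreover have "prod_list (map2 (\<lambda>u (n, \<phi>). \<phi> u) us (map (\<lambda>(n, \<psi>). (n, \<psi> \<circ> f)) w)) =
      prod_list (map2 (\<lambda>u (n, \<phi>). \<phi> u) (map f us) w)"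
    by (rule arg_cong[where f = prod_list], rule nth_equalityI) (auto simp: split_beta)
  ultimately show "Sc_map s' G' f (pure_tensor s G us) w = pure_tensor s' G' (map f us) w"
    unfolding Sc_map_def pure_tensor_def by auto
qed


section \<open>The recursive construction\<close>

text \<open>
  Throughout, \<open>(sH, GH)\<close> is the homology, and the symmetric coalgebra is cogenerated by its
  suspension \<open>(sH, susp GH)\<close>. As the suspension is the identity on underlying vectors,
  \<open>\<tau>\<^sub>H\<close> is \<open>corestrict sH (susp GH)\<close>.

  \<open>conv_bracket C br a b\<close> is the composite of the diagonal of \<open>C\<close>, \<open>a \<otimes> b\<close>, and the bracket, for
  \<open>a\<close>, \<open>b\<close> of degree \<open>-1\<close>, whence the Koszul sign \<open>(a \<otimes> b) (p \<otimes> q) = (-1)\<^sup>|\<^sup>p\<^sup>| a p \<otimes> b q\<close>.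
\<close>

definition conv_bracket ::
  "('f::field, 'b) tens set \<Rightarrow> ('a \<Rightarrow> 'a \<Rightarrow> 'a) \<Rightarrow>
   (('f, 'b) tens \<Rightarrow> 'a) \<Rightarrow> (('f, 'b) tens \<Rightarrow> 'a) \<Rightarrow> ('f, 'b) tens \<Rightarrow> 'a::ab_group_add" where
  "conv_bracket C br a b t = tlift C C (\<lambda>p q. br (a (parity p)) (b q)) (diag t)"

fun tau_part ::
  "('f::field \<Rightarrow> 'a::ab_group_add \<Rightarrow> 'a) \<Rightarrow> ('a \<Rightarrow> 'a \<Rightarrow> 'a) \<Rightarrow>
   ('f \<Rightarrow> 'b::ab_group_add \<Rightarrow> 'b) \<Rightarrow> (int \<Rightarrow> 'b set) \<Rightarrow> ('b \<Rightarrow> 'a) \<Rightarrow> ('a \<Rightarrow> 'a) \<Rightarrow>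
   nat \<Rightarrow> ('f, 'b) tens \<Rightarrow> 'a" where
  "tau_part s br sH GH nab h l =
     (if l = 0 then (\<lambda>t. 0)
      else if l = 1 then (\<lambda>t. nab (corestrict sH (susp GH) t))
      else (\<lambda>t. s (1 / 2) (h (\<Sum>i\<in>{1..<l}.
              conv_bracket (Sc sH (susp GH) UNIV) br
                (tau_part s br sH GH nab h i) (tau_part s br sH GH nab h (l - i))
                (tensor_length l t)))))"

declare tau_part.simps [simp del]

definition tau ::
  "('f::field \<Rightarrow> 'a::ab_group_add \<Rightarrow> 'a) \<Rightarrow> ('a \<Rightarrow> 'a \<Rightarrow> 'a) \<Rightarrow>
   ('f \<Rightarrow> 'b::ab_group_add \<Rightarrow> 'b) \<Rightarrow> (int \<Rightarrow> 'b set) \<Rightarrow> ('b \<Rightarrow> 'a) \<Rightarrow> ('a \<Rightarrow> 'a) \<Rightarrow>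
   ('f, 'b) tens \<Rightarrow> 'a" where
  "tau s br sH GH nab h t = Sum_any (\<lambda>j. tau_part s br sH GH nab h (Suc j) t)"

definition DD_part ::
  "('f::field \<Rightarrow> 'a::ab_group_add \<Rightarrow> 'a) \<Rightarrow> ('a \<Rightarrow> 'a \<Rightarrow> 'a) \<Rightarrow>
   ('f \<Rightarrow> 'b::ab_group_add \<Rightarrow> 'b) \<Rightarrow> (int \<Rightarrow> 'b set) \<Rightarrow> ('b \<Rightarrow> 'a) \<Rightarrow> ('a \<Rightarrow> 'b) \<Rightarrow> ('a \<Rightarrow> 'a) \<Rightarrow>
   nat \<Rightarrow> ('f, 'b) tens \<Rightarrow> ('f, 'b) tens" where
  "DD_part s br sH GH nab p h j =
     coder_lift sH (susp GH) (\<lambda>t. sH (1 / 2) (p (\<Sum>i\<in>{1..<Suc j}.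
       conv_bracket (Sc sH (susp GH) UNIV) br
         (tau_part s br sH GH nab h i) (tau_part s br sH GH nab h (Suc j - i))
         (tensor_length (Suc j) t))))"

definition DD ::
  "('f::field \<Rightarrow> 'a::ab_group_add \<Rightarrow> 'a) \<Rightarrow> ('a \<Rightarrow> 'a \<Rightarrow> 'a) \<Rightarrow>
   ('f \<Rightarrow> 'b::ab_group_add \<Rightarrow> 'b) \<Rightarrow> (int \<Rightarrow> 'b set) \<Rightarrow> ('b \<Rightarrow> 'a) \<Rightarrow> ('a \<Rightarrow> 'b) \<Rightarrow> ('a \<Rightarrow> 'a) \<Rightarrow>
   ('f, 'b) tens \<Rightarrow> ('f, 'b) tens" where
  "DD s br sH GH nab p h t = Sum_any (\<lambda>j. DD_part s br sH GH nab p h (Suc j) t)"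

text \<open>The bracket of \<open>k\<^sub>a\<close>.\<close>

definition bracket_a :: "('a \<Rightarrow> 'a) \<Rightarrow> ('a \<Rightarrow> 'a) \<Rightarrow> ('a \<Rightarrow> 'a \<Rightarrow> 'a) \<Rightarrow> 'a \<Rightarrow> 'a \<Rightarrow> 'a" where
  "bracket_a d h br x y = d (h (br x y))"

text \<open>The adjoint of the twisting cochain \<open>\<tau>\<close> with values in \<open>k\<^sub>a\<close>.\<close>

definition tau_bar ::
  "('f::field \<Rightarrow> 'a::ab_group_add \<Rightarrow> 'a) \<Rightarrow> (int \<Rightarrow> 'a set) \<Rightarrow> ('a \<Rightarrow> 'a) \<Rightarrow> ('a \<Rightarrow> 'a \<Rightarrow> 'a) \<Rightarrow>
   ('f \<Rightarrow> 'b::ab_group_add \<Rightarrow> 'b) \<Rightarrow> (int \<Rightarrow> 'b set) \<Rightarrow> ('b \<Rightarrow> 'a) \<Rightarrow> ('a \<Rightarrow> 'a) \<Rightarrow>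
   ('f, 'b) tens \<Rightarrow> ('f, 'a) tens" where
  "tau_bar s G d br sH GH nab h =
     coalgebra_lift sH (susp GH) s (susp G) (tau s (bracket_a d h br) sH GH nab h)"

text \<open>
  The degree zero homology of \<open>Sc\<close> on \<open>(sH, susp GH)\<close> with differential \<open>DD\<close>; there is nothing in
  degree one when the homology is concentrated in degrees \<open>-1\<close> and \<open>-2\<close>.
\<close>

definition kuranishi_coalgebra ::
  "('f::field \<Rightarrow> 'a::ab_group_add \<Rightarrow> 'a) \<Rightarrow> ('a \<Rightarrow> 'a \<Rightarrow> 'a) \<Rightarrow>
   ('f \<Rightarrow> 'b::ab_group_add \<Rightarrow> 'b) \<Rightarrow> (int \<Rightarrow> 'b set) \<Rightarrow> ('b \<Rightarrow> 'a) \<Rightarrow> ('a \<Rightarrow> 'b) \<Rightarrow> ('a \<Rightarrow> 'a) \<Rightarrow>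
   ('f, 'b) tens set" where
  "kuranishi_coalgebra s br sH GH nab p h =
     {t \<in> Sc sH (susp GH) (susp GH 0). DD s br sH GH nab p h t = 0}"


section \<open>Affine varieties and their coordinate coalgebras\<close>

text \<open>
  The symmetric algebra on the dual of a finite-dimensional subspace \<open>U\<close>, over an infinite field,
  is the algebra of polynomial functions on \<open>U\<close>. Functions on \<open>U\<close> are extended by zero outside \<open>U\<close>.
\<close>

definition on_set :: "'a set \<Rightarrow> ('a \<Rightarrow> 'f::zero) \<Rightarrow> 'a \<Rightarrow> 'f" where
  "on_set U g = (\<lambda>v. if v \<in> U then g v else 0)"

definition hpoly :: "('f::field \<Rightarrow> 'a::ab_group_add \<Rightarrow> 'a) \<Rightarrow> 'a set \<Rightarrow> nat \<Rightarrow> ('a \<Rightarrow> 'f) set" where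
  "hpoly s U j = module.span fscale
     {on_set U (\<lambda>v. prod_list (map (\<lambda>\<phi>. \<phi> v) \<phi>s)) | \<phi>s.
        length \<phi>s = j \<and> (\<forall>\<phi>\<in>set \<phi>s. Vector_Spaces.linear s (*) \<phi>)}"

definition polys :: "('f::field \<Rightarrow> 'a::ab_group_add \<Rightarrow> 'a) \<Rightarrow> 'a set \<Rightarrow> ('a \<Rightarrow> 'f) set" where
  "polys s U = module.span fscale (\<Union>j. hpoly s U j)"

definition poly_ideal ::
  "('f::field \<Rightarrow> 'a::ab_group_add \<Rightarrow> 'a) \<Rightarrow> 'a set \<Rightarrow> ('a \<Rightarrow> 'f) set \<Rightarrow> ('a \<Rightarrow> 'f) set" where
  "poly_ideal s U Y = module.span fscale {(\<lambda>v. r v * y v) | r y. r \<in> polys s U \<and> y \<in> Y}"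

definition generators ::
  "('f::field \<Rightarrow> 'a::ab_group_add \<Rightarrow> 'a) \<Rightarrow> 'a set \<Rightarrow> ('a \<Rightarrow> 'f) set \<Rightarrow> ('a \<Rightarrow> 'f) set \<Rightarrow> bool" where
  "generators s U I Y \<longleftrightarrow> finite Y \<and> Y \<subseteq> polys s U \<and> poly_ideal s U Y = I"

text \<open>
  The linear form on \<open>Sc s G U\<close> with \<open>v \<otimes> \<dots> \<otimes> v \<mapsto> y\<^sub>j(v)\<close> (\<open>j\<close> factors) for the homogeneous parts
  \<open>y\<^sub>j\<close> of the polynomial \<open>y\<close>. It is unique on \<open>Sc s G U\<close> when \<open>U\<close> is of degree zero and the field
  is of characteristic zero.
\<close>

definition poly_form ::
  "('f::field \<Rightarrow> 'a::ab_group_add \<Rightarrow> 'a) \<Rightarrow> (int \<Rightarrow> 'a set) \<Rightarrow> 'a set \<Rightarrow> ('a \<Rightarrow> 'f) \<Rightarrow> ('f, 'a) tens \<Rightarrow> 'f" where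
  "poly_form s G U y = (SOME L. lin_on fscale (*) (Sc s G U) L \<and>
     (\<exists>c. (\<forall>j. c j \<in> hpoly s U j) \<and> finite {j. c j \<noteq> 0} \<and> y = Sum_any c \<and>
          (\<forall>j. \<forall>v\<in>U. L (pure_tensor s G (replicate j v)) = c j v)))"

text \<open>
  The coordinate coalgebra, the kernel of \<open>(Id \<otimes> y) \<Delta>\<close>, of the affine variety in \<open>U\<close> whose ideal is
  generated by \<open>Y\<close>.
\<close>

definition coord_coalgebra ::
  "('f::field \<Rightarrow> 'a::ab_group_add \<Rightarrow> 'a) \<Rightarrow> (int \<Rightarrow> 'a set) \<Rightarrow> 'a set \<Rightarrow> ('a \<Rightarrow> 'f) set \<Rightarrow> ('f, 'a) tens set" where
  "coord_coalgebra s G U Y = {t \<in> Sc s G U. \<forall>y\<in>Y.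
     tlift (Sc s G U) (Sc s G U) (\<lambda>p q. fscale (poly_form s G U y q) p) (diag t) = 0}"

text \<open>
  The ideal of the zero locus of a polynomial map \<open>f\<close> on \<open>U\<close>, as a variety over the ground field,
  is the ideal generated by the components of \<open>f\<close> (that is, the zero locus is taken with its scheme
  structure). It cannot be replaced by the ideal of all polynomials that vanish at the rational (or
  geometric) points: for zero differential and \<open>q(v) = v\<^sup>2\<close> on a line the latter is generated by
  \<open>v\<close>, whereas the Kuranishi coalgebra is two-dimensional.
\<close>

definition zero_locus_ideal ::
  "('f::field \<Rightarrow> 'a::ab_group_add \<Rightarrow> 'a) \<Rightarrow> 'a set \<Rightarrow> ('a \<Rightarrow> 'a) \<Rightarrow> ('a \<Rightarrow> 'f) set" where
  "zero_locus_ideal s U f =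
     poly_ideal s U {on_set U (\<lambda>v. \<chi> (f v)) | \<chi>. Vector_Spaces.linear s (*) \<chi>}"

definition quad :: "('f::field \<Rightarrow> 'a \<Rightarrow> 'a) \<Rightarrow> ('a \<Rightarrow> 'a \<Rightarrow> 'a) \<Rightarrow> 'a \<Rightarrow> 'a" where
  "quad s br v = s (1 / 2) (br v v)"

text \<open>
  \<open>M_map\<close> is \<open>x \<mapsto> x\<^sub>2 + h (q\<^sub>B x)\<close>, where \<open>x\<^sub>2 = h d x\<close> is the component of \<open>x\<close> in \<open>A\<^sub>0\<close> and
  \<open>q\<^sub>B = d h q\<close> that of \<open>q\<close> in \<open>B\<^sub>-\<^sub>1\<close>, with \<open>d\<close>, \<open>h\<close> the operators on the suspension.
\<close>

definition M_map ::
  "('f::field \<Rightarrow> 'a::ab_group_add \<Rightarrow> 'a) \<Rightarrow> ('a \<Rightarrow> 'a) \<Rightarrow> ('a \<Rightarrow> 'a \<Rightarrow> 'a) \<Rightarrow> ('a \<Rightarrow> 'a) \<Rightarrow> 'a \<Rightarrow> 'a" where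
  "M_map s d br h x =
     susp_odd h (susp_odd d x) + susp_odd h (susp_odd d (susp_odd h (quad s br x)))"

definition J_map ::
  "('f::field \<Rightarrow> 'a::ab_group_add \<Rightarrow> 'a) \<Rightarrow> ('a \<Rightarrow> 'a) \<Rightarrow> ('a \<Rightarrow> 'a \<Rightarrow> 'a) \<Rightarrow> 'a \<Rightarrow> 'a" where
  "J_map s d br x = susp_odd d x + quad s br x"

end

theory Submission
  imports Defs "HOL-Computational_Algebra.Polynomial" "HOL-Combinatorics.Permutations"
begin

text \<open>
  An element of the symmetric coalgebra is determined by its rows \<open>\<lambda>z. t (x @ z)\<close>, which again lie in
  the coalgebra, and the convolution of two linear maps \<open>\<alpha>\<close>, \<open>\<beta>\<close> is \<open>\<alpha> (\<lambda>x. \<beta> (\<lambda>y. t (x @ y)))\<close>. In these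
  terms the morphism and the coderivation with given corestriction have explicit recursive formulas, and
  uniqueness becomes an induction on words. Since powers \<open>v \<otimes> \<dots> \<otimes> v\<close> span the symmetric
  tensors in degree zero, the coordinate coalgebra of the zero locus of \<open>f = f\<^sub>1 + f\<^sub>2\<close> (linear plus
  quadratic) consists of the \<open>t\<close> all of whose rows are annihilated by the linear map which \<open>f\<close> induces
  on the coalgebra. For \<open>f = M_map\<close> this equation is \<open>x = \<nabla> \<pi> x + h (q x)\<close>, the recursion that defines
  \<open>\<tau>\<close>; hence the adjoint of \<open>\<tau>\<close> maps into \<open>C[M]\<close>, and induction on the tensor length shows that it inverts
  the projection there. Finally \<open>J = - d M + \<nabla> \<pi> q\<close>, so within \<open>C[M]\<close> the coalgebra \<open>C[V]\<close> is cut
  out by \<open>\<pi> q\<close>, whose pullback along the adjoint is the corestriction of the differential.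
\<close>

section \<open>Linear maps and tensor products of function spaces\<close>

text \<open>\<open>tlift\<close>, \<open>coalgebra_lift\<close>, \<open>coder_lift\<close> and
  \<open>poly_form\<close> are given by description or choice, so nothing can be computed before
  existence and uniqueness are settled; this accounts for the first half of the development. For
  \<open>tlift\<close> the point is that a tensor product of function spaces embeds into functions
  on pairs. For the two lifts the delicate point is graded symmetry of the formula: a homogeneous
  functional sees only one degree, and this makes the Koszul sign constant. Characteristic zero is
  used for \<open>poly_form\<close> twice, for averaging over permutations and for separating the
  homogeneous parts of a polynomial function. In degree zero the signs disappear and rows and
  columns of a tensor coincide. The length induction works because the cochain and the corestriction
  both vanish on the coaugmentation, so that the quadratic term sees only shorter tensors. The
  vanishing of the differential on \<open>t\<close> is a condition on rows because a word with a
  single letter of degree \<open>-1\<close> isolates one value of the corestriction.\<close>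

interpretation fs: vector_space "fscale :: 'f::field \<Rightarrow> ('x \<Rightarrow> 'f) \<Rightarrow> 'x \<Rightarrow> 'f"
  by (rule vector_space_fscale)

lemma sum_list_fun_apply: "sum_list (map F xs) x = sum_list (map (\<lambda>i. F i x) xs)"
  for F :: "'i \<Rightarrow> 'x \<Rightarrow> 'f::ab_group_add"
  by (induction xs) (auto simp: zero_fun_def plus_fun_def)

lemma prod_fun_ext: "(\<And>x y. f (x, y) = g (x, y)) \<Longrightarrow> f = g"
  by (simp add: fun_eq_iff split_paired_all)

lemma lin_onI:
  assumes "\<And>x y. x \<in> S \<Longrightarrow> y \<in> S \<Longrightarrow> f (x + y) = f x + f y" "\<And>c x. x \<in> S \<Longrightarrow> f (s c x) = s' c (f x)"
  shows "lin_on s s' S f"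
  using assms by (auto simp: lin_on_def)

lemma lin_on_subset: "lin_on s s' S f \<Longrightarrow> S' \<subseteq> S \<Longrightarrow> lin_on s s' S' f"
  by (simp add: lin_on_def subset_iff)

lemma lin_on_cong:
  assumes "lin_on s s' S f" "module.subspace s S" "vector_space s" "\<And>x. x \<in> S \<Longrightarrow> f x = g x"
  shows "lin_on s s' S g"
proof -
  interpret s: vector_space s by fact
  show ?thesis
    using assms(1,4) s.subspace_add[OF assms(2)] s.subspace_scale[OF assms(2)]
    by (simp add: lin_on_def)
qed

lemma lin_on_scale: "lin_on s s' S f \<Longrightarrow> x \<in> S \<Longrightarrow> f (s c x) = s' c (f x)"
  by (simp add: lin_on_def)

lemma lin_on_add: "lin_on s s' S f \<Longrightarrow> x \<in> S \<Longrightarrow> y \<in> S \<Longrightarrow> f (x + y) = f x + f y"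
  by (simp add: lin_on_def)

lemma lin_on_zero:
  assumes "lin_on s s' S f" "module.subspace s S" "vector_space s" "vector_space s'"
  shows "f 0 = 0"
proof -
  interpret s: vector_space s by fact
  interpret s': vector_space s' by fact
  have "f (s 0 0) = s' 0 (f 0)" by (rule lin_on_scale[OF assms(1) s.subspace_0[OF assms(2)]])
  then show ?thesis by simp
qed

lemma lin_on_neg:
  assumes "lin_on s s' S f" "x \<in> S" "vector_space s" "vector_space s'"
  shows "f (- x) = - f x"
proof -
  interpret s: vector_space s by fact
  interpret s': vector_space s' by fact
  have "f (s (- 1) x) = s' (- 1) (f x)" by (rule lin_on_scale[OF assms(1,2)])
  then show ?thesis by simp
qed

lemma lin_on_diff:
  assumes "lin_on s s' S f" "x \<in> S" "y \<in> S" "module.subspace s S" "vector_space s" "vector_space s'"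
  shows "f (x - y) = f x - f y"
proof -
  interpret s: vector_space s by fact
  have "f (x + - y) = f x + f (- y)"
    by (rule lin_on_add[OF assms(1,2) s.subspace_neg[OF assms(4,3)]])
  then show ?thesis using lin_on_neg[OF assms(1,3,5,6)] by simp
qed

lemma lin_on_sum_list:
  assumes "lin_on s s' S f" "module.subspace s S" "vector_space s" "vector_space s'"
    and "\<And>i. i \<in> set xs \<Longrightarrow> g i \<in> S"
  shows "f (sum_list (map g xs)) = sum_list (map (\<lambda>i. f (g i)) xs) \<and> sum_list (map g xs) \<in> S"
  using assms(5)
proof (induction xs)
  interpret s: vector_space s by fact
  case Nil
  show ?case using lin_on_zero[OF assms(1-4)] s.subspace_0[OF assms(2)] by simp
next
  interpret s: vector_space s by fact
  case (Cons a xs)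
  then show ?case using assms(1) s.subspace_add[OF assms(2)] by (auto simp: lin_on_def)
qed

lemma lin_on_sum:
  assumes "lin_on s s' S f" "module.subspace s S" "vector_space s" "vector_space s'"
    and "\<And>i. i \<in> I \<Longrightarrow> g i \<in> S"
  shows "f (sum g I) = (\<Sum>i\<in>I. f (g i))"
proof (cases "finite I")
  interpret s: vector_space s by fact
  case True
  then show ?thesis using assms(5)
  proof (induction I)
    case empty
    show ?case using lin_on_zero[OF assms(1-4)] by simp
  next
    case (insert a I)
    have "sum g I \<in> S" using insert by (intro s.subspace_sum[OF assms(2)]) auto
    then show ?case using insert assms(1) by (auto simp: lin_on_def)
  qed
next
  case False
  then show ?thesis using lin_on_zero[OF assms(1-4)] by simp
qed

lemma lin_on_compose:
  assumes "lin_on s s' S f" "Vector_Spaces.linear s' s'' g"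
  shows "lin_on s s'' S (\<lambda>x. g (f x))"
proof -
  interpret g: Vector_Spaces.linear s' s'' g by fact
  show ?thesis using assms(1) by (auto simp: lin_on_def g.add g.scale)
qed

lemma lin_on_span_eq:
  assumes "lin_on s s' S f" "lin_on s s' S g" "module.subspace s S" "vector_space s" "vector_space s'"
    and "B \<subseteq> S" "\<And>b. b \<in> B \<Longrightarrow> f b = g b" "x \<in> module.span s B"
  shows "f x = g x"
proof -
  interpret s: vector_space s by fact
  have "x \<in> S \<and> f x = g x" using assms(8)
  proof (induction rule: s.span_induct_alt)
    case base
    then show ?case using lin_on_zero[OF assms(1,3-5)] lin_on_zero[OF assms(2,3-5)]
        s.subspace_0[OF assms(3)] by simp
  next
    case (step c x y)
    then show ?case using assms(1,2,6,7) s.subspace_add[OF assms(3)] s.subspace_scale[OF assms(3)]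
      by (auto simp: lin_on_def subset_iff)
  qed
  then show ?thesis by simp
qed

section \<open>Bilinear maps and their extension to tensor products\<close>

definition bilin_on ::
  "('f::field \<Rightarrow> 'w::ab_group_add \<Rightarrow> 'w) \<Rightarrow> ('x \<Rightarrow> 'f) set \<Rightarrow> ('y \<Rightarrow> 'f) set \<Rightarrow>
   (('x \<Rightarrow> 'f) \<Rightarrow> ('y \<Rightarrow> 'f) \<Rightarrow> 'w) \<Rightarrow> bool" where
  "bilin_on sW P Q \<beta> \<longleftrightarrow>
     (\<forall>q\<in>Q. lin_on fscale sW P (\<lambda>p. \<beta> p q)) \<and> (\<forall>p\<in>P. lin_on fscale sW Q (\<beta> p))"

lemma bilin_onI:
  assumes "\<And>q. q \<in> Q \<Longrightarrow> lin_on fscale sW P (\<lambda>p. \<beta> p q)" "\<And>p. p \<in> P \<Longrightarrow> lin_on fscale sW Q (\<beta> p)"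
  shows "bilin_on sW P Q \<beta>"
  using assms by (auto simp: bilin_on_def)

lemma bilin_on_subset: "bilin_on sW P Q \<beta> \<Longrightarrow> P' \<subseteq> P \<Longrightarrow> Q' \<subseteq> Q \<Longrightarrow> bilin_on sW P' Q' \<beta>"
  by (simp add: bilin_on_def lin_on_def subset_iff)

text \<open>Decomposable tensors are kept in a list because \<open>tlift\<close> quantifies over
  such presentations of its argument.\<close>

definition tsum :: "(('x \<Rightarrow> 'f::field) \<times> ('y \<Rightarrow> 'f)) list \<Rightarrow> 'x \<times> 'y \<Rightarrow> 'f" where
  "tsum xs = sum_list (map (\<lambda>(p, q). tprod p q) xs)"

lemma tsum_apply: "tsum xs (x, y) = sum_list (map (\<lambda>(p, q). p x * q y) xs)"
  by (simp add: tsum_def sum_list_fun_apply case_prod_unfold tprod_def)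

lemma sum_list_map_add:
  "sum_list (map (\<lambda>i. f i + g i) xs) = sum_list (map f xs) + sum_list (map g xs)"
  for f g :: "'i \<Rightarrow> 'w::ab_group_add"
  by (induction xs) (auto simp: algebra_simps)

lemma sum_list_map_diff:
  "sum_list (map (\<lambda>i. f i - g i) xs) = sum_list (map f xs) - sum_list (map g xs)"
  for f g :: "'i \<Rightarrow> 'w::ab_group_add"
  by (induction xs) (auto simp: algebra_simps)

lemma sum_list_cmult:
  "sum_list (map (\<lambda>i. c * f i) xs) = c * sum_list (map f xs)" for c :: "'f::field"
  by (induction xs) (auto simp: algebra_simps)

lemma sum_list_multc:
  "sum_list (map (\<lambda>i. f i * c) xs) = sum_list (map f xs) * c" for c :: "'f::field"
  by (induction xs) (auto simp: algebra_simps)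

text \<open>
  Gaussian elimination: if \<open>q y \<noteq> 0\<close> for the first summand \<open>p \<otimes> q\<close>, then \<open>p\<close> is a combination of
  the first factors of the other summands, and substituting it shortens the sum.
\<close>

lemma bilin_on_tsum_zero:
  assumes P: "fs.subspace P" and Q: "fs.subspace Q" and W: "vector_space sW"
    and \<beta>: "bilin_on sW P Q \<beta>" and "set xs \<subseteq> P \<times> Q" and "tsum xs = 0"
  shows "sum_list (map (\<lambda>(p, q). \<beta> p q) xs) = 0"
  using assms(5,6)
proof (induction "length xs" arbitrary: xs)
  case 0
  then show ?case by simp
next
  case (Suc n)
  interpret W: vector_space sW by fact
  obtain p q ys where xs: "xs = (p, q) # ys" using Suc(2) by (cases xs) auto
  have pq: "p \<in> P" "q \<in> Q" and ys: "set ys \<subseteq> P \<times> Q" and n: "n = length ys" using Suc xs by auto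
  have z: "p x * q y + sum_list (map (\<lambda>(p, q). p x * q y) ys) = 0" for x y
    using fun_cong[OF Suc(4), of "(x, y)"] by (simp add: xs tsum_apply zero_fun_def)
  show ?case
  proof (cases "q = 0")
    case True
    have "tsum ys = 0"
      using z True by (auto simp: fun_eq_iff tsum_apply zero_fun_def)
    then have "sum_list (map (\<lambda>(p, q). \<beta> p q) ys) = 0" using Suc(1)[OF n ys] by simp
    moreover have "\<beta> p q = 0"
      using \<beta> pq True lin_on_zero[OF _ Q fs.vector_space_axioms W] by (auto simp: bilin_on_def)
    ultimately show ?thesis by (simp add: xs)
  next
    case False
    then obtain y where y: "q y \<noteq> 0" by (auto simp: fun_eq_iff zero_fun_def)
    define c where "c = (\<lambda>r. r y / q y)"
    \<comment> \<open>Substituting the expression for \<open>p\<close> into the product of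
      \<open>p\<close> and \<open>q\<close> turns every remaining \<open>p' \<otimes> q'\<close>
      into \<open>p' \<otimes> (q' - c q' q)\<close>, with \<open>c q'\<close> a scalar; bilinearity
      of \<open>\<beta>\<close> carries out the same substitution on values.\<close>
    define ys' where "ys' = map (\<lambda>(p', q'). (p', q' - fscale (c q') q)) ys"
    have ys': "set ys' \<subseteq> P \<times> Q"
      using ys pq fs.subspace_diff[OF Q] fs.subspace_scale[OF Q] by (auto simp: ys'_def)
    have p: "p = - sum_list (map (\<lambda>(p', q'). fscale (c q') p') ys)"
    proof
      fix x
      have "p x = - (sum_list (map (\<lambda>(p', q'). p' x * q' y) ys)) / q y"
        using z[of x y] y by (simp add: field_simps add_eq_0_iff2)
      also have "\<dots> = - (sum_list (map (\<lambda>i. (p' i x * q' i y) * (1 / q y)) ys))"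
        if "p' = fst" "q' = snd" for p' q'
        unfolding sum_list_multc using that by (simp add: case_prod_unfold)
      finally show "p x = (- sum_list (map (\<lambda>(p', q'). fscale (c q') p') ys)) x"
        by (simp add: sum_list_fun_apply case_prod_unfold fscale_def c_def fun_Compl_def mult.commute)
    qed
    have "tsum ys' = 0"
    proof (rule prod_fun_ext)
      fix x y'
      have "tsum ys' (x, y') = sum_list (map (\<lambda>i. fst i x * snd i y') ys)
              - sum_list (map (\<lambda>i. c (snd i) * fst i x * q y') ys)"
        by (simp add: tsum_apply ys'_def case_prod_unfold o_def fscale_def fun_diff_def algebra_simps
            flip: sum_list_map_diff)
      also have "sum_list (map (\<lambda>i. c (snd i) * fst i x * q y') ys) = - p x * q y'"
        unfolding sum_list_multc
        by (subst p) (simp add: sum_list_fun_apply case_prod_unfold fscale_def fun_Compl_def)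
      finally show "tsum ys' (x, y') = 0 (x, y')" using z[of x y'] by (simp add: case_prod_unfold zero_fun_def add.commute)
    qed
    then have "0 = sum_list (map (\<lambda>(p, q). \<beta> p q) ys')" using Suc(1)[of ys'] ys' n by (simp add: ys'_def)
    also have "\<dots> = sum_list (map (\<lambda>i. \<beta> (fst i) (snd i) - \<beta> (fscale (c (snd i)) (fst i)) q) ys)"
      unfolding ys'_def map_map
    proof (intro arg_cong[where f = sum_list] map_cong refl, clarsimp)
      fix a b assume "(a, b) \<in> set ys"
      then have ab: "a \<in> P" "b \<in> Q" using ys by auto
      have "\<beta> a (b - fscale (c b) q) = \<beta> a b - \<beta> a (fscale (c b) q)"
        using \<beta> ab pq fs.subspace_scale[OF Q] lin_on_diff[OF _ _ _ Q fs.vector_space_axioms W]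
        by (auto simp: bilin_on_def)
      also have "\<beta> a (fscale (c b) q) = \<beta> (fscale (c b) a) q"
        using \<beta> ab pq by (auto simp: bilin_on_def lin_on_def)
      finally show "\<beta> a (b - fscale (c b) q) = \<beta> a b - \<beta> (fscale (c b) a) q" .
    qed
    also have "\<dots> = sum_list (map (\<lambda>i. \<beta> (fst i) (snd i)) ys)
        - sum_list (map (\<lambda>i. \<beta> (fscale (c (snd i)) (fst i)) q) ys)"
      by (simp add: sum_list_map_diff)
    also have "sum_list (map (\<lambda>i. \<beta> (fscale (c (snd i)) (fst i)) q) ys) = - \<beta> p q"
    proof -
      have lin: "lin_on fscale sW P (\<lambda>p. \<beta> p q)" using \<beta> pq by (auto simp: bilin_on_def)
      have *: "\<beta> (sum_list (map (\<lambda>i. fscale (c (snd i)) (fst i)) ys)) q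
         = sum_list (map (\<lambda>i. \<beta> (fscale (c (snd i)) (fst i)) q) ys)"
        and in_P: "sum_list (map (\<lambda>i. fscale (c (snd i)) (fst i)) ys) \<in> P"
        using lin_on_sum_list[OF lin P fs.vector_space_axioms W, of ys "\<lambda>i. fscale (c (snd i)) (fst i)"]
          ys fs.subspace_scale[OF P] by (fastforce simp: subset_iff)+
      have "\<beta> p q = - \<beta> (sum_list (map (\<lambda>i. fscale (c (snd i)) (fst i)) ys)) q"
        by (subst p) (use lin_on_neg[OF lin in_P fs.vector_space_axioms W] in \<open>simp add: case_prod_unfold\<close>)
      then show ?thesis using * by simp
    qed
    finally show ?thesis by (simp add: xs case_prod_unfold add.commute)
  qed
qed

text \<open>Two presentations of \<open>z\<close> differ by a presentation of zero, obtained by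
  negating first factors, and \<open>\<beta>\<close> sums to zero over it by elimination. Hence the
  description in \<open>tlift\<close> has exactly one value.\<close>

lemma tlift_tsum:
  assumes P: "fs.subspace P" and Q: "fs.subspace Q" and W: "vector_space sW"
    and \<beta>: "bilin_on sW P Q \<beta>" and xs: "set xs \<subseteq> P \<times> Q" and z: "z = tsum xs"
  shows "tlift P Q \<beta> z = sum_list (map (\<lambda>(p, q). \<beta> p q) xs)"
  unfolding tlift_def tsum_def[symmetric]
proof (rule the_equality)
  show "\<exists>xs'. set xs' \<subseteq> P \<times> Q \<and> z = tsum xs' \<and>
      sum_list (map (\<lambda>(p, q). \<beta> p q) xs) = sum_list (map (\<lambda>(p, q). \<beta> p q) xs')"
    using xs z by blast
next
  fix w assume "\<exists>ys. set ys \<subseteq> P \<times> Q \<and> z = tsum ys \<and> w = sum_list (map (\<lambda>(p, q). \<beta> p q) ys)"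
  then obtain ys where ys: "set ys \<subseteq> P \<times> Q" "z = tsum ys" "w = sum_list (map (\<lambda>(p, q). \<beta> p q) ys)"
    by blast
  interpret W: vector_space sW by fact
  let ?ns = "map (\<lambda>(p, q). (- p, q)) xs"
  have "tsum (ys @ ?ns) = 0"
  proof (rule prod_fun_ext)
    fix x y
    have "sum_list (map (\<lambda>i. - (fst i x * snd i y)) xs) = - sum_list (map (\<lambda>i. fst i x * snd i y) xs)"
      by (induction xs) auto
    then show "tsum (ys @ ?ns) (x, y) = 0 (x, y)"
      using fun_cong[OF z, of "(x, y)"] fun_cong[OF ys(2), of "(x, y)"]
      by (simp add: tsum_apply case_prod_unfold o_def fun_Compl_def zero_fun_def)
  qed
  moreover have "set (ys @ ?ns) \<subseteq> P \<times> Q" using xs ys fs.subspace_neg[OF P] by auto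
  ultimately have "sum_list (map (\<lambda>(p, q). \<beta> p q) (ys @ ?ns)) = 0"
    using bilin_on_tsum_zero[OF P Q W \<beta>] by blast
  moreover have "sum_list (map (\<lambda>(p, q). \<beta> p q) ?ns) = - sum_list (map (\<lambda>(p, q). \<beta> p q) xs)"
    using xs
  proof (induction xs)
    case (Cons a xs)
    then have "\<beta> (- fst a) (snd a) = - \<beta> (fst a) (snd a)"
      using \<beta> by (intro lin_on_neg[OF _ _ fs.vector_space_axioms W, of P]) (auto simp: bilin_on_def)
    then show ?case using Cons by (auto simp: case_prod_unfold fun_Compl_def)
  qed simp
  ultimately show "w = sum_list (map (\<lambda>(p, q). \<beta> p q) xs)" using ys(3) by simp
qed

section \<open>Tensors with factors in prescribed subspaces\<close>

lemma span_tprod_iff: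
  assumes "fs.subspace P"
  shows "z \<in> fs.span {tprod p q | p q. p \<in> P \<and> q \<in> Q} \<longleftrightarrow> (\<exists>xs. set xs \<subseteq> P \<times> Q \<and> z = tsum xs)"
proof
  assume "z \<in> fs.span {tprod p q | p q. p \<in> P \<and> q \<in> Q}"
  then show "\<exists>xs. set xs \<subseteq> P \<times> Q \<and> z = tsum xs"
  proof (induction rule: fs.span_induct_alt)
    case base
    show ?case by (intro exI[of _ "[]"]) (auto simp: tsum_def)
  next
    case (step c x y)
    then obtain p q xs where "x = tprod p q" "p \<in> P" "q \<in> Q" "set xs \<subseteq> P \<times> Q" "y = tsum xs" by blast
    then show ?case using fs.subspace_scale[OF assms]
      by (intro exI[of _ "(fscale c p, q) # xs"]) (auto simp: tsum_def tprod_def fscale_def fun_eq_iff)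
  qed
next
  assume "\<exists>xs. set xs \<subseteq> P \<times> Q \<and> z = tsum xs"
  then obtain xs where "set xs \<subseteq> P \<times> Q" "z = tsum xs" by blast
  then show "z \<in> fs.span {tprod p q | p q. p \<in> P \<and> q \<in> Q}"
  proof (induction xs arbitrary: z)
    case Nil
    then have "z = 0" by (simp only: tsum_def list.map sum_list.Nil)
    then show ?case by (simp only: fs.span_zero)
  next
    case (Cons a xs)
    then have "tsum xs \<in> fs.span {tprod p q | p q. p \<in> P \<and> q \<in> Q}" by simp
    moreover have "tprod (fst a) (snd a) \<in> fs.span {tprod p q | p q. p \<in> P \<and> q \<in> Q}"
      using Cons(2) by (intro fs.span_base CollectI exI[of _ "fst a"] exI[of _ "snd a"]) (cases a, simp)
    moreover have "z = tprod (fst a) (snd a) + tsum xs" using Cons(3) by (simp add: tsum_def case_prod_unfold fun_eq_iff)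
    ultimately show ?case using fs.span_add by blast
  qed
qed

text \<open>Elimination again, now with \<open>Q\<close> known only through the rows of the whole
  function. If \<open>p x0 \<noteq> 0\<close>, the row at \<open>x0\<close> lies in \<open>Q\<close>
  and serves as second factor for \<open>p\<close>; the remainder is a shorter sum whose rows are
  still in \<open>Q\<close>.\<close>

lemma tsum_columns:
  assumes P: "fs.subspace P" and Q: "fs.subspace Q"
    and "fst ` set xs \<subseteq> P" "\<And>x. (\<lambda>y. tsum xs (x, y)) \<in> Q"
  shows "\<exists>ys. set ys \<subseteq> P \<times> Q \<and> tsum xs = tsum ys"
  using assms(3,4)
proof (induction "length xs" arbitrary: xs)
  case 0
  then show ?case by (intro exI[of _ "[]"]) auto
next
  case (Suc n)
  obtain p q xs' where xs: "xs = (p, q) # xs'" using Suc(2) by (cases xs) auto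
  have n: "n = length xs'" and p: "p \<in> P" and xs': "fst ` set xs' \<subseteq> P" using Suc xs by auto
  have z: "tsum xs (x, y) = p x * q y + tsum xs' (x, y)" for x y by (simp add: xs tsum_apply)
  show ?case
  proof (cases "p = 0")
    case True
    then have "tsum xs = tsum xs'" using z by (auto simp: fun_eq_iff)
    then show ?thesis using Suc(1)[OF n xs'] Suc(4) by simp
  next
    case False
    then obtain x0 where x0: "p x0 \<noteq> 0" by (auto simp: fun_eq_iff zero_fun_def)
    define g where "g = (\<lambda>y. tsum xs (x0, y))"
    have g: "g \<in> Q" unfolding g_def by (rule Suc(4))
    \<comment> \<open>Each \<open>p'\<close> is corrected by the multiple of \<open>p\<close> that
      makes it vanish at \<open>x0\<close>.\<close>
    define ys where "ys = map (\<lambda>(p', q'). (p' - fscale (p' x0 / p x0) p, q')) xs'"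
    have ys: "fst ` set ys \<subseteq> P"
      using xs' p by (force simp: ys_def intro: fs.subspace_diff[OF P] fs.subspace_scale[OF P])
    have eq: "tsum ys (x, y) = tsum xs (x, y) - p x / p x0 * g y" for x y
    proof -
      have "tsum ys (x, y) = tsum xs' (x, y) - sum_list (map (\<lambda>i. p x / p x0 * (fst i x0 * snd i y)) xs')"
        by (simp add: tsum_apply ys_def case_prod_unfold o_def fscale_def fun_diff_def algebra_simps
            flip: sum_list_map_diff)
      also have "\<dots> = tsum xs' (x, y) - p x / p x0 * tsum xs' (x0, y)"
        unfolding sum_list_cmult by (simp add: tsum_apply case_prod_unfold)
      also have "\<dots> = tsum xs (x, y) - p x / p x0 * g y"
        using x0 by (simp add: g_def z field_simps)
      finally show ?thesis .
    qed
    have "(\<lambda>y. tsum ys (x, y)) \<in> Q" for x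
    proof -
      have "(\<lambda>y. tsum ys (x, y)) = (\<lambda>y. tsum xs (x, y)) - fscale (p x / p x0) g"
        by (simp add: eq fun_eq_iff fscale_def fun_diff_def)
      then show ?thesis using Suc(4) g fs.subspace_diff[OF Q] fs.subspace_scale[OF Q] by simp
    qed
    then obtain zs where zs: "set zs \<subseteq> P \<times> Q" "tsum ys = tsum zs"
      using Suc(1)[of ys] n ys by (auto simp: ys_def)
    have "tsum xs = tsum ((fscale (1 / p x0) p, g) # zs)"
    proof (rule prod_fun_ext)
      fix x y
      have "tsum ((fscale (1 / p x0) p, g) # zs) (x, y) = p x / p x0 * g y + tsum ys (x, y)"
        unfolding zs(2) by (simp add: tsum_apply fscale_def)
      then show "tsum xs (x, y) = tsum ((fscale (1 / p x0) p, g) # zs) (x, y)" by (simp add: eq)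
    qed
    then show ?thesis using zs g p fs.subspace_scale[OF P] by (intro exI[of _ "(fscale (1 / p x0) p, g) # zs"]) auto
  qed
qed

text \<open>Tensors with first factors in \<open>P\<close> and tensors with second factors in
  \<open>Q\<close> meet in \<open>P \<otimes> Q\<close>: elimination on the transposed sum brings
  one factor into \<open>P\<close>, and a second elimination brings the other into
  \<open>Q\<close>.\<close>

lemma tsum_rows_columns:
  fixes xs :: "(('x \<Rightarrow> 'f::field) \<times> ('y \<Rightarrow> 'f)) list"
  assumes P: "fs.subspace P" and Q: "fs.subspace Q"
    and "\<And>y. (\<lambda>x. tsum xs (x, y)) \<in> P" "\<And>x. (\<lambda>y. tsum xs (x, y)) \<in> Q"
  shows "\<exists>ys. set ys \<subseteq> P \<times> Q \<and> tsum xs = tsum ys"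
proof -
  define sw :: "('x \<Rightarrow> 'f) \<times> ('y \<Rightarrow> 'f) \<Rightarrow> _" where "sw = (\<lambda>(p, q). (q, p))"
  define sw' :: "('y \<Rightarrow> 'f) \<times> ('x \<Rightarrow> 'f) \<Rightarrow> _" where "sw' = (\<lambda>(p, q). (q, p))"
  have sw: "tsum (map sw zs) (y, x) = tsum zs (x, y)" for zs x y
    by (simp add: tsum_apply sw_def case_prod_unfold o_def mult.commute)
  have sw': "tsum (map sw' zs) (x, y) = tsum zs (y, x)" for zs x y
    by (simp add: tsum_apply sw'_def case_prod_unfold o_def mult.commute)
  obtain ys where ys: "set ys \<subseteq> UNIV \<times> P" "tsum (map sw xs) = tsum ys"
    using tsum_columns[OF fs.subspace_UNIV P, of "map sw xs"] assms(3) by (auto simp: sw)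
  have "tsum xs = tsum (map sw' ys)"
    by (rule prod_fun_ext) (metis sw sw' ys(2))
  moreover have "fst ` set (map sw' ys) \<subseteq> P" using ys(1) by (auto simp: sw'_def)
  ultimately show ?thesis using tsum_columns[OF P Q, of "map sw' ys"] assms(4) by simp
qed

section \<open>Subcoalgebras of functions on words\<close>

lemma vector_space_field: "vector_space ((*) :: 'f::field \<Rightarrow> 'f \<Rightarrow> 'f)"
  by unfold_locales (auto simp: algebra_simps)

lemma lin_on_eval: "lin_on fscale (*) S (\<lambda>t. t x)"
  by (simp add: lin_on_def fscale_def)

text \<open>The diagonal may be any finite sum of products; closure under rows and columns then
  forces the factors into \<open>C\<close> by \<open>tsum_rows_columns\<close>. All subcoalgebras
  below are recognised in this way.\<close>

lemma subcoalgebraI: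
  assumes C: "fs.subspace C"
    and "\<And>t. t \<in> C \<Longrightarrow> \<exists>xs. diag t = tsum xs"
    and "\<And>t u. t \<in> C \<Longrightarrow> (\<lambda>z. t (u @ z)) \<in> C" "\<And>t u. t \<in> C \<Longrightarrow> (\<lambda>z. t (z @ u)) \<in> C"
  shows "subcoalgebra C"
  unfolding subcoalgebra_def
proof (intro conjI ballI C)
  fix t assume t: "t \<in> C"
  then obtain xs where xs: "diag t = tsum xs" using assms(2) by blast
  then have e: "tsum xs (x, y) = t (x @ y)" for x y
    unfolding xs[symmetric] by (simp add: diag_def)
  then have "\<exists>ys. set ys \<subseteq> C \<times> C \<and> tsum xs = tsum ys"
    using assms(3,4)[OF t] by (intro tsum_rows_columns[OF C C]) simp_all
  then show "diag t \<in> fs.span {tprod p q |p q. p \<in> C \<and> q \<in> C}"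
    unfolding xs span_tprod_iff[OF C] .
qed

locale coalg =
  fixes C :: "('f::field, 'a) tens set"
  assumes subcoalgebra: "subcoalgebra C"
begin

lemma subspace: "fs.subspace C"
  using subcoalgebra by (simp add: subcoalgebra_def)

lemma diag_tsum:
  assumes "t \<in> C"
  obtains xs where "set xs \<subseteq> C \<times> C" "diag t = tsum xs"
  using assms subcoalgebra span_tprod_iff[OF subspace] unfolding subcoalgebra_def by blast

lemma diag_eval: "diag t = tsum xs \<Longrightarrow> t (x @ y) = sum_list (map (\<lambda>(p, q). p x * q y) xs)"
  by (metis diag_def case_prod_conv tsum_apply)

lemma row_eq: "diag t = tsum xs \<Longrightarrow> (\<lambda>y. t (x @ y)) = sum_list (map (\<lambda>(p, q). fscale (p x) q) xs)"
  by (rule ext) (simp add: diag_eval sum_list_fun_apply case_prod_unfold fscale_def)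

lemma column_eq: "diag t = tsum xs \<Longrightarrow> (\<lambda>x. t (x @ y)) = sum_list (map (\<lambda>(p, q). fscale (q y) p) xs)"
  by (rule ext) (simp add: diag_eval sum_list_fun_apply case_prod_unfold fscale_def mult.commute)

lemma sum_list_in:
  assumes "\<And>i. i \<in> set xs \<Longrightarrow> g i \<in> C"
  shows "sum_list (map g xs) \<in> C"
  using assms
proof (induction xs)
  case Nil
  show ?case unfolding list.map sum_list.Nil by (rule fs.subspace_0[OF subspace])
next
  case (Cons a xs)
  then show ?case unfolding list.map sum_list.Cons by (intro fs.subspace_add[OF subspace]) auto
qed

text \<open>The value is \<open>(ev x \<otimes> \<alpha>) \<Delta> t\<close>, computed from any
  presentation of the diagonal.\<close>

lemma lin_row:
  assumes "lin_on fscale sW C \<alpha>" "vector_space sW" "set xs \<subseteq> C \<times> C" "diag t = tsum xs"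
  shows "\<alpha> (\<lambda>y. t (x @ y)) = sum_list (map (\<lambda>(p, q). sW (p x) (\<alpha> q)) xs)"
proof -
  have "\<alpha> (sum_list (map (\<lambda>(p, q). fscale (p x) q) xs)) =
      sum_list (map (\<lambda>i. \<alpha> (case i of (p, q) \<Rightarrow> fscale (p x) q)) xs)"
    using assms(3) fs.subspace_scale[OF subspace]
    by (intro conjunct1[OF lin_on_sum_list[OF assms(1) subspace fs.vector_space_axioms assms(2)]]) auto
  also have "\<dots> = sum_list (map (\<lambda>(p, q). sW (p x) (\<alpha> q)) xs)"
    using assms(3) by (intro arg_cong[where f = sum_list] map_cong) (auto simp: lin_on_scale[OF assms(1)])
  finally show ?thesis by (simp add: row_eq[OF assms(4)])
qed

lemma lin_column:
  assumes "lin_on fscale sW C \<alpha>" "vector_space sW" "set xs \<subseteq> C \<times> C" "diag t = tsum xs"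
  shows "\<alpha> (\<lambda>x. t (x @ y)) = sum_list (map (\<lambda>(p, q). sW (q y) (\<alpha> p)) xs)"
proof -
  have "\<alpha> (sum_list (map (\<lambda>(p, q). fscale (q y) p) xs)) =
      sum_list (map (\<lambda>i. \<alpha> (case i of (p, q) \<Rightarrow> fscale (q y) p)) xs)"
    using assms(3) fs.subspace_scale[OF subspace]
    by (intro conjunct1[OF lin_on_sum_list[OF assms(1) subspace fs.vector_space_axioms assms(2)]]) auto
  also have "\<dots> = sum_list (map (\<lambda>(p, q). sW (q y) (\<alpha> p)) xs)"
    using assms(3) by (intro arg_cong[where f = sum_list] map_cong) (auto simp: lin_on_scale[OF assms(1)])
  finally show ?thesis by (simp add: column_eq[OF assms(4)])
qed

lemma row_in: "t \<in> C \<Longrightarrow> (\<lambda>y. t (x @ y)) \<in> C"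
proof -
  assume t: "t \<in> C"
  then obtain xs where xs: "set xs \<subseteq> C \<times> C" "diag t = tsum xs" by (rule diag_tsum)
  show ?thesis unfolding row_eq[OF xs(2)]
    using xs(1) fs.subspace_scale[OF subspace] by (intro sum_list_in) auto
qed

lemma column_in: "t \<in> C \<Longrightarrow> (\<lambda>x. t (x @ y)) \<in> C"
proof -
  assume t: "t \<in> C"
  then obtain xs where xs: "set xs \<subseteq> C \<times> C" "diag t = tsum xs" by (rule diag_tsum)
  show ?thesis unfolding column_eq[OF xs(2)]
    using xs(1) fs.subspace_scale[OF subspace] by (intro sum_list_in) auto
qed

lemma partial_row_eq:
  assumes \<alpha>: "lin_on fscale (*) C \<alpha>" and xs: "set xs \<subseteq> C \<times> C" "diag t = tsum xs"
  shows "(\<lambda>x. \<alpha> (\<lambda>y. t (x @ y))) = sum_list (map (\<lambda>(p, q). fscale (\<alpha> q) p) xs)"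
  by (rule ext) (simp add: lin_row[OF \<alpha> vector_space_field xs] sum_list_fun_apply fscale_def
      case_prod_unfold mult.commute)

lemma partial_column_eq:
  assumes \<alpha>: "lin_on fscale (*) C \<alpha>" and xs: "set xs \<subseteq> C \<times> C" "diag t = tsum xs"
  shows "(\<lambda>y. \<alpha> (\<lambda>x. t (x @ y))) = sum_list (map (\<lambda>(p, q). fscale (\<alpha> p) q) xs)"
  by (rule ext) (simp add: lin_column[OF \<alpha> vector_space_field xs] sum_list_fun_apply fscale_def
      case_prod_unfold mult.commute)

text \<open>The function is \<open>(Id \<otimes> \<alpha>) \<Delta> t\<close>, a combination of
  first factors of the diagonal; so partial evaluations may be nested without leaving
  \<open>C\<close>.\<close>

lemma partial_row_in:
  assumes t: "t \<in> C" and \<alpha>: "lin_on fscale (*) C \<alpha>"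
  shows "(\<lambda>x. \<alpha> (\<lambda>y. t (x @ y))) \<in> C"
proof -
  obtain xs where xs: "set xs \<subseteq> C \<times> C" "diag t = tsum xs" using t by (rule diag_tsum)
  show ?thesis unfolding partial_row_eq[OF \<alpha> xs]
    using xs(1) fs.subspace_scale[OF subspace] by (auto intro!: sum_list_in)
qed

lemma partial_column_in:
  assumes t: "t \<in> C" and \<alpha>: "lin_on fscale (*) C \<alpha>"
  shows "(\<lambda>y. \<alpha> (\<lambda>x. t (x @ y))) \<in> C"
proof -
  obtain xs where xs: "set xs \<subseteq> C \<times> C" "diag t = tsum xs" using t by (rule diag_tsum)
  show ?thesis unfolding partial_column_eq[OF \<alpha> xs]
    using xs(1) fs.subspace_scale[OF subspace] by (auto intro!: sum_list_in)
qed

lemma lin_partial_row: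
  assumes \<alpha>: "lin_on fscale sW C \<alpha>" "vector_space sW" and \<beta>: "lin_on fscale (*) C \<beta>"
    and xs: "set xs \<subseteq> C \<times> C" "diag t = tsum xs"
  shows "\<alpha> (\<lambda>x. \<beta> (\<lambda>y. t (x @ y))) = sum_list (map (\<lambda>(p, q). sW (\<beta> q) (\<alpha> p)) xs)"
proof -
  have "\<alpha> (\<lambda>x. \<beta> (\<lambda>y. t (x @ y))) = sum_list (map (\<lambda>i. \<alpha> (case i of (p, q) \<Rightarrow> fscale (\<beta> q) p)) xs)"
    unfolding partial_row_eq[OF \<beta> xs] using xs(1) fs.subspace_scale[OF subspace]
    by (intro conjunct1[OF lin_on_sum_list[OF \<alpha>(1) subspace fs.vector_space_axioms \<alpha>(2)]]) auto
  also have "\<dots> = sum_list (map (\<lambda>(p, q). sW (\<beta> q) (\<alpha> p)) xs)"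
    using xs(1) by (intro arg_cong[where f = sum_list] map_cong) (auto simp: lin_on_scale[OF \<alpha>(1)])
  finally show ?thesis .
qed

text \<open>Both sides are \<open>\<Sum> \<alpha> p * \<beta> q\<close> over a presentation of the
  diagonal. The explicit lifts are nested partial evaluations, whose order is exchanged by this
  identity.\<close>

lemma fubini:
  assumes t: "t \<in> C" and \<alpha>: "lin_on fscale (*) C \<alpha>" and \<beta>: "lin_on fscale (*) C \<beta>"
  shows "\<alpha> (\<lambda>x. \<beta> (\<lambda>y. t (x @ y))) = \<beta> (\<lambda>y. \<alpha> (\<lambda>x. t (x @ y)))"
proof -
  obtain xs where xs: "set xs \<subseteq> C \<times> C" "diag t = tsum xs" using t by (rule diag_tsum)
  have "\<beta> (\<lambda>y. \<alpha> (\<lambda>x. t (x @ y))) = sum_list (map (\<lambda>i. \<beta> (case i of (p, q) \<Rightarrow> fscale (\<alpha> p) q)) xs)"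
    unfolding partial_column_eq[OF \<alpha> xs] using xs(1) fs.subspace_scale[OF subspace]
    by (intro conjunct1[OF lin_on_sum_list[OF \<beta> subspace fs.vector_space_axioms vector_space_field]]) auto
  also have "\<dots> = sum_list (map (\<lambda>(p, q). \<beta> q * \<alpha> p) xs)"
    using xs(1) by (intro arg_cong[where f = sum_list] map_cong) (auto simp: lin_on_scale[OF \<beta>] mult.commute)
  finally show ?thesis using lin_partial_row[OF \<alpha> vector_space_field \<beta> xs] by simp
qed

lemma tlift_diag:
  assumes "bilin_on sW C C \<beta>" "vector_space sW" "set xs \<subseteq> C \<times> C" "diag t = tsum xs"
  shows "tlift C C \<beta> (diag t) = sum_list (map (\<lambda>(p, q). \<beta> p q) xs)"
  using tlift_tsum[OF subspace subspace assms(2,1,3,4)] .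

lemma lin_on_tlift:
  assumes \<beta>: "bilin_on sW C C \<beta>" and W: "vector_space sW"
  shows "lin_on fscale sW C (\<lambda>t. tlift C C \<beta> (diag t))"
proof (rule lin_onI)
  interpret W: vector_space sW by fact
  fix t t' assume "t \<in> C" "t' \<in> C"
  then obtain xs ys where xs: "set xs \<subseteq> C \<times> C" "diag t = tsum xs"
    and ys: "set ys \<subseteq> C \<times> C" "diag t' = tsum ys" by (metis diag_tsum)
  have "diag (t + t') = tsum (xs @ ys)"
    using xs(2) ys(2) by (auto simp: fun_eq_iff diag_def tsum_apply)
  then have "tlift C C \<beta> (diag (t + t')) = sum_list (map (\<lambda>(p, q). \<beta> p q) (xs @ ys))"
    using xs ys by (intro tlift_diag[OF \<beta> W]) auto
  then show "tlift C C \<beta> (diag (t + t')) = tlift C C \<beta> (diag t) + tlift C C \<beta> (diag t')"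
    using tlift_diag[OF \<beta> W xs] tlift_diag[OF \<beta> W ys] by simp
next
  interpret W: vector_space sW by fact
  fix t c assume "t \<in> C"
  then obtain xs where xs: "set xs \<subseteq> C \<times> C" "diag t = tsum xs" by (metis diag_tsum)
  let ?ys = "map (\<lambda>(p, q). (fscale c p, q)) xs"
  have "diag (fscale c t) = tsum ?ys"
    using xs(2) by (auto simp: fun_eq_iff diag_def tsum_apply case_prod_unfold o_def fscale_def
        mult.assoc sum_list_cmult)
  moreover have "set ?ys \<subseteq> C \<times> C" using xs fs.subspace_scale[OF subspace] by auto
  ultimately have "tlift C C \<beta> (diag (fscale c t)) = sum_list (map (\<lambda>(p, q). \<beta> p q) ?ys)"
    by (intro tlift_diag[OF \<beta> W])
  also have "\<dots> = sum_list (map (\<lambda>(p, q). sW c (\<beta> p q)) xs)"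
    unfolding map_map using xs(1) \<beta>
    by (intro arg_cong[where f = sum_list] map_cong) (auto simp: bilin_on_def lin_on_def)
  also have "\<dots> = sW c (sum_list (map (\<lambda>(p, q). \<beta> p q) xs))"
    by (induction xs) (auto simp: W.scale_right_distrib)
  finally show "tlift C C \<beta> (diag (fscale c t)) = sW c (tlift C C \<beta> (diag t))"
    using tlift_diag[OF \<beta> W xs] by simp
qed

text \<open>A presentation of the diagonal over \<open>D\<close> is also one over \<open>C\<close>,
  so passing to a subcoalgebra does not change a convolution.\<close>

lemma tlift_smaller:
  assumes "subcoalgebra D" "D \<subseteq> C" "t \<in> D" "bilin_on sW C C \<beta>" "vector_space sW"
  shows "tlift D D \<beta> (diag t) = tlift C C \<beta> (diag t)"
proof -
  interpret D: coalg D using assms(1) by unfold_locales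
  obtain xs where xs: "set xs \<subseteq> D \<times> D" "diag t = tsum xs" using assms(3) by (rule D.diag_tsum)
  then have "set xs \<subseteq> C \<times> C" using assms(2) by auto
  then show ?thesis
    using D.tlift_diag[OF bilin_on_subset[OF assms(4,2,2)] assms(5) xs] tlift_diag[OF assms(4,5) _ xs(2)] by simp
qed

end

section \<open>Homogeneous functionals\<close>

locale grsp =
  fixes s :: "'f::field \<Rightarrow> 'a::ab_group_add \<Rightarrow> 'a" and G :: "int \<Rightarrow> 'a set"
  assumes graded: "graded_space s G"
begin

sublocale vector_space s
  using graded by (simp add: graded_space_def)

lemma subspace_G: "subspace (G n)"
  using graded by (simp add: graded_space_def)

definition hcomp :: "'a \<Rightarrow> int \<Rightarrow> 'a" where
  "hcomp v = (THE c. (\<forall>n. c n \<in> G n) \<and> finite {n. c n \<noteq> 0} \<and> v = Sum_any c)"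

lemma hcomp: "hcomp v n \<in> G n" "finite {n. hcomp v n \<noteq> 0}" "Sum_any (hcomp v) = v"
proof -
  have "\<exists>!c. (\<forall>n. c n \<in> G n) \<and> finite {n. c n \<noteq> 0} \<and> v = Sum_any c"
    using graded by (simp add: graded_space_def)
  from theI'[OF this] show "hcomp v n \<in> G n" "finite {n. hcomp v n \<noteq> 0}" "Sum_any (hcomp v) = v"
    unfolding hcomp_def by auto
qed

lemma hcomp_unique:
  assumes "\<And>n. c n \<in> G n" "finite {n. c n \<noteq> 0}" "v = Sum_any c"
  shows "hcomp v = c"
proof -
  have "\<exists>!c. (\<forall>n. c n \<in> G n) \<and> finite {n. c n \<noteq> 0} \<and> v = Sum_any c"
    using graded by (simp add: graded_space_def)
  then show ?thesis unfolding hcomp_def using assms by (intro the1_equality) auto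
qed

lemma hcomp_in: "v \<in> G n \<Longrightarrow> hcomp v = (\<lambda>m. if m = n then v else 0)"
proof (rule hcomp_unique)
  assume v: "v \<in> G n"
  show "(if m = n then v else 0) \<in> G m" for m using v subspace_0[OF subspace_G] by auto
  have "{m. (if m = n then v else 0) \<noteq> 0} \<subseteq> {n}" by auto
  then show "finite {m. (if m = n then v else 0) \<noteq> 0}" by (rule finite_subset) simp
  show "v = (\<Sum>m. if m = n then v else 0)"
    by (subst Sum_any.expand_superset[of "{n}"]) auto
qed

lemma hcomp_add: "hcomp (v + w) n = hcomp v n + hcomp w n"
proof -
  have "{n. hcomp v n + hcomp w n \<noteq> 0} \<subseteq> {n. hcomp v n \<noteq> 0} \<union> {n. hcomp w n \<noteq> 0}" by auto
  then have "finite {n. hcomp v n + hcomp w n \<noteq> 0}" by (rule finite_subset) (simp add: hcomp)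
  then have "hcomp (v + w) = (\<lambda>n. hcomp v n + hcomp w n)"
    using hcomp subspace_add[OF subspace_G] by (intro hcomp_unique) (auto simp: Sum_any.distrib)
  then show ?thesis by simp
qed

lemma hcomp_scale: "hcomp (s c v) n = s c (hcomp v n)"
proof -
  have sub: "{n. s c (hcomp v n) \<noteq> 0} \<subseteq> {n. hcomp v n \<noteq> 0}" by auto
  have "hcomp (s c v) = (\<lambda>n. s c (hcomp v n))"
  proof (rule hcomp_unique)
    show "finite {n. s c (hcomp v n) \<noteq> 0}" using sub by (rule finite_subset) (rule hcomp)
    have "s c v = s c (sum (hcomp v) {n. hcomp v n \<noteq> 0})"
      using hcomp(2,3)[of v] by (simp add: Sum_any.expand_set)
    also have "\<dots> = (\<Sum>n | hcomp v n \<noteq> 0. s c (hcomp v n))" by (rule scale_sum_right)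
    also have "\<dots> = (\<Sum>n. s c (hcomp v n))"
      using hcomp(2) sub by (intro Sum_any.expand_superset[symmetric])
    finally show "s c v = (\<Sum>n. s c (hcomp v n))" .
  qed (use hcomp subspace_scale[OF subspace_G] in auto)
  then show ?thesis by simp
qed

lemma linear_hcomp: "Vector_Spaces.linear s s (\<lambda>v. hcomp v n)"
  using hcomp_add hcomp_scale vector_space_axioms
  by (simp add: Vector_Spaces.linear_def module_hom_def module_hom_axioms_def module_axioms)

lemma sum_hcomp: "finite A \<Longrightarrow> {n. hcomp v n \<noteq> 0} \<subseteq> A \<Longrightarrow> sum (hcomp v) A = v"
  using Sum_any.expand_superset[of A "hcomp v"] hcomp(3) by simp

lemma hdual_linear: "\<phi> \<in> hdual s G n \<Longrightarrow> Vector_Spaces.linear s (*) \<phi>"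
  by (simp add: hdual_def)

lemma hdual_zero: "\<phi> \<in> hdual s G n \<Longrightarrow> v \<in> G m \<Longrightarrow> m \<noteq> n \<Longrightarrow> \<phi> v = 0"
  by (simp add: hdual_def)

lemma hdual_simps:
  assumes "\<phi> \<in> hdual s G n"
  shows "\<phi> (x + y) = \<phi> x + \<phi> y" "\<phi> (s c x) = c * \<phi> x" "\<phi> 0 = 0" "\<phi> (x - y) = \<phi> x - \<phi> y"
    "\<phi> (- x) = - \<phi> x" "\<phi> (sum g A) = (\<Sum>i\<in>A. \<phi> (g i))" "\<phi> (sum_list (map g' xs)) = sum_list (map (\<lambda>i. \<phi> (g' i)) xs)"
proof -
  interpret \<phi>: Vector_Spaces.linear s "(*)" \<phi> using assms by (rule hdual_linear)
  show "\<phi> (x + y) = \<phi> x + \<phi> y" "\<phi> (s c x) = c * \<phi> x" "\<phi> 0 = 0" "\<phi> (x - y) = \<phi> x - \<phi> y"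
    "\<phi> (- x) = - \<phi> x" "\<phi> (sum g A) = (\<Sum>i\<in>A. \<phi> (g i))"
    by (simp_all add: \<phi>.add \<phi>.scale \<phi>.zero \<phi>.diff \<phi>.neg \<phi>.sum)
  show "\<phi> (sum_list (map g' xs)) = sum_list (map (\<lambda>i. \<phi> (g' i)) xs)"
    by (induction xs) (simp_all add: \<phi>.add \<phi>.zero)
qed

lemma hdual_hcomp: "\<phi> \<in> hdual s G n \<Longrightarrow> \<phi> v = \<phi> (hcomp v n)"
proof -
  assume \<phi>: "\<phi> \<in> hdual s G n"
  let ?A = "insert n {n. hcomp v n \<noteq> 0}"
  have "\<phi> v = \<phi> (sum (hcomp v) ?A)" by (subst sum_hcomp) (auto simp: hcomp(2))
  also have "\<dots> = (\<Sum>m\<in>?A. \<phi> (hcomp v m))" by (rule hdual_simps[OF \<phi>])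
  also have "\<dots> = (\<Sum>m\<in>{n}. \<phi> (hcomp v m))"
    using hdual_zero[OF \<phi> hcomp(1)] by (intro sum.mono_neutral_right) (auto simp: hcomp(2))
  finally show ?thesis by simp
qed

lemma linear_comp_hcomp_hdual:
  assumes "Vector_Spaces.linear s (*) \<psi>"
  shows "(\<lambda>v. \<psi> (hcomp v n)) \<in> hdual s G n"
proof -
  interpret \<psi>: Vector_Spaces.linear s "(*)" \<psi> by fact
  have "Vector_Spaces.linear s (*) (\<psi> \<circ> (\<lambda>v. hcomp v n))"
    using linear_hcomp assms by (rule Vector_Spaces.linear_compose)
  then show ?thesis by (auto simp: hdual_def hcomp_in o_def \<psi>.zero)
qed

lemma separating: "v \<noteq> 0 \<Longrightarrow> \<exists>\<psi>. Vector_Spaces.linear s (*) \<psi> \<and> \<psi> v = (1::'f)"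
proof -
  interpret fld: vector_space "(*) :: 'f \<Rightarrow> 'f \<Rightarrow> 'f" by (rule vector_space_field)
  interpret pr: vector_space_pair s "(*) :: 'f \<Rightarrow> 'f \<Rightarrow> 'f" by unfold_locales
  assume "v \<noteq> 0"
  then have "independent {v}" by simp
  from pr.linear_independent_extend[OF this, of "\<lambda>_. 1"] show ?thesis by auto
qed

text \<open>Letters have to be homogeneous, so a functional that detects a nonzero component of
  \<open>v - w\<close> is composed with the projection to that component.\<close>

lemma hdual_separating:
  assumes "\<And>n \<phi>. \<phi> \<in> hdual s G n \<Longrightarrow> \<phi> v = \<phi> w"
  shows "v = w"
proof (rule ccontr)
  assume "v \<noteq> w"
  have "\<exists>n. hcomp (v - w) n \<noteq> 0"
  proof (rule ccontr)
    assume "\<not> ?thesis"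
    then have "v - w = 0" using sum_hcomp[of "{}" "v - w"] by simp
    then show False using \<open>v \<noteq> w\<close> by simp
  qed
  then obtain n where n: "hcomp (v - w) n \<noteq> 0" by blast
  obtain \<psi> where \<psi>: "Vector_Spaces.linear s (*) \<psi>" "\<psi> (hcomp (v - w) n) = 1" using separating[OF n] by blast
  have *: "(\<lambda>v. \<psi> (hcomp v n)) \<in> hdual s G n" by (rule linear_comp_hcomp_hdual[OF \<psi>(1)])
  have "\<psi> (hcomp (v - w) n) = 0" using hdual_simps(4)[OF *, of v w] assms[OF *] by simp
  then show False using \<psi>(2) by simp
qed

lemma linear_eqI:
  assumes "\<And>\<psi>. Vector_Spaces.linear s (*) \<psi> \<Longrightarrow> \<psi> v = \<psi> w"
  shows "v = w"
  using assms hdual_separating hdual_linear by blast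

text \<open>Under the hypothesis no homogeneous functional distinguishes \<open>v\<close> from its
  component \<open>hcomp v n\<close>, so the two coincide.\<close>

lemma in_GI:
  assumes "\<And>m \<phi>. m \<noteq> n \<Longrightarrow> \<phi> \<in> hdual s G m \<Longrightarrow> \<phi> v = 0"
  shows "v \<in> G n"
proof -
  have "v = hcomp v n"
  proof (rule hdual_separating)
    fix m \<phi> assume \<phi>: "\<phi> \<in> hdual s G m"
    show "\<phi> v = \<phi> (hcomp v n)"
      using assms[OF _ \<phi>] hdual_zero[OF \<phi> hcomp(1)] hdual_hcomp[OF \<phi>] by (cases "m = n") auto
  qed
  then show ?thesis using hcomp(1)[of v n] by simp
qed

end

lemma graded_space_susp:
  fixes s :: "'f::field \<Rightarrow> 'a::ab_group_add \<Rightarrow> 'a"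
  assumes "graded_space s G"
  shows "graded_space s (susp G)"
proof -
  interpret grsp s G using assms by unfold_locales
  have shift: "Sum_any (\<lambda>n. c (n + k)) = Sum_any c" "finite {n. c (n + k) \<noteq> 0} \<longleftrightarrow> finite {n. c n \<noteq> 0}"
    for c :: "int \<Rightarrow> 'a" and k
  proof -
    have im: "{n. c n \<noteq> 0} = (\<lambda>n. n + k) ` {n. c (n + k) \<noteq> 0}"
      by (auto simp: image_iff) (metis diff_add_cancel)
    show "finite {n. c (n + k) \<noteq> 0} \<longleftrightarrow> finite {n. c n \<noteq> 0}"
      unfolding im by (subst finite_image_iff) (auto intro: inj_onI)
    show "Sum_any (\<lambda>n. c (n + k)) = Sum_any c"
      unfolding Sum_any.expand_set im by (subst sum.reindex) (auto intro: inj_onI)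
  qed
  have "\<exists>!c. (\<forall>n. c n \<in> susp G n) \<and> finite {n. c n \<noteq> 0} \<and> v = Sum_any c" for v
  proof (rule ex1I)
    show "(\<forall>n. hcomp v (n + - 1) \<in> susp G n) \<and> finite {n. hcomp v (n + - 1) \<noteq> 0} \<and>
        v = Sum_any (\<lambda>n. hcomp v (n + - 1))"
      using hcomp[of v] unfolding shift(1)[of "hcomp v" "- 1"] shift(2)[of "hcomp v" "- 1"] by (simp add: susp_def)
  next
    fix c assume c: "(\<forall>n. c n \<in> susp G n) \<and> finite {n. c n \<noteq> 0} \<and> v = Sum_any c"
    have "hcomp v = (\<lambda>n. c (n + 1))"
    proof (rule hcomp_unique)
      show "c (n + 1) \<in> G n" for n using c by (metis add_diff_cancel_right' susp_def)
    qed (use c in \<open>simp_all only: shift\<close>)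
    then show "c = (\<lambda>n. hcomp v (n + - 1))" by simp
  qed
  then show ?thesis
    using vector_space_axioms subspace_G by (simp add: graded_space_def susp_def)
qed

section \<open>Tensors and the symmetric coalgebra\<close>

lemma sum_fun_apply: "(\<Sum>i\<in>I. F i) x = (\<Sum>i\<in>I. F i x)" for F :: "'i \<Rightarrow> 'x \<Rightarrow> 'w::ab_group_add"
  by (induction I rule: infinite_finite_induct) auto

lemma koszul_add: "koszul (m + n) = (koszul m * koszul n :: 'f::comm_ring_1)"
  by (simp add: koszul_def)

lemma wdeg_simps [simp]: "wdeg [] = 0" "wdeg (a # w) = fst a + wdeg w" "wdeg (v @ w) = wdeg v + wdeg w"
  by (auto simp: wdeg_def)

lemma hword_simps [simp]:
  "hword s G []" "hword s G (a # w) \<longleftrightarrow> snd a \<in> hdual s G (fst a) \<and> hword s G w"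
  "hword s G (v @ w) \<longleftrightarrow> hword s G v \<and> hword s G w"
  by (auto simp: hword_def)

lemma graded_symmetricI:
  "(\<And>w w' m n \<phi> \<psi>. t (w @ (m, \<phi>) # (n, \<psi>) # w') = koszul (m * n) * t (w @ (n, \<psi>) # (m, \<phi>) # w'))
    \<Longrightarrow> graded_symmetric t"
  unfolding graded_symmetric_def by blast

lemma graded_symmetricD:
  "graded_symmetric t \<Longrightarrow> t (w @ (m, \<phi>) # (n, \<psi>) # w') = koszul (m * n) * t (w @ (n, \<psi>) # (m, \<phi>) # w')"
  unfolding graded_symmetric_def by blast

definition tens_span :: "('f::field \<Rightarrow> 'a::ab_group_add \<Rightarrow> 'a) \<Rightarrow> (int \<Rightarrow> 'a set) \<Rightarrow> 'a set \<Rightarrow> ('f, 'a) tens set" where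
  "tens_span s G U = fs.span {pure_tensor s G us | us. set us \<subseteq> U}"

lemma Sc_iff: "t \<in> Sc s G U \<longleftrightarrow> t \<in> tens_span s G U \<and> graded_symmetric t"
  by (simp add: Sc_def tens_span_def)

text \<open>This is \<open>v \<otimes> t\<close>. The guard mirrors \<open>pure_tensor\<close>,
  which vanishes on words with a letter that is not a functional of its announced degree.\<close>

definition tcons :: "('f::field \<Rightarrow> 'a::ab_group_add \<Rightarrow> 'a) \<Rightarrow> (int \<Rightarrow> 'a set) \<Rightarrow> 'a \<Rightarrow> ('f, 'a) tens \<Rightarrow> ('f, 'a) tens" where
  "tcons s G v t = (\<lambda>w. case w of [] \<Rightarrow> 0 | a # w' \<Rightarrow> if snd a \<in> hdual s G (fst a) then snd a v * t w' else 0)"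

lemma tcons_simps [simp]:
  "tcons s G v t [] = 0"
  "tcons s G v t (a # w) = (if snd a \<in> hdual s G (fst a) then snd a v * t w else 0)"
  by (auto simp: tcons_def)

lemma pure_tensor_Nil: "pure_tensor s G [] = (\<lambda>w. if w = [] then 1 else 0)"
  by (auto simp: pure_tensor_def fun_eq_iff)

lemma pure_tensor_Cons: "pure_tensor s G (u # us) = tcons s G u (pure_tensor s G us)"
proof
  fix w show "pure_tensor s G (u # us) w = tcons s G u (pure_tensor s G us) w"
    by (cases w) (auto simp: pure_tensor_def case_prod_unfold)
qed

context grsp
begin

lemma subspace_tens_span: "fs.subspace (tens_span s G U)"
  by (simp add: tens_span_def fs.subspace_span)

lemma pure_in_tens_span: "set us \<subseteq> U \<Longrightarrow> pure_tensor s G us \<in> tens_span s G U"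
  unfolding tens_span_def by (rule fs.span_base) auto

lemma tens_span_induct [consumes 1, case_names zero add]:
  assumes "t \<in> tens_span s G U" "P 0"
    "\<And>c us t. set us \<subseteq> U \<Longrightarrow> t \<in> tens_span s G U \<Longrightarrow> P t \<Longrightarrow> P (fscale c (pure_tensor s G us) + t)"
  shows "P t"
proof -
  have "t \<in> tens_span s G U \<and> P t"
    using assms(1) unfolding tens_span_def
  proof (induction rule: fs.span_induct_alt)
    case base
    then show ?case using assms(2) fs.span_zero by blast
  next
    case (step c x y)
    then show ?case using assms(3) unfolding tens_span_def
      by (blast intro: fs.span_add fs.span_scale fs.span_base)
  qed
  then show ?thesis by simp
qed

lemma tens_span_mono: "U \<subseteq> U' \<Longrightarrow> tens_span s G U \<subseteq> tens_span s G U'"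
  unfolding tens_span_def by (rule fs.span_mono) auto

lemma tens_span_linear_image:
  assumes t: "t \<in> tens_span s G U" and T: "fs.subspace T" "F 0 = 0"
    "\<And>c x y. F (fscale c x + y) = fscale c (F x) + F y"
    and "\<And>us. set us \<subseteq> U \<Longrightarrow> F (pure_tensor s G us) \<in> T"
  shows "F t \<in> T"
  using t
proof (induction rule: tens_span_induct)
  case zero
  show ?case unfolding T(2) by (rule fs.subspace_0[OF T(1)])
next
  case (add c us t)
  then show ?case unfolding T(3)
    by (intro fs.subspace_add[OF T(1)] fs.subspace_scale[OF T(1)] assms(5))
qed

lemma tens_span_hword: "t \<in> tens_span s G U \<Longrightarrow> \<not> hword s G w \<Longrightarrow> t w = 0"
  by (induction rule: tens_span_induct) (auto simp: fscale_def pure_tensor_def)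

lemma tens_span_bounded: "t \<in> tens_span s G U \<Longrightarrow> \<exists>N. \<forall>w. N \<le> length w \<longrightarrow> t w = 0"
proof (induction rule: tens_span_induct)
  case (add c us t)
  then obtain N where "\<forall>w. N \<le> length w \<longrightarrow> t w = 0" by blast
  then show ?case
    by (intro exI[of _ "max N (Suc (length us))"]) (auto simp: fscale_def pure_tensor_def)
qed auto

lemma tcons_in_tens_span: "v \<in> U \<Longrightarrow> t \<in> tens_span s G U \<Longrightarrow> tcons s G v t \<in> tens_span s G U"
proof (rule tens_span_linear_image[of t U _ "tcons s G v"])
  show "tcons s G v 0 = 0"
    by (rule ext) (auto simp: tcons_def split: list.split)
  show "tcons s G v (fscale c x + y) = fscale c (tcons s G v x) + tcons s G v y" for c x y
    by (rule ext) (auto simp: tcons_def fscale_def algebra_simps split: list.split)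
  show "tcons s G v (pure_tensor s G us) \<in> tens_span s G U" if "v \<in> U" "set us \<subseteq> U" for us
    unfolding pure_tensor_Cons[symmetric] using that by (intro pure_in_tens_span) auto
qed (auto simp: subspace_tens_span)

lemma pure_tensor_append:
  "pure_tensor s G us (x @ y) = (if length x \<le> length us
     then pure_tensor s G (take (length x) us) x * pure_tensor s G (drop (length x) us) y else 0)"
proof (induction x arbitrary: us)
  case Nil
  then show ?case by (simp add: pure_tensor_Nil)
next
  case (Cons a x)
  then show ?case by (cases us) (auto simp: pure_tensor_Nil pure_tensor_Cons)
qed

lemma diag_pure_tensor:
  "diag (pure_tensor s G us) =
     tsum (map (\<lambda>i. (pure_tensor s G (take i us), pure_tensor s G (drop i us))) [0..<Suc (length us)])"
proof (rule prod_fun_ext)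
  fix x y
  have "sum_list (map (\<lambda>i. pure_tensor s G (take i us) x * pure_tensor s G (drop i us) y) [0..<Suc (length us)])
      = (\<Sum>i\<in>{0..<Suc (length us)}. pure_tensor s G (take i us) x * pure_tensor s G (drop i us) y)"
    by (simp only: interv_sum_list_conv_sum_set_nat set_upt)
  \<comment> \<open>All cuts but the one at \<open>length x\<close> contribute zero, since a pure
    tensor is supported on words of its own length.\<close>
  also have "\<dots> = (\<Sum>i\<in>{0..<Suc (length us)}. if i = length x then pure_tensor s G us (x @ y) else 0)"
    by (rule sum.cong) (auto simp: pure_tensor_append, auto simp: pure_tensor_def)
  also have "\<dots> = pure_tensor s G us (x @ y)"
    by (auto simp: pure_tensor_append)
  finally show "diag (pure_tensor s G us) (x, y) =
     tsum (map (\<lambda>i. (pure_tensor s G (take i us), pure_tensor s G (drop i us))) [0..<Suc (length us)]) (x, y)"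
    by (simp only: diag_def case_prod_conv tsum_apply map_map o_def)
qed

lemma diag_tens_span: "t \<in> tens_span s G U \<Longrightarrow> \<exists>xs. diag t = tsum xs"
proof (induction rule: tens_span_induct)
  case zero
  show ?case by (rule exI[of _ "[]"]) (auto simp: fun_eq_iff diag_def tsum_apply)
next
  case (add c us t)
  then obtain xs where xs: "diag t = tsum xs" by blast
  let ?ys = "map (\<lambda>i. (pure_tensor s G (take i us), pure_tensor s G (drop i us))) [0..<Suc (length us)]"
  have "diag (fscale c (pure_tensor s G us) + t) = fscale c (tsum ?ys) + tsum xs"
    unfolding diag_pure_tensor[symmetric] xs[symmetric] by (rule prod_fun_ext) (simp add: diag_def fscale_def)
  also have "\<dots> = tsum (map (\<lambda>(p, q). (fscale c p, q)) ?ys @ xs)"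
    by (rule prod_fun_ext)
      (simp add: tsum_apply case_prod_unfold o_def fscale_def mult.assoc sum_list_cmult algebra_simps del: upt_Suc)
  finally show ?case by blast
qed

lemma tens_span_row:
  assumes "t \<in> tens_span s G U" shows "(\<lambda>z. t (u @ z)) \<in> tens_span s G U"
proof (rule tens_span_linear_image[OF assms, of _ "\<lambda>t z. t (u @ z)"])
  show "(\<lambda>z. pure_tensor s G us (u @ z)) \<in> tens_span s G U" if "set us \<subseteq> U" for us
  proof -
    have "(\<lambda>z. pure_tensor s G us (u @ z)) =
        fscale (if length u \<le> length us then pure_tensor s G (take (length u) us) u else 0)
          (pure_tensor s G (drop (length u) us))"
      by (auto simp: pure_tensor_append fscale_def fun_eq_iff)
    moreover have "set (drop (length u) us) \<subseteq> U" by (rule order_trans[OF set_drop_subset that])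
    ultimately show ?thesis
      using fs.subspace_scale[OF subspace_tens_span] pure_in_tens_span by simp
  qed
qed (auto simp: subspace_tens_span fscale_def fun_eq_iff)

lemma tens_span_column:
  assumes "t \<in> tens_span s G U" shows "(\<lambda>z. t (z @ u)) \<in> tens_span s G U"
proof (rule tens_span_linear_image[OF assms, of _ "\<lambda>t z. t (z @ u)"])
  show "(\<lambda>z. pure_tensor s G us (z @ u)) \<in> tens_span s G U" if "set us \<subseteq> U" for us
  proof -
    let ?k = "length us - length u"
    have "(\<lambda>z. pure_tensor s G us (z @ u)) =
        fscale (if length u \<le> length us then pure_tensor s G (drop ?k us) u else 0)
          (pure_tensor s G (take ?k us))"
    proof
      fix z
      show "pure_tensor s G us (z @ u) =
        fscale (if length u \<le> length us then pure_tensor s G (drop ?k us) u else 0)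
          (pure_tensor s G (take ?k us)) z"
      proof (cases "length z + length u = length us")
        case True
        then have "?k = length z" by simp
        then show ?thesis using True by (simp add: pure_tensor_append fscale_def)
      next
        case False
        then show ?thesis by (auto simp: pure_tensor_def fscale_def)
      qed
    qed
    moreover have "set (take ?k us) \<subseteq> U" by (rule order_trans[OF set_take_subset that])
    ultimately show ?thesis
      using fs.subspace_scale[OF subspace_tens_span] pure_in_tens_span by simp
  qed
qed (auto simp: subspace_tens_span fscale_def fun_eq_iff)

lemma subspace_graded_symmetric: "fs.subspace {t :: ('f, 'a) tens. graded_symmetric t}"
proof (rule fs.subspaceI)
  show "0 \<in> {t. graded_symmetric t}" by (rule CollectI, rule graded_symmetricI) simp
next
  fix x y :: "('f, 'a) tens" assume "x \<in> {t. graded_symmetric t}" "y \<in> {t. graded_symmetric t}"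
  then have x: "graded_symmetric x" and y: "graded_symmetric y" by simp_all
  show "x + y \<in> {t. graded_symmetric t}"
  proof (rule CollectI, rule graded_symmetricI)
    fix w w' m n \<phi> \<psi>
    show "(x + y) (w @ (m, \<phi>) # (n, \<psi>) # w') = koszul (m * n) * (x + y) (w @ (n, \<psi>) # (m, \<phi>) # w')"
      using graded_symmetricD[OF x, of w m \<phi> n \<psi> w'] graded_symmetricD[OF y, of w m \<phi> n \<psi> w']
      by (simp add: distrib_left)
  qed
next
  fix c and x :: "('f, 'a) tens" assume "x \<in> {t. graded_symmetric t}"
  then have x: "graded_symmetric x" by simp
  show "fscale c x \<in> {t. graded_symmetric t}"
  proof (rule CollectI, rule graded_symmetricI)
    fix w w' m n \<phi> \<psi>
    show "fscale c x (w @ (m, \<phi>) # (n, \<psi>) # w') = koszul (m * n) * fscale c x (w @ (n, \<psi>) # (m, \<phi>) # w')"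
      using graded_symmetricD[OF x, of w m \<phi> n \<psi> w'] by (simp add: fscale_def)
  qed
qed

lemma subspace_Sc: "fs.subspace (Sc s G U)"
proof -
  have "Sc s G U = tens_span s G U \<inter> {t. graded_symmetric t}" by (auto simp: Sc_iff)
  then show ?thesis using fs.subspace_inter[OF subspace_tens_span subspace_graded_symmetric] by simp
qed

text \<open>Adjacent letters of a row or a column are adjacent in the full word, so graded symmetry
  passes to both and \<open>subcoalgebraI\<close> applies.\<close>

lemma subcoalgebra_Sc: "subcoalgebra (Sc s G U)"
proof (rule subcoalgebraI[OF subspace_Sc])
  fix t u assume t: "t \<in> Sc s G U"
  show "\<exists>xs. diag t = tsum xs" using t diag_tens_span by (auto simp: Sc_iff)
  have sym: "graded_symmetric t" using t by (simp add: Sc_iff)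
  have "graded_symmetric (\<lambda>z. t (u @ z))"
    by (rule graded_symmetricI) (metis append_assoc graded_symmetricD[OF sym])
  then show "(\<lambda>z. t (u @ z)) \<in> Sc s G U" using t tens_span_row by (simp add: Sc_iff)
  have "graded_symmetric (\<lambda>z. t (z @ u))"
    by (rule graded_symmetricI) (simp, rule graded_symmetricD[OF sym])
  then show "(\<lambda>z. t (z @ u)) \<in> Sc s G U" using t tens_span_column by (simp add: Sc_iff)
qed

lemma pure_Nil_in_Sc: "pure_tensor s G [] \<in> Sc s G U"
  using pure_in_tens_span[of "[]" U] unfolding Sc_iff
  by (intro conjI graded_symmetricI) (simp_all add: pure_tensor_Nil)

lemma Sc_mono: "U \<subseteq> U' \<Longrightarrow> Sc s G U \<subseteq> Sc s G U'"
  using tens_span_mono[of U U'] by (auto simp: Sc_iff)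

lemma Sc_hword: "t \<in> Sc s G U \<Longrightarrow> \<not> hword s G w \<Longrightarrow> t w = 0"
  using tens_span_hword by (auto simp: Sc_iff)

lemma Sc_bounded: "t \<in> Sc s G U \<Longrightarrow> \<exists>N. \<forall>w. N \<le> length w \<longrightarrow> t w = 0"
  using tens_span_bounded by (auto simp: Sc_iff)

lemma tensor_length_tens_span:
  assumes "t \<in> tens_span s G U" shows "tensor_length l t \<in> tens_span s G U"
proof (rule tens_span_linear_image[OF assms, of _ "tensor_length l"])
  show "tensor_length l (pure_tensor s G us) \<in> tens_span s G U" if "set us \<subseteq> U" for us
  proof -
    have "tensor_length l (pure_tensor s G us) = (if length us = l then pure_tensor s G us else 0)"
      by (auto simp: tensor_length_def pure_tensor_def fun_eq_iff)
    then show ?thesis using pure_in_tens_span[OF that] fs.subspace_0[OF subspace_tens_span] by simp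
  qed
qed (auto simp: subspace_tens_span fscale_def fun_eq_iff tensor_length_def)

lemma tensor_length_Sc: "t \<in> Sc s G U \<Longrightarrow> tensor_length l t \<in> Sc s G U"
  unfolding Sc_iff
proof (intro conjI graded_symmetricI)
  assume t: "t \<in> tens_span s G U \<and> graded_symmetric t"
  show "tensor_length l t \<in> tens_span s G U" using t tensor_length_tens_span by blast
  show "tensor_length l t (w @ (m, \<phi>) # (n, \<psi>) # w') =
      koszul (m * n) * tensor_length l t (w @ (n, \<psi>) # (m, \<phi>) # w')" for w w' m n \<phi> \<psi>
    using graded_symmetricD[OF conjunct2[OF t], of w m \<phi> n \<psi> w'] by (simp add: tensor_length_def)
qed

lemma corestrict_eqI:
  assumes "\<And>n \<phi>. \<phi> \<in> hdual s G n \<Longrightarrow> t [(n, \<phi>)] = \<phi> v"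
  shows "corestrict s G t = v"
  unfolding corestrict_def
proof (rule the_equality)
  show "\<forall>n. \<forall>\<phi>\<in>hdual s G n. t [(n, \<phi>)] = \<phi> v" using assms by blast
  show "w = v" if "\<forall>n. \<forall>\<phi>\<in>hdual s G n. t [(n, \<phi>)] = \<phi> w" for w
    using that assms by (intro hdual_separating) metis
qed

lemma corestrict_spec:
  assumes "t \<in> tens_span s G U"
  shows "corestrict s G t \<in> span U \<and> (\<forall>n. \<forall>\<phi>\<in>hdual s G n. t [(n, \<phi>)] = \<phi> (corestrict s G t))"
proof -
  have "\<exists>v \<in> span U. \<forall>n. \<forall>\<phi>\<in>hdual s G n. t [(n, \<phi>)] = \<phi> v"
    using assms
  proof (induction rule: tens_span_induct)
    case zero
    show ?case by (intro bexI[of _ 0]) (auto simp: hdual_simps span_zero)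
  next
    case (add c us t)
    then obtain v where v: "v \<in> span U" "\<forall>n. \<forall>\<phi>\<in>hdual s G n. t [(n, \<phi>)] = \<phi> v" by blast
    \<comment> \<open>Pure tensors of length other than one vanish on one-letter words, whence the
      default value zero.\<close>
    define w where "w = (if length us = 1 then hd us else 0)"
    have "\<forall>n. \<forall>\<phi>\<in>hdual s G n. pure_tensor s G us [(n, \<phi>)] = \<phi> w"
      by (cases us) (auto simp: w_def pure_tensor_Nil pure_tensor_Cons hdual_simps pure_tensor_def)
    moreover have "w \<in> span U"
      using add(1) by (cases us) (auto simp: w_def intro: span_base span_zero)
    ultimately show ?case using v
      by (intro bexI[of _ "s c w + v"]) (auto simp: hdual_simps fscale_def intro: span_add span_scale)
  qed
  then show ?thesis using corestrict_eqI by metis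
qed

lemma corestrict_apply: "t \<in> Sc s G U \<Longrightarrow> \<phi> \<in> hdual s G n \<Longrightarrow> \<phi> (corestrict s G t) = t [(n, \<phi>)]"
  using corestrict_spec[of t U] by (auto simp: Sc_iff)

lemma corestrict_in: "t \<in> Sc s G U \<Longrightarrow> subspace U \<Longrightarrow> corestrict s G t \<in> U"
  using corestrict_spec[of t U] by (auto simp: Sc_iff simp flip: span_eq_iff)

lemma lin_on_corestrict: "lin_on fscale s (Sc s G U) (corestrict s G)"
proof (rule lin_onI)
  show "corestrict s G (x + y) = corestrict s G x + corestrict s G y" if "x \<in> Sc s G U" "y \<in> Sc s G U" for x y
    by (rule corestrict_eqI) (use that in \<open>simp add: hdual_simps corestrict_apply\<close>)
  show "corestrict s G (fscale c x) = s c (corestrict s G x)" if "x \<in> Sc s G U" for c x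
    by (rule corestrict_eqI) (use that in \<open>simp add: hdual_simps corestrict_apply fscale_def\<close>)
qed

lemma corestrict_pure: "corestrict s G (pure_tensor s G us) = (if length us = 1 then hd us else 0)"
  by (rule corestrict_eqI, cases us) (auto simp: pure_tensor_Nil pure_tensor_Cons hdual_simps pure_tensor_def)

end

section \<open>Homogeneous components\<close>

definition tcomp :: "int \<Rightarrow> ('f::zero, 'a) tens \<Rightarrow> ('f, 'a) tens" where
  "tcomp a t = (\<lambda>w. if wdeg w = a then t w else 0)"

lemma homogeneous_tcomp: "homogeneous a (tcomp a t)"
  by (simp add: homogeneous_def tcomp_def)

context grsp
begin

text \<open>Degrees add along a word: a first letter of degree \<open>n\<close> reads off
  \<open>hcomp v n\<close> and leaves degree \<open>a - n\<close> to the rest.\<close>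

lemma tcomp_tcons:
  assumes "finite A" "{n. hcomp v n \<noteq> 0} \<subseteq> A"
  shows "tcomp a (tcons s G v t) = (\<Sum>n\<in>A. tcons s G (hcomp v n) (tcomp (a - n) t))"
proof
  fix w
  show "tcomp a (tcons s G v t) w = (\<Sum>n\<in>A. tcons s G (hcomp v n) (tcomp (a - n) t)) w"
  proof (cases w)
    case Nil
    then show ?thesis unfolding sum_fun_apply by (simp add: tcomp_def)
  next
    case (Cons b w')
    show ?thesis
    proof (cases "snd b \<in> hdual s G (fst b)")
      case True
      \<comment> \<open>The degree of the letter is adjoined because it may lie outside
        \<open>A\<close>; the component of \<open>v\<close> in that degree is then zero.\<close>
      have "(\<Sum>n\<in>A. snd b (hcomp v n) * tcomp (a - n) t w')
          = (\<Sum>n\<in>insert (fst b) A. snd b (hcomp v n) * tcomp (a - n) t w')"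
      proof (rule sum.mono_neutral_left)
        have "hcomp v n = 0" if "n \<notin> A" for n using that assms(2) by auto
        then show "\<forall>n\<in>insert (fst b) A - A. snd b (hcomp v n) * tcomp (a - n) t w' = 0"
          using hdual_simps(3)[OF True] by simp
      qed (use assms in auto)
      also have "\<dots> = (\<Sum>n\<in>{fst b}. snd b (hcomp v n) * tcomp (a - n) t w')"
        using assms hdual_zero[OF True hcomp(1)] by (intro sum.mono_neutral_right) auto
      also have "\<dots> = snd b v * tcomp (a - fst b) t w'" using hdual_hcomp[OF True, of v] by simp
      finally show ?thesis using True Cons unfolding sum_fun_apply by (auto simp: tcomp_def)
    qed (unfold sum_fun_apply, simp add: Cons tcomp_def)
  qed
qed

lemma tcomp_tens_span:
  assumes "t \<in> tens_span s G UNIV" shows "tcomp a t \<in> tens_span s G UNIV"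
proof (rule tens_span_linear_image[OF assms, of _ "tcomp a"])
  show "tcomp a (pure_tensor s G us) \<in> tens_span s G UNIV" for us
  proof (induction us arbitrary: a)
    case Nil
    have "tcomp a (pure_tensor s G []) = (if a = 0 then pure_tensor s G [] else 0)"
      by (auto simp: tcomp_def pure_tensor_Nil fun_eq_iff)
    then show ?case using pure_in_tens_span[of "[]" UNIV] fs.subspace_0[OF subspace_tens_span] by simp
  next
    case (Cons v us)
    show ?case unfolding pure_tensor_Cons
      by (subst tcomp_tcons[OF hcomp(2)[of v]])
        (auto intro!: fs.subspace_sum[OF subspace_tens_span] tcons_in_tens_span Cons)
  qed
qed (auto simp: subspace_tens_span fscale_def fun_eq_iff tcomp_def)

lemma tcomp_Sc: "t \<in> Sc s G UNIV \<Longrightarrow> tcomp a t \<in> Sc s G UNIV"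
  unfolding Sc_iff
proof (intro conjI graded_symmetricI)
  assume t: "t \<in> tens_span s G UNIV \<and> graded_symmetric t"
  show "tcomp a t \<in> tens_span s G UNIV" using t tcomp_tens_span by blast
  show "tcomp a t (w @ (m, \<phi>) # (n, \<psi>) # w') =
      koszul (m * n) * tcomp a t (w @ (n, \<psi>) # (m, \<phi>) # w')" for w w' m n \<phi> \<psi>
    using graded_symmetricD[OF conjunct2[OF t], of w m \<phi> n \<psi> w'] by (simp add: tcomp_def algebra_simps)
qed

text \<open>The vectors of a pure tensor need not be homogeneous, so it may have several degrees;
  each vector contributes finitely many, and the degrees of the product are sums of these.\<close>

lemma tens_span_finite_degrees: "t \<in> tens_span s G U \<Longrightarrow> \<exists>A. finite A \<and> (\<forall>w. t w \<noteq> 0 \<longrightarrow> wdeg w \<in> A)"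
proof (induction rule: tens_span_induct)
  case (add c us t)
  have "\<exists>A. finite A \<and> (\<forall>w. pure_tensor s G us w \<noteq> 0 \<longrightarrow> wdeg w \<in> A)"
  proof (induction us)
    case Nil
    show ?case by (intro exI[of _ "{0}"]) (auto simp: pure_tensor_Nil)
  next
    case (Cons v us)
    then obtain A where A: "finite A" "\<forall>w. pure_tensor s G us w \<noteq> 0 \<longrightarrow> wdeg w \<in> A" by blast
    let ?B = "(\<lambda>(n, a). n + a) ` ({n. hcomp v n \<noteq> 0} \<times> A)"
    have "wdeg w \<in> ?B" if "pure_tensor s G (v # us) w \<noteq> 0" for w
    proof (cases w)
      case (Cons b w')
      have b: "snd b \<in> hdual s G (fst b)" "snd b v \<noteq> 0" "pure_tensor s G us w' \<noteq> 0"
        using that by (auto simp: Cons pure_tensor_Cons split: if_splits)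
      have "hcomp v (fst b) \<noteq> 0" using hdual_hcomp[OF b(1), of v] b(2) hdual_simps(3)[OF b(1)] by auto
      then show ?thesis using A(2) b(3) by (force simp: Cons)
    qed (use that in \<open>simp add: pure_tensor_Cons\<close>)
    moreover have "finite ?B" using A(1) hcomp(2) by blast
    ultimately show ?case by blast
  qed
  then obtain A where A: "finite A" "\<forall>w. pure_tensor s G us w \<noteq> 0 \<longrightarrow> wdeg w \<in> A" by blast
  obtain B where B: "finite B" "\<forall>w. t w \<noteq> 0 \<longrightarrow> wdeg w \<in> B" using add by blast
  show ?case
  proof (intro exI[of _ "A \<union> B"] conjI allI impI)
    fix w assume "(fscale c (pure_tensor s G us) + t) w \<noteq> 0"
    then have "pure_tensor s G us w \<noteq> 0 \<or> t w \<noteq> 0" by (auto simp: fscale_def)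
    then show "wdeg w \<in> A \<union> B" using A B by blast
  qed (use A B in auto)
qed auto

lemma sum_tcomp:
  fixes t :: "('f, 'a) tens"
  assumes "finite A" "\<And>w. t w \<noteq> 0 \<Longrightarrow> wdeg w \<in> A"
  shows "(\<Sum>a\<in>A. tcomp a t) = t"
proof
  fix w show "(\<Sum>a\<in>A. tcomp a t) w = t w"
    unfolding sum_fun_apply using assms by (cases "t w = 0") (auto simp: tcomp_def)
qed

lemma Sc_sum_tcomp:
  assumes "t \<in> Sc s G UNIV"
  obtains A where "finite A" "(\<Sum>a\<in>A. tcomp a t) = t"
  using assms tens_span_finite_degrees sum_tcomp unfolding Sc_iff by metis

lemma parity_Sc:
  assumes "t \<in> Sc s G UNIV" shows "parity t \<in> Sc s G UNIV"
proof -
  obtain A where A: "finite A" "(\<Sum>a\<in>A. tcomp a t) = t" using assms by (rule Sc_sum_tcomp)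
  have "parity t w = (\<Sum>a\<in>A. fscale (koszul a) (tcomp a t)) w" for w
  proof -
    have "parity t w = koszul (wdeg w) * (\<Sum>a\<in>A. tcomp a t w)"
      using fun_cong[OF A(2), of w] by (simp add: parity_def sum_fun_apply)
    also have "\<dots> = (\<Sum>a\<in>A. fscale (koszul a) (tcomp a t) w)"
      unfolding sum_distrib_left by (rule sum.cong) (auto simp: tcomp_def fscale_def)
    finally show ?thesis by (simp add: sum_fun_apply)
  qed
  then have "parity t = (\<Sum>a\<in>A. fscale (koszul a) (tcomp a t))" ..
  then show ?thesis using tcomp_Sc[OF assms]
    by (auto intro!: fs.subspace_sum[OF subspace_Sc] fs.subspace_scale[OF subspace_Sc])
qed

lemma Sc_degree_induct:
  assumes "t \<in> Sc s G UNIV" "lin_on fscale sW (Sc s G UNIV) f" "lin_on fscale sW (Sc s G UNIV) g" "vector_space sW"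
    and "\<And>n t. t \<in> Sc s G UNIV \<Longrightarrow> homogeneous n t \<Longrightarrow> f t = g t"
  shows "f t = g t"
proof -
  obtain A where A: "finite A" "(\<Sum>a\<in>A. tcomp a t) = t" using assms(1) by (rule Sc_sum_tcomp)
  have "f (\<Sum>a\<in>A. tcomp a t) = (\<Sum>a\<in>A. f (tcomp a t))"
    by (rule lin_on_sum[OF assms(2) subspace_Sc fs.vector_space_axioms assms(4)]) (rule tcomp_Sc[OF assms(1)])
  also have "\<dots> = (\<Sum>a\<in>A. g (tcomp a t))"
    using assms(5)[OF tcomp_Sc[OF assms(1)] homogeneous_tcomp] by simp
  also have "\<dots> = g (\<Sum>a\<in>A. tcomp a t)"
    by (rule lin_on_sum[OF assms(3) subspace_Sc fs.vector_space_axioms assms(4), symmetric]) (rule tcomp_Sc[OF assms(1)])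
  finally show ?thesis unfolding A(2) .
qed

text \<open>An arbitrary presentation may have inhomogeneous factors. Cutting both factors into
  components and keeping the pairs of total degree \<open>n\<close> still presents
  \<open>diag t\<close>, because \<open>t\<close> vanishes on words of any other degree.\<close>

lemma diag_homogeneous:
  assumes t: "t \<in> Sc s G UNIV" and n: "homogeneous n t"
  obtains xs where "set xs \<subseteq> Sc s G UNIV \<times> Sc s G UNIV" "diag t = tsum xs"
    "\<And>p q. (p, q) \<in> set xs \<Longrightarrow> \<exists>a. homogeneous a p \<and> homogeneous (n - a) q"
proof -
  interpret C: coalg "Sc s G UNIV" by unfold_locales (rule subcoalgebra_Sc)
  obtain xs where xs: "set xs \<subseteq> Sc s G UNIV \<times> Sc s G UNIV" "diag t = tsum xs" using t by (rule C.diag_tsum)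
  have "\<exists>A. finite A \<and> (\<forall>p\<in>fst ` set xs. \<forall>w. p w \<noteq> 0 \<longrightarrow> wdeg w \<in> A)"
    using xs(1)
  proof (induction xs)
    case Nil
    then show ?case by auto
  next
    case (Cons x xs)
    then obtain A where A: "finite A" "\<forall>p\<in>fst ` set xs. \<forall>w. p w \<noteq> 0 \<longrightarrow> wdeg w \<in> A" by auto
    have "fst x \<in> tens_span s G UNIV" using Cons(2) by (auto simp: Sc_iff)
    then obtain B where "finite B" "\<forall>w. fst x w \<noteq> 0 \<longrightarrow> wdeg w \<in> B" using tens_span_finite_degrees by blast
    then show ?case using A by (intro exI[of _ "A \<union> B"]) auto
  qed
  then obtain A where A: "finite A" "\<And>p q w. (p, q) \<in> set xs \<Longrightarrow> p w \<noteq> 0 \<Longrightarrow> wdeg w \<in> A"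
    by fastforce
  obtain as where as: "set as = A" "distinct as" using finite_distinct_list[OF A(1)] by blast
  define ys where "ys = concat (map (\<lambda>(p, q). map (\<lambda>a. (tcomp a p, tcomp (n - a) q)) as) xs)"
  have "diag t = tsum ys"
  proof (rule prod_fun_ext)
    fix x y
    have one: "sum_list (map (\<lambda>a. tcomp a p x * tcomp (n - a) q y) as) =
        (if wdeg x + wdeg y = n then p x * q y else 0)" if "(p, q) \<in> set xs" for p q
    proof -
      have "sum_list (map (\<lambda>a. tcomp a p x * tcomp (n - a) q y) as) = (\<Sum>a\<in>A. tcomp a p x * tcomp (n - a) q y)"
        unfolding as(1)[symmetric] by (rule sum_list_distinct_conv_sum_set[OF as(2)])
      also have "\<dots> = (\<Sum>a\<in>A. if a = wdeg x then (if wdeg x + wdeg y = n then p x * q y else 0) else 0)"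
        by (rule sum.cong) (auto simp: tcomp_def)
      also have "\<dots> = (if wdeg x + wdeg y = n then p x * q y else 0)"
        using A(1) A(2)[OF that, of x] by auto
      finally show ?thesis .
    qed
    have "tsum ys (x, y) = sum_list (map (\<lambda>(p, q). sum_list (map (\<lambda>a. tcomp a p x * tcomp (n - a) q y) as)) xs)"
      unfolding ys_def by (induction xs) (auto simp: tsum_apply o_def)
    also have "\<dots> = sum_list (map (\<lambda>(p, q). if wdeg x + wdeg y = n then p x * q y else 0) xs)"
      using one by (intro arg_cong[where f = sum_list] map_cong) auto
    also have "\<dots> = (if wdeg x + wdeg y = n then tsum xs (x, y) else 0)"
      by (simp add: tsum_apply case_prod_unfold)
    also have "\<dots> = diag t (x, y)"
      using n by (simp add: xs(2)[symmetric] diag_def homogeneous_def) (metis wdeg_simps(3))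
    finally show "diag t (x, y) = tsum ys (x, y)" ..
  qed
  moreover have "set ys \<subseteq> Sc s G UNIV \<times> Sc s G UNIV"
    using xs(1) by (auto simp: ys_def intro!: tcomp_Sc)
  moreover have "\<exists>a. homogeneous a p \<and> homogeneous (n - a) q" if "(p, q) \<in> set ys" for p q
    using that homogeneous_tcomp unfolding ys_def by fastforce
  ultimately show thesis using that by blast
qed

lemma tens_span_degree_0:
  assumes "t \<in> tens_span s G (G 0)" "t w \<noteq> 0"
  shows "\<forall>a\<in>set w. fst a = 0"
proof -
  have "pure_tensor s G us w = 0" if "set us \<subseteq> G 0" "\<exists>a\<in>set w. fst a \<noteq> 0" for us
    using that
  proof (induction us arbitrary: w)
    case Nil
    then show ?case by (auto simp: pure_tensor_Nil)
  next
    case (Cons u us)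
    then show ?case using hdual_zero[of _ _ u 0]
      by (cases w) (auto simp: pure_tensor_Cons)
  qed
  note pure = this
  have "t w = 0" if "\<exists>a\<in>set w. fst a \<noteq> 0"
    using assms(1)
  proof (induction rule: tens_span_induct)
    case (add c us t)
    then show ?case using pure[OF add(1) that] by (simp add: fscale_def)
  qed simp
  then show ?thesis using assms(2) by blast
qed

lemma homogeneous_0: "t \<in> Sc s G (G 0) \<Longrightarrow> homogeneous 0 t"
proof -
  assume t: "t \<in> Sc s G (G 0)"
  have "wdeg w = 0" if "\<forall>a\<in>set w. fst a = 0" for w :: "('f, 'a) word"
    using that by (induction w) auto
  then show ?thesis using t tens_span_degree_0 by (auto simp: homogeneous_def Sc_iff)
qed

lemma parity_0: "t \<in> Sc s G (G 0) \<Longrightarrow> parity t = t"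
  using homogeneous_0 by (fastforce simp: homogeneous_def parity_def koszul_def fun_eq_iff)

end

section \<open>Permutation invariance in degree zero\<close>

lemma swap_invariant_mset:
  assumes swap: "\<And>w a b w'. t (w @ a # b # w') = t (w @ b # a # w')" and "mset w = mset w'"
  shows "t (u @ w) = t (u @ w')"
proof -
  have move: "t (u @ a # v @ w) = t (u @ v @ a # w)" for u a v w
  proof (induction v arbitrary: u)
    case (Cons b v)
    have "t (u @ a # (b # v) @ w) = t ((u @ [b]) @ a # v @ w)" using swap[of u a b "v @ w"] by simp
    also have "\<dots> = t ((u @ [b]) @ v @ a # w)" by (rule Cons)
    finally show ?case by simp
  qed simp
  show ?thesis using assms(2)
  proof (induction w arbitrary: u w')
    case (Cons a w)
    then have "a \<in> set w'" by (metis list.set_intros(1) set_mset_mset)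
    then obtain x y where w': "w' = x @ a # y" by (meson split_list)
    then have "mset w = mset (x @ y)" using Cons(2) by simp
    then have "t ((u @ [a]) @ w) = t ((u @ [a]) @ x @ y)" by (rule Cons(1))
    then show ?case using move[of u a x y] by (simp add: w')
  qed simp
qed

text \<open>A letter of nonzero degree makes \<open>t\<close> vanish on both words, and between
  letters of degree zero every Koszul sign is \<open>1\<close>; adjacent transpositions generate the
  remaining rearrangements.\<close>

lemma (in grsp) Sc_0_perm:
  assumes t: "t \<in> Sc s G (G 0)" and w: "mset w = mset w'"
  shows "t w = t w'"
proof -
  have "t (x @ a # b # y) = t (x @ b # a # y)" for x a b y
  proof (cases "fst a = 0 \<and> fst b = 0")
    case True
    then obtain \<phi> \<psi> where "a = (0, \<phi>)" "b = (0, \<psi>)" by (metis prod.collapse)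
    moreover have "graded_symmetric t" using t by (simp add: Sc_iff)
    ultimately show ?thesis using graded_symmetricD[of t x 0 \<phi> 0 \<psi> y] by (simp add: koszul_def)
  next
    case False
    have z: "t w = 0" if "\<exists>a\<in>set w. fst a \<noteq> 0" for w
      using that tens_span_degree_0[of t w] t unfolding Sc_iff by blast
    have "t (x @ a # b # y) = 0" "t (x @ b # a # y) = 0"
      using False by (auto intro!: z)
    then show ?thesis by simp
  qed
  from swap_invariant_mset[of t, OF this w, of "[]"] show ?thesis by simp
qed

section \<open>Coalgebra morphisms with given corestriction\<close>

lemma graded_symmetric_move:
  assumes "graded_symmetric t"
  shows "t (x @ a # v @ y) = koszul (fst a * wdeg v) * t (x @ v @ a # y)"
proof (induction v arbitrary: x)
  case Nil
  then show ?case by (simp add: koszul_def)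
next
  case (Cons b v)
  have "t (x @ a # (b # v) @ y) = koszul (fst a * fst b) * t ((x @ [b]) @ a # v @ y)"
    using graded_symmetricD[OF assms, of x "fst a" "snd a" "fst b" "snd b" "v @ y"] by simp
  also have "\<dots> = koszul (fst a * fst b) * koszul (fst a * wdeg v) * t ((x @ [b]) @ v @ a # y)"
    by (subst Cons) simp
  finally show ?case by (simp add: koszul_add[symmetric] algebra_simps)
qed

lemma graded_symmetric_block:
  assumes "graded_symmetric t"
  shows "t (x @ u @ v @ y) = koszul (wdeg u * wdeg v) * t (x @ v @ u @ y)"
proof (induction u arbitrary: x)
  case Nil
  then show ?case by (simp add: koszul_def)
next
  case (Cons a u)
  have "t (x @ (a # u) @ v @ y) = koszul (wdeg u * wdeg v) * t (x @ a # v @ u @ y)"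
    using Cons[of "x @ [a]"] by simp
  also have "\<dots> = koszul (wdeg u * wdeg v) * koszul (fst a * wdeg v) * t (x @ v @ a # u @ y)"
    by (subst graded_symmetric_move[OF assms]) simp
  finally show ?case by (simp add: koszul_add[symmetric] algebra_simps)
qed

definition deg_on :: "('f::field, 'b) tens set \<Rightarrow> (int \<Rightarrow> 'a set) \<Rightarrow> int \<Rightarrow> (('f, 'b) tens \<Rightarrow> 'a) \<Rightarrow> bool" where
  "deg_on C G k f \<longleftrightarrow> (\<forall>n. \<forall>t\<in>C. homogeneous n t \<longrightarrow> f t \<in> G (n + k))"

lemma homogeneous_row: "homogeneous n t \<Longrightarrow> homogeneous (n - wdeg u) (\<lambda>z. t (u @ z))"
  by (auto simp: homogeneous_def)

lemma homogeneous_column: "homogeneous n t \<Longrightarrow> homogeneous (n - wdeg u) (\<lambda>z. t (z @ u))"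
  by (auto simp: homogeneous_def)

lemma homogeneous_tcomp_eq: "homogeneous n t \<Longrightarrow> tcomp m t = (if n = m then t else 0)"
  by (auto simp: homogeneous_def tcomp_def fun_eq_iff)

lemma lin_on_tcomp:
  fixes C :: "('f::field, 'b) tens set"
  assumes "lin_on fscale sW C f" "\<And>t. t \<in> C \<Longrightarrow> tcomp m t \<in> C"
  shows "lin_on fscale sW C (\<lambda>t. f (tcomp m t))"
proof (rule lin_onI)
  have "tcomp m (x + y) = tcomp m x + tcomp m y" for x y :: "('f, 'b) tens" by (auto simp: tcomp_def fun_eq_iff)
  then show "f (tcomp m (x + y)) = f (tcomp m x) + f (tcomp m y)" if "x \<in> C" "y \<in> C" for x y
    using lin_on_add[OF assms(1) assms(2)[OF that(1)] assms(2)[OF that(2)]] by simp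
  have "tcomp m (fscale c x) = fscale c (tcomp m x)" for c and x :: "('f, 'b) tens"
    by (auto simp: tcomp_def fun_eq_iff fscale_def)
  then show "f (tcomp m (fscale c x)) = sW c (f (tcomp m x))" if "x \<in> C" for c x
    using lin_on_scale[OF assms(1) assms(2)[OF that]] by simp
qed

text \<open>The functional reads only degree \<open>m\<close> of \<open>f t\<close>, and
  \<open>f\<close> produces that degree from component \<open>m - k\<close> alone. This is how a
  sign that depends on the degree of a variable word becomes a constant.\<close>

lemma deg_on_hdual:
  assumes "grsp sC GC" "grsp s G" and f: "lin_on fscale s (Sc sC GC UNIV) f" "deg_on (Sc sC GC UNIV) G k f"
    and \<phi>: "\<phi> \<in> hdual s G m" and t: "t \<in> Sc sC GC UNIV"
  shows "\<phi> (f t) = \<phi> (f (tcomp (m - k) t))"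
proof -
  interpret H: grsp sC GC by fact
  interpret V: grsp s G by fact
  have lin: "lin_on fscale (*) (Sc sC GC UNIV) (\<lambda>t. \<phi> (f t))"
    by (rule lin_on_compose[OF f(1) V.hdual_linear[OF \<phi>]])
  show ?thesis
  proof (rule H.Sc_degree_induct[OF t lin lin_on_tcomp[OF lin H.tcomp_Sc] vector_space_field])
    fix n t assume t: "t \<in> Sc sC GC UNIV" "homogeneous n t"
    have "\<phi> (f t) = 0" if "n \<noteq> m - k"
      using f(2) t that V.hdual_zero[OF \<phi>, of "f t" "n + k"] by (auto simp: deg_on_def)
    moreover have "\<phi> (f 0) = 0"
      by (rule lin_on_zero[OF lin H.subspace_Sc fs.vector_space_axioms vector_space_field])
    ultimately show "\<phi> (f t) = \<phi> (f (tcomp (m - k) t))"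
      by (simp add: homogeneous_tcomp_eq[OF t(2)])
  qed
qed

primrec lift_at ::
  "('f::field \<Rightarrow> 'a::ab_group_add \<Rightarrow> 'a) \<Rightarrow> (int \<Rightarrow> 'a set) \<Rightarrow> (('f, 'b) tens \<Rightarrow> 'a) \<Rightarrow>
   ('f, 'a) word \<Rightarrow> ('f, 'b) tens \<Rightarrow> 'f" where
  "lift_at s G f [] t = t []"
| "lift_at s G f (a # w) t =
     (if snd a \<in> hdual s G (fst a) then snd a (f (\<lambda>z. lift_at s G f w (\<lambda>z'. t (z @ z')))) else 0)"

text \<open>
  The word \<open>\<phi>\<^sub>1 \<dots> \<phi>\<^sub>k\<close> evaluates the \<open>k\<close>-fold tensor power of \<open>f\<close> on the iterated diagonal; this is the
  classical formula for the morphism with corestriction \<open>f\<close>.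
\<close>

definition lift_map ::
  "('f::field \<Rightarrow> 'a::ab_group_add \<Rightarrow> 'a) \<Rightarrow> (int \<Rightarrow> 'a set) \<Rightarrow> (('f, 'b) tens \<Rightarrow> 'a) \<Rightarrow>
   ('f, 'b) tens \<Rightarrow> ('f, 'a) tens" where
  "lift_map s G f t = (\<lambda>w. lift_at s G f w t)"

lemma lift_at_append:
  "lift_at s G f (x @ y) t = lift_at s G f x (\<lambda>z. lift_at s G f y (\<lambda>z'. t (z @ z')))"
  by (induction x arbitrary: t) auto

lemma bilin_on_tprod:
  assumes "lin_on fscale fscale C F" "lin_on fscale fscale C F'"
  shows "bilin_on fscale C C (\<lambda>p q. tprod (F p) (F' q))"
  using assms by (auto intro!: bilin_onI lin_onI simp: lin_on_def fun_eq_iff tprod_def fscale_def algebra_simps)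

text \<open>\<open>bounded\<close> stands for cocompleteness and \<open>unit\<close> for vanishing
  on the coaugmentation; together they keep the lift within finite sums of tensors.\<close>

locale colift = coalg C + V: grsp s G
  for C :: "('f::field, 'b) tens set" and s :: "'f \<Rightarrow> 'a::ab_group_add \<Rightarrow> 'a" and G :: "int \<Rightarrow> 'a set" +
  fixes f :: "('f, 'b) tens \<Rightarrow> 'a"
  assumes bounded: "t \<in> C \<Longrightarrow> \<exists>N. \<forall>w. N \<le> length w \<longrightarrow> t w = 0"
    and lin: "lin_on fscale s C f"
    and unit: "t \<in> C \<Longrightarrow> (\<And>w. w \<noteq> [] \<Longrightarrow> t w = 0) \<Longrightarrow> f t = 0"
begin

lemma lin_hdual: "\<phi> \<in> hdual s G n \<Longrightarrow> lin_on fscale (*) C (\<lambda>t. \<phi> (f t))"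
  by (rule lin_on_compose[OF lin V.hdual_linear])

lemma lin_on_lift_at: "lin_on fscale (*) C (lift_at s G f w)"
proof (induction w)
  case Nil
  show ?case by (simp add: lin_on_eval)
next
  case (Cons a w)
  show ?case
  proof (cases "snd a \<in> hdual s G (fst a)")
    case True
    note l = lin_hdual[OF True]
    show ?thesis
    proof (rule lin_onI)
      fix x y assume x: "x \<in> C" and y: "y \<in> C"
      have "lift_at s G f w (\<lambda>z'. (x + y) (z @ z')) =
          lift_at s G f w (\<lambda>z'. x (z @ z')) + lift_at s G f w (\<lambda>z'. y (z @ z'))" for z
        using lin_on_add[OF Cons row_in[OF x] row_in[OF y], of z z] by (simp add: plus_fun_def)
      then show "lift_at s G f (a # w) (x + y) = lift_at s G f (a # w) x + lift_at s G f (a # w) y"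
        using True lin_on_add[OF l partial_row_in[OF x Cons] partial_row_in[OF y Cons]]
        by (simp add: plus_fun_def)
    next
      fix c x assume x: "x \<in> C"
      have "lift_at s G f w (\<lambda>z'. fscale c x (z @ z')) = c * lift_at s G f w (\<lambda>z'. x (z @ z'))" for z
        using lin_on_scale[OF Cons row_in[OF x], of c z] by (simp add: fscale_def)
      then show "lift_at s G f (a # w) (fscale c x) = c * lift_at s G f (a # w) x"
        using True lin_on_scale[OF l partial_row_in[OF x Cons], of c] by (simp add: fscale_def)
    qed
  qed (simp add: lin_on_def)
qed

lemma lift_inner_in: "t \<in> C \<Longrightarrow> (\<lambda>z. lift_at s G f w (\<lambda>z'. t (z @ z'))) \<in> C"
  by (rule partial_row_in[OF _ lin_on_lift_at])

text \<open>A nonempty left factor uses up at least one letter, so the induction hypothesis confines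
  the inner function to the empty word, and there \<open>f\<close> gives zero by
  \<open>unit\<close>.\<close>

lemma lift_at_bounded:
  assumes "t \<in> C" "\<And>w. N \<le> length w \<Longrightarrow> t w = 0" "N \<le> length w"
  shows "lift_at s G f w t = 0"
  using assms
proof (induction w arbitrary: N t)
  case (Cons a w)
  have "lift_at s G f w (\<lambda>z'. t (z @ z')) = 0" if "z \<noteq> []" for z
  proof (rule Cons.IH)
    show "(\<lambda>z'. t (z @ z')) \<in> C" by (rule row_in[OF Cons.prems(1)])
    show "t (z @ w') = 0" if "N - 1 \<le> length w'" for w'
      using that \<open>z \<noteq> []\<close> by (intro Cons.prems(2)) (cases z, auto)
  qed (use Cons.prems in auto)
  then have "f (\<lambda>z. lift_at s G f w (\<lambda>z'. t (z @ z'))) = 0"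
    by (intro unit lift_inner_in Cons.prems) auto
  then show ?case using V.hdual_simps(3) by simp
qed simp

lemma lift_map_unit:
  assumes "t \<in> C" "\<And>w. w \<noteq> [] \<Longrightarrow> t w = 0"
  shows "lift_map s G f t = fscale (t []) (pure_tensor s G [])"
proof
  fix w show "lift_map s G f t w = fscale (t []) (pure_tensor s G []) w"
  proof (cases w)
    case (Cons a w')
    have "t v = 0" if "1 \<le> length v" for v using that assms(2) by (cases v) auto
    then have "lift_at s G f w t = 0" using lift_at_bounded[OF assms(1), of 1 w] by (simp add: Cons)
    then show ?thesis by (simp add: lift_map_def pure_tensor_Nil fscale_def Cons)
  qed (simp add: lift_map_def pure_tensor_Nil fscale_def)
qed

lemma lift_at_tsum:
  assumes "set xs \<subseteq> C \<times> C" "diag t = tsum xs" "snd a \<in> hdual s G (fst a)"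
  shows "lift_at s G f (a # w) t = sum_list (map (\<lambda>(p, q). snd a (f p) * lift_at s G f w q) xs)"
  using lin_partial_row[OF lin_hdual[OF assms(3)] vector_space_field lin_on_lift_at assms(1,2)] assms(3)
  by (simp add: mult.commute)

text \<open>Each length is treated separately: splitting the diagonal once writes the component of
  length \<open>k + 1\<close> as a sum of tensors of \<open>f p\<close> with the length
  \<open>k\<close> component of the lift of \<open>q\<close>. Boundedness leaves finitely many
  lengths.\<close>

lemma lift_map_tens_span:
  assumes t: "t \<in> C" and U: "f ` C \<subseteq> U"
  shows "lift_map s G f t \<in> tens_span s G U"
proof -
  have *: "tensor_length k (lift_map s G f t) \<in> tens_span s G U" if "t \<in> C" for k t
    using that
  proof (induction k arbitrary: t)
    case 0
    have "tensor_length 0 (lift_map s G f t) = fscale (t []) (pure_tensor s G [])"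
      by (auto simp: tensor_length_def lift_map_def fscale_def pure_tensor_Nil fun_eq_iff)
    then show ?case
      using fs.subspace_scale[OF V.subspace_tens_span V.pure_in_tens_span[of "[]"]] by simp
  next
    case (Suc k)
    obtain xs where xs: "set xs \<subseteq> C \<times> C" "diag t = tsum xs" using Suc(2) by (rule diag_tsum)
    let ?g = "\<lambda>(p, q). tcons s G (f p) (tensor_length k (lift_map s G f q))"
    have "tensor_length (Suc k) (lift_map s G f t) = sum_list (map ?g xs)"
    proof
      fix w
      show "tensor_length (Suc k) (lift_map s G f t) w = sum_list (map ?g xs) w"
      proof (cases w)
        case Nil
        then show ?thesis unfolding sum_list_fun_apply by (simp add: tensor_length_def case_prod_unfold)
      next
        case (Cons a w')
        show ?thesis
        proof (cases "snd a \<in> hdual s G (fst a)")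
          case True
          show ?thesis
            unfolding Cons sum_list_fun_apply
            by (simp add: tensor_length_def lift_map_def lift_at_tsum[OF xs True] True case_prod_unfold
                del: lift_at.simps)
        next
          case False
          then show ?thesis
            unfolding Cons sum_list_fun_apply by (simp add: tensor_length_def lift_map_def case_prod_unfold)
        qed
      qed
    qed
    moreover have "sum_list (map ?g xs) \<in> tens_span s G U"
    proof (rule conjunct2[OF lin_on_sum_list[of fscale fscale _ id]])
      show "?g i \<in> tens_span s G U" if "i \<in> set xs" for i
      proof -
        obtain p q where i: "i = (p, q)" by (cases i)
        then have "p \<in> C" "q \<in> C" using that xs(1) by auto
        then show ?thesis using Suc(1) U by (auto simp: i intro!: V.tcons_in_tens_span)
      qed
    qed (auto simp: lin_on_def V.subspace_tens_span vector_space_fscale)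
    ultimately show ?case by simp
  qed
  obtain N where N: "\<And>w. N \<le> length w \<Longrightarrow> t w = 0" using bounded[OF t] by blast
  have "lift_map s G f t = (\<Sum>k<N. tensor_length k (lift_map s G f t))"
    using lift_at_bounded[OF t N]
    by (intro ext) (auto simp: sum_fun_apply tensor_length_def lift_map_def not_less)
  also have "\<dots> \<in> tens_span s G U"
    using *[OF t] by (intro fs.subspace_sum[OF V.subspace_tens_span]) auto
  finally show ?thesis .
qed

lemma corestrict_lift_map: "t \<in> C \<Longrightarrow> corestrict s G (lift_map s G f t) = f t"
  by (rule V.corestrict_eqI) (simp add: lift_map_def)

lemma lin_on_lift_map: "lin_on fscale fscale C (lift_map s G f)"
  using lin_on_lift_at by (simp add: lin_on_def lift_map_def fun_eq_iff fscale_def)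

lemma diag_lift_map:
  assumes t: "t \<in> C"
  shows "diag (lift_map s G f t) = tlift C C (\<lambda>p q. tprod (lift_map s G f p) (lift_map s G f q)) (diag t)"
proof -
  obtain xs where xs: "set xs \<subseteq> C \<times> C" "diag t = tsum xs" using t by (rule diag_tsum)
  show ?thesis
    unfolding tlift_diag[OF bilin_on_tprod[OF lin_on_lift_map lin_on_lift_map] vector_space_fscale xs]
  proof (rule prod_fun_ext)
    fix x y
    have "lift_at s G f (x @ y) t = sum_list (map (\<lambda>(p, q). lift_at s G f x p * lift_at s G f y q) xs)"
      using lin_partial_row[OF lin_on_lift_at vector_space_field lin_on_lift_at xs]
      by (simp add: lift_at_append mult.commute)
    then show "diag (lift_map s G f t) (x, y) =
        sum_list (map (\<lambda>(p, q). tprod (lift_map s G f p) (lift_map s G f q)) xs) (x, y)"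
      unfolding sum_list_fun_apply by (simp add: diag_def lift_map_def tprod_def case_prod_unfold)
  qed
qed

lemma coalgebra_map_lift_map: "lift_map s G f ` C \<subseteq> C' \<Longrightarrow> coalgebra_map C C' (lift_map s G f)"
  using lin_on_lift_map diag_lift_map by (auto simp: coalgebra_map_def counit_def lift_map_def)

text \<open>Compatibility with the diagonal, read at the cut after the first letter, expresses
  \<open>F t\<close> on a word through the corestriction of one factor and a shorter word on the
  other. The counit settles the empty word.\<close>

lemma coalgebra_map_eq_lift_map:
  assumes F: "coalgebra_map C (Sc s G U) F" "\<And>t. t \<in> C \<Longrightarrow> corestrict s G (F t) = f t" and t: "t \<in> C"
  shows "F t = lift_map s G f t"
proof -
  have F_in: "F t \<in> Sc s G U" if "t \<in> C" for t using F(1) that by (auto simp: coalgebra_map_def)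
  have linF: "lin_on fscale fscale C F" using F(1) by (simp add: coalgebra_map_def)
  have "F t w = lift_at s G f w t" if "t \<in> C" for w t
    using that
  proof (induction w arbitrary: t)
    case Nil
    then show ?case using F(1) by (auto simp: coalgebra_map_def counit_def)
  next
    case (Cons a w)
    show ?case
    proof (cases "snd a \<in> hdual s G (fst a)")
      case True
      obtain xs where xs: "set xs \<subseteq> C \<times> C" "diag t = tsum xs" using Cons(2) by (rule diag_tsum)
      have "F t (a # w) = diag (F t) ([a], w)" by (simp add: diag_def)
      also have "diag (F t) = sum_list (map (\<lambda>(p, q). tprod (F p) (F q)) xs)"
        using F(1) Cons(2) tlift_diag[OF bilin_on_tprod[OF linF linF] vector_space_fscale xs]
        by (simp add: coalgebra_map_def)
      also have "\<dots> ([a], w) = sum_list (map (\<lambda>(p, q). F p [a] * F q w) xs)"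
        unfolding sum_list_fun_apply by (simp add: tprod_def case_prod_unfold)
      also have "\<dots> = sum_list (map (\<lambda>(p, q). snd a (f p) * lift_at s G f w q) xs)"
      proof (intro arg_cong[where f = sum_list] map_cong refl, clarify)
        fix p q assume "(p, q) \<in> set xs"
        then have pq: "p \<in> C" "q \<in> C" using xs by auto
        have "F p [a] = snd a (f p)"
          using V.corestrict_apply[OF F_in[OF pq(1)] True] F(2)[OF pq(1)] by simp
        then show "F p [a] * F q w = snd a (f p) * lift_at s G f w q" using Cons(1)[OF pq(2)] by simp
      qed
      also have "\<dots> = lift_at s G f (a # w) t" by (rule lift_at_tsum[OF xs True, symmetric])
      finally show ?thesis .
    next
      case False
      then show ?thesis using V.Sc_hword[OF F_in[OF Cons(2)], of "a # w"] by simp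
    qed
  qed
  then show ?thesis using t by (auto simp: lift_map_def)
qed

end

text \<open>The sign comes from evaluating the commuted diagonal on components of fixed degree.\<close>

lemma graded_symmetric_lift_map:
  assumes "grsp sC GC" "colift (Sc sC GC UNIV) s G f" and deg: "deg_on (Sc sC GC UNIV) G 0 f"
    and t: "t \<in> Sc sC GC UNIV"
  shows "graded_symmetric (lift_map s G f t)"
proof -
  interpret H: grsp sC GC by fact
  interpret colift "Sc sC GC UNIV" s G f by fact
  have two: "lift_at s G f (a # b # w) t = koszul (fst a * fst b) * lift_at s G f (b # a # w) t"
    if t: "t \<in> Sc sC GC UNIV" for a b w t
  proof (cases "snd a \<in> hdual s G (fst a) \<and> snd b \<in> hdual s G (fst b)")
    case True
    then have a: "snd a \<in> hdual s G (fst a)" and b: "snd b \<in> hdual s G (fst b)" by auto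
    define u where "u = (\<lambda>z. lift_at s G f w (\<lambda>z'. t (z @ z')))"
    have u: "u \<in> Sc sC GC UNIV" unfolding u_def by (rule lift_inner_in[OF t])
    have sym: "u (z @ z') = koszul (wdeg z * wdeg z') * u (z' @ z)" for z z'
      using graded_symmetric_block[of u "[]" z z' "[]"] u by (simp add: Sc_iff)
    define \<alpha> where "\<alpha> = (\<lambda>t. snd a (f t))"
    define \<beta> where "\<beta> = (\<lambda>t. snd b (f t))"
    have lin\<alpha>: "lin_on fscale (*) (Sc sC GC UNIV) \<alpha>" unfolding \<alpha>_def by (rule lin_hdual[OF a])
    have lin\<beta>: "lin_on fscale (*) (Sc sC GC UNIV) \<beta>" unfolding \<beta>_def by (rule lin_hdual[OF b])
    have comp\<alpha>: "\<alpha> t = \<alpha> (tcomp (fst a) t)" if "t \<in> Sc sC GC UNIV" for t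
      unfolding \<alpha>_def using deg_on_hdual[OF assms(1) V.grsp_axioms lin deg a that] by simp
    have comp\<beta>: "\<beta> t = \<beta> (tcomp (fst b) t)" if "t \<in> Sc sC GC UNIV" for t
      unfolding \<beta>_def using deg_on_hdual[OF assms(1) V.grsp_axioms lin deg b that] by simp
    have "lift_at s G f (a # b # w) t = \<alpha> (\<lambda>z. \<beta> (\<lambda>z'. u (z @ z')))"
      using a b by (simp add: \<alpha>_def \<beta>_def u_def)
    also have "\<dots> = \<beta> (\<lambda>z'. \<alpha> (\<lambda>z. u (z @ z')))"
      by (rule fubini[OF u lin\<alpha> lin\<beta>])
    also have "(\<lambda>z'. \<alpha> (\<lambda>z. u (z @ z'))) = (\<lambda>z'. koszul (fst a * wdeg z') * \<alpha> (\<lambda>z. u (z' @ z)))"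
    proof
      fix z'
      have "tcomp (fst a) (\<lambda>z. u (z @ z')) = fscale (koszul (fst a * wdeg z')) (tcomp (fst a) (\<lambda>z. u (z' @ z)))"
        by (rule ext) (simp add: tcomp_def fscale_def sym[of _ z'])
      then show "\<alpha> (\<lambda>z. u (z @ z')) = koszul (fst a * wdeg z') * \<alpha> (\<lambda>z. u (z' @ z))"
        using comp\<alpha>[OF column_in[OF u], of z'] comp\<alpha>[OF row_in[OF u], of z']
          lin_on_scale[OF lin\<alpha> H.tcomp_Sc[OF row_in[OF u]]] by simp
    qed
    also have "\<beta> \<dots> = koszul (fst a * fst b) * \<beta> (\<lambda>z'. \<alpha> (\<lambda>z. u (z' @ z)))"
    proof -
      let ?r = "\<lambda>z'. koszul (fst a * wdeg z') * \<alpha> (\<lambda>z. u (z' @ z))"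
      have r: "(\<lambda>z'. \<alpha> (\<lambda>z. u (z' @ z))) \<in> Sc sC GC UNIV" by (rule partial_row_in[OF u lin\<alpha>])
      \<comment> \<open>Because of the varying sign, membership of \<open>?r\<close> in the
        coalgebra is not visible from its formula; identifying it with a partial evaluation supplies
        it.\<close>
      have "?r = (\<lambda>z'. \<alpha> (\<lambda>z. u (z @ z')))"
        using calculation \<open>(\<lambda>z'. \<alpha> (\<lambda>z. u (z @ z'))) = ?r\<close> by simp
      moreover have "(\<lambda>z'. \<alpha> (\<lambda>z. u (z @ z'))) \<in> Sc sC GC UNIV" by (rule partial_column_in[OF u lin\<alpha>])
      ultimately have "\<beta> ?r = \<beta> (tcomp (fst b) ?r)" using comp\<beta> by simp
      also have "tcomp (fst b) ?r = fscale (koszul (fst a * fst b)) (tcomp (fst b) (\<lambda>z'. \<alpha> (\<lambda>z. u (z' @ z))))"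
        by (rule ext) (simp add: tcomp_def fscale_def)
      also have "\<beta> \<dots> = koszul (fst a * fst b) * \<beta> (\<lambda>z'. \<alpha> (\<lambda>z. u (z' @ z)))"
        using lin_on_scale[OF lin\<beta> H.tcomp_Sc[OF r]] comp\<beta>[OF r] by simp
      finally show ?thesis .
    qed
    also have "\<beta> (\<lambda>z'. \<alpha> (\<lambda>z. u (z' @ z))) = lift_at s G f (b # a # w) t"
      using a b by (simp add: \<alpha>_def \<beta>_def u_def)
    finally show ?thesis .
  next
    case False
    have zero: "\<phi> (f (\<lambda>z. 0)) = 0" if "\<phi> \<in> hdual s G n" for \<phi> n
      using lin_on_zero[OF lin_hdual[OF that] subspace fs.vector_space_axioms vector_space_field]
      by (simp add: zero_fun_def)
    show ?thesis using False zero by auto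
  qed
  show ?thesis
  proof (rule graded_symmetricI)
    fix w w' m n \<phi> \<psi>
    let ?u = "\<lambda>z. lift_at s G f ((n, \<psi>) # (m, \<phi>) # w') (\<lambda>z'. t (z @ z'))"
    have "(\<lambda>z. lift_at s G f ((m, \<phi>) # (n, \<psi>) # w') (\<lambda>z'. t (z @ z'))) = fscale (koszul (m * n)) ?u"
      by (rule ext) (use two[OF row_in[OF t], of "(m, \<phi>)" "(n, \<psi>)" w'] in \<open>simp add: fscale_def del: lift_at.simps\<close>)
    then show "lift_map s G f t (w @ (m, \<phi>) # (n, \<psi>) # w') =
        koszul (m * n) * lift_map s G f t (w @ (n, \<psi>) # (m, \<phi>) # w')"
      unfolding lift_map_def lift_at_append[of s G f w]
      using lin_on_scale[OF lin_on_lift_at lift_inner_in[OF t], of w "koszul (m * n)" "(n, \<psi>) # (m, \<phi>) # w'"]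
      by (simp del: lift_at.simps)
  qed
qed

lemma homogeneous_lift_map:
  assumes "grsp sC GC" "colift (Sc sC GC UNIV) s G f" and deg: "deg_on (Sc sC GC UNIV) G 0 f"
    and t: "t \<in> Sc sC GC UNIV" and n: "homogeneous n t"
  shows "homogeneous n (lift_map s G f t)"
proof -
  interpret H: grsp sC GC by fact
  interpret colift "Sc sC GC UNIV" s G f by fact
  have "wdeg w = n" if "lift_at s G f w t \<noteq> 0" "t \<in> Sc sC GC UNIV" "homogeneous n t" for w t n
    using that
  proof (induction w arbitrary: t n)
    case Nil
    then show ?case by (auto simp: homogeneous_def)
  next
    case (Cons a w)
    let ?r = "\<lambda>z. lift_at s G f w (\<lambda>z'. t (z @ z'))"
    have a: "snd a \<in> hdual s G (fst a)" "snd a (f ?r) \<noteq> 0" using Cons(2) by (auto split: if_splits)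
    have "homogeneous (n - wdeg w) ?r"
      unfolding homogeneous_def
    proof (intro allI impI)
      fix z assume "?r z \<noteq> 0"
      then have "wdeg w = n - wdeg z"
        by (rule Cons(1)) (rule row_in[OF Cons(3)], rule homogeneous_row[OF Cons(4)])
      then show "wdeg z = n - wdeg w" by simp
    qed
    then have "f ?r \<in> G (n - wdeg w)" using deg lift_inner_in[OF Cons(3)] by (auto simp: deg_on_def)
    then have "n - wdeg w = fst a" using V.hdual_zero[OF a(1)] a(2) by blast
    then show ?case by simp
  qed
  then show ?thesis using t n by (auto simp: homogeneous_def lift_map_def)
qed

text \<open>The choice is resolved: \<open>lift_map\<close> has the property from which
  \<open>coalgebra_lift\<close> selects, so the selected morphism has it too, and uniqueness
  identifies the two on the coalgebra.\<close>

lemma coalgebra_lift_eq: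
  assumes H: "grsp sC GC" and f: "colift (Sc sC GC UNIV) s G f" and deg: "deg_on (Sc sC GC UNIV) G 0 f"
    and t: "t \<in> Sc sC GC UNIV"
  shows "coalgebra_lift sC GC s G f t = lift_map s G f t"
proof -
  interpret H: grsp sC GC by fact
  interpret colift "Sc sC GC UNIV" s G f by fact
  let ?P = "\<lambda>F. coalgebra_map (Sc sC GC UNIV) (Sc s G UNIV) F \<and>
     (\<forall>n. \<forall>t\<in>Sc sC GC UNIV. homogeneous n t \<longrightarrow> homogeneous n (F t)) \<and>
     F (pure_tensor sC GC []) = pure_tensor s G [] \<and>
     (\<forall>t\<in>Sc sC GC UNIV. corestrict s G (F t) = f t)"
  have "lift_map s G f t \<in> Sc s G UNIV" if "t \<in> Sc sC GC UNIV" for t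
    using lift_map_tens_span[OF that, of UNIV] graded_symmetric_lift_map[OF H f deg that] by (simp add: Sc_iff)
  then have "coalgebra_map (Sc sC GC UNIV) (Sc s G UNIV) (lift_map s G f)"
    by (intro coalgebra_map_lift_map) auto
  moreover have "lift_map s G f (pure_tensor sC GC []) = pure_tensor s G []"
    using lift_map_unit[OF H.pure_Nil_in_Sc] by (auto simp: pure_tensor_Nil fscale_def)
  ultimately have "?P (lift_map s G f)"
    by (intro conjI allI ballI impI homogeneous_lift_map[OF H f deg] corestrict_lift_map)
  then have "?P (coalgebra_lift sC GC s G f)"
    unfolding coalgebra_lift_def by (rule someI[where P = ?P])
  then show ?thesis by (intro coalgebra_map_eq_lift_map[OF _ _ t, of UNIV]) simp_all
qed

section \<open>Coderivations with given corestriction\<close>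

text \<open>On a word \<open>\<phi>1 ... \<phi>k\<close> this is the sum over \<open>i\<close> of
  \<open>\<phi>i\<close> applied to \<open>\<theta>\<close> of the function that puts a variable
  word in place of \<open>\<phi>i\<close>; the sign is that of moving an operator of degree
  \<open>-1\<close> past the letters before \<open>\<phi>i\<close>.\<close>

primrec coder_at ::
  "('f::field \<Rightarrow> 'a::ab_group_add \<Rightarrow> 'a) \<Rightarrow> (int \<Rightarrow> 'a set) \<Rightarrow> (('f, 'a) tens \<Rightarrow> 'a) \<Rightarrow>
   ('f, 'a) word \<Rightarrow> ('f, 'a) tens \<Rightarrow> 'f" where
  "coder_at s G \<theta> [] t = 0"
| "coder_at s G \<theta> (a # w) t =
     (if snd a \<in> hdual s G (fst a) then snd a (\<theta> (\<lambda>z. t (z @ w))) else 0) +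
     koszul (fst a) * coder_at s G \<theta> w (\<lambda>z. t (a # z))"

definition coder_map ::
  "('f::field \<Rightarrow> 'a::ab_group_add \<Rightarrow> 'a) \<Rightarrow> (int \<Rightarrow> 'a set) \<Rightarrow> (('f, 'a) tens \<Rightarrow> 'a) \<Rightarrow>
   ('f, 'a) tens \<Rightarrow> ('f, 'a) tens" where
  "coder_map s G \<theta> t = (\<lambda>w. coder_at s G \<theta> w t)"

lemma coder_at_append:
  "coder_at s G \<theta> (x @ y) t =
     coder_at s G \<theta> x (\<lambda>z. t (z @ y)) + koszul (wdeg x) * coder_at s G \<theta> y (\<lambda>z. t (x @ z))"
proof (induction x arbitrary: t)
  case Nil
  then show ?case by (simp add: koszul_def)
next
  case (Cons a x)
  show ?case by (simp add: Cons koszul_add algebra_simps)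
qed

locale coderiv = grsp s G
  for s :: "'f::field \<Rightarrow> 'a::ab_group_add \<Rightarrow> 'a" and G :: "int \<Rightarrow> 'a set" +
  fixes \<theta> :: "('f, 'a) tens \<Rightarrow> 'a"
  assumes lin: "lin_on fscale s (Sc s G UNIV) \<theta>"
    and deg: "deg_on (Sc s G UNIV) G (- 1) \<theta>"
    and unit: "t \<in> Sc s G UNIV \<Longrightarrow> (\<And>w. w \<noteq> [] \<Longrightarrow> t w = 0) \<Longrightarrow> \<theta> t = 0"
begin

sublocale C: coalg "Sc s G UNIV"
  by unfold_locales (rule subcoalgebra_Sc)

lemma lin_hdual: "\<phi> \<in> hdual s G n \<Longrightarrow> lin_on fscale (*) (Sc s G UNIV) (\<lambda>t. \<phi> (\<theta> t))"
  by (rule lin_on_compose[OF lin hdual_linear])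

lemma letter_in: "t \<in> Sc s G UNIV \<Longrightarrow> (\<lambda>z. t (a # z)) \<in> Sc s G UNIV"
  using C.row_in[of t "[a]"] by simp

lemma lin_on_coder_at: "lin_on fscale (*) (Sc s G UNIV) (coder_at s G \<theta> w)"
proof (induction w)
  case (Cons a w)
  let ?h = "\<lambda>t. if snd a \<in> hdual s G (fst a) then snd a (\<theta> (\<lambda>z. t (z @ w))) else 0"
  have 1: "?h (x + y) = ?h x + ?h y" if "x \<in> Sc s G UNIV" "y \<in> Sc s G UNIV" for x y
    using lin_on_add[OF lin_hdual C.column_in[OF that(1)] C.column_in[OF that(2)], of "snd a" "fst a" w w]
    by (simp add: plus_fun_def)
  have 2: "?h (fscale c x) = c * ?h x" if "x \<in> Sc s G UNIV" for c x
    using lin_on_scale[OF lin_hdual C.column_in[OF that], of "snd a" "fst a" c w] by (simp add: fscale_def)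
  show ?case
  proof (rule lin_onI)
    fix x y assume x: "x \<in> Sc s G UNIV" and y: "y \<in> Sc s G UNIV"
    show "coder_at s G \<theta> (a # w) (x + y) = coder_at s G \<theta> (a # w) x + coder_at s G \<theta> (a # w) y"
      using lin_on_add[OF Cons letter_in[OF x] letter_in[OF y], of a a] 1[OF x y, unfolded plus_fun_def]
      by (simp add: plus_fun_def algebra_simps)
  next
    fix c x assume x: "x \<in> Sc s G UNIV"
    show "coder_at s G \<theta> (a # w) (fscale c x) = c * coder_at s G \<theta> (a # w) x"
      using lin_on_scale[OF Cons letter_in[OF x], of c a] 2[OF x, of c, unfolded fscale_def]
      by (simp add: fscale_def algebra_simps)
  qed
qed (simp add: lin_on_def)

lemma lin_on_coder_map: "lin_on fscale fscale (Sc s G UNIV) (coder_map s G \<theta>)"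
  using lin_on_coder_at by (simp add: lin_on_def coder_map_def fun_eq_iff fscale_def)

text \<open>Replacing a letter by a nonempty word keeps the length at least \<open>N\<close>. Only
  the empty word could fall below the bound, and \<open>unit\<close> discards its
  contribution.\<close>

lemma coder_at_bounded:
  assumes "t \<in> Sc s G UNIV" "\<And>w. N \<le> length w \<Longrightarrow> t w = 0" "N \<le> length w"
  shows "coder_at s G \<theta> w t = 0"
  using assms
proof (induction w arbitrary: N t)
  case (Cons a w)
  have "\<theta> (\<lambda>z. t (z @ w)) = 0"
  proof (rule unit)
    show "t (z @ w) = 0" if "z \<noteq> []" for z
      using that Cons.prems(3) by (intro Cons.prems(2)) (cases z, auto)
  qed (rule C.column_in[OF Cons.prems(1)])
  moreover have "coder_at s G \<theta> w (\<lambda>z. t (a # z)) = 0"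
    by (rule Cons.IH[OF letter_in[OF Cons.prems(1)], of "N - 1"]) (use Cons.prems in auto)
  ultimately show ?case using hdual_simps(3) by simp
qed simp

lemma coder_at_tsum:
  assumes xs: "set xs \<subseteq> Sc s G UNIV \<times> Sc s G UNIV" "diag t = tsum xs"
  shows "coder_at s G \<theta> (a # w) t = sum_list (map (\<lambda>(p, q).
      (if snd a \<in> hdual s G (fst a) then snd a (\<theta> p) else 0) * q w + koszul (fst a) * p [a] * coder_at s G \<theta> w q) xs)"
proof -
  have "coder_at s G \<theta> w (\<lambda>z. t ([a] @ z)) = sum_list (map (\<lambda>(p, q). p [a] * coder_at s G \<theta> w q) xs)"
    by (rule C.lin_row[OF lin_on_coder_at vector_space_field xs])
  then have 1: "koszul (fst a) * coder_at s G \<theta> w (\<lambda>z. t (a # z)) =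
      sum_list (map (\<lambda>(p, q). koszul (fst a) * p [a] * coder_at s G \<theta> w q) xs)"
    by (simp add: sum_list_cmult[symmetric] case_prod_unfold mult.assoc)
  have 2: "(if snd a \<in> hdual s G (fst a) then snd a (\<theta> (\<lambda>z. t (z @ w))) else 0) =
      sum_list (map (\<lambda>(p, q). (if snd a \<in> hdual s G (fst a) then snd a (\<theta> p) else 0) * q w) xs)"
  proof (cases "snd a \<in> hdual s G (fst a)")
    case True
    then show ?thesis
      using C.lin_column[OF lin_hdual[OF True] vector_space_field xs, of w]
      by (simp add: case_prod_unfold mult.commute)
  qed (simp add: case_prod_unfold)
  show ?thesis by (simp add: 1 2 case_prod_unfold sum_list_map_add)
qed

lemma coder_map_tens_span:
  assumes t: "t \<in> Sc s G UNIV"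
  shows "coder_map s G \<theta> t \<in> tens_span s G UNIV"
proof -
  have *: "tensor_length k (coder_map s G \<theta> t) \<in> tens_span s G UNIV" if "t \<in> Sc s G UNIV" for k t
    using that
  proof (induction k arbitrary: t)
    case 0
    have "tensor_length 0 (coder_map s G \<theta> t) = 0"
      by (auto simp: tensor_length_def coder_map_def fun_eq_iff)
    then show ?case by (simp only: fs.subspace_0[OF subspace_tens_span])
  next
    case (Suc k)
    obtain xs where xs: "set xs \<subseteq> Sc s G UNIV \<times> Sc s G UNIV" "diag t = tsum xs" using Suc(2) by (rule C.diag_tsum)
    \<comment> \<open>The second summand is the identity on the first letter: the corestriction of
      \<open>parity p\<close> supplies \<open>p [a]\<close> together with the sign
      \<open>koszul (fst a)\<close>.\<close>
    let ?g = "\<lambda>(p, q). tcons s G (\<theta> p) (tensor_length k q) +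
      tcons s G (corestrict s G (parity p)) (tensor_length k (coder_map s G \<theta> q))"
    have "tensor_length (Suc k) (coder_map s G \<theta> t) = sum_list (map ?g xs)"
    proof
      fix w
      show "tensor_length (Suc k) (coder_map s G \<theta> t) w = sum_list (map ?g xs) w"
      proof (cases w)
        case Nil
        then show ?thesis unfolding sum_list_fun_apply by (simp add: tensor_length_def case_prod_unfold)
      next
        case (Cons a w')
        have p: "(if snd a \<in> hdual s G (fst a) then snd a (corestrict s G (parity p)) else 0) = koszul (fst a) * p [a]"
          if "p \<in> Sc s G UNIV" for p
          using corestrict_apply[OF parity_Sc[OF that], of "snd a" "fst a"] Sc_hword[OF that, of "[a]"]
          by (simp add: parity_def)
        have "tensor_length (Suc k) (coder_map s G \<theta> t) w = (if length w' = k then coder_at s G \<theta> (a # w') t else 0)"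
          by (simp add: tensor_length_def coder_map_def Cons)
        also have "\<dots> = sum_list (map (\<lambda>i. ?g i w) xs)"
        proof (cases "length w' = k")
          case True
          have "sum_list (map (\<lambda>i. ?g i w) xs) = sum_list (map (\<lambda>(p, q).
            (if snd a \<in> hdual s G (fst a) then snd a (\<theta> p) else 0) * q w' +
              koszul (fst a) * p [a] * coder_at s G \<theta> w' q) xs)"
          proof (intro arg_cong[where f = sum_list] map_cong refl, clarify)
            fix p q assume "(p, q) \<in> set xs"
            then have "p \<in> Sc s G UNIV" using xs by auto
            from p[OF this] show "(tcons s G (\<theta> p) (tensor_length k q) +
               tcons s G (corestrict s G (parity p)) (tensor_length k (coder_map s G \<theta> q))) w =
               (if snd a \<in> hdual s G (fst a) then snd a (\<theta> p) else 0) * q w' +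
              koszul (fst a) * p [a] * coder_at s G \<theta> w' q"
              using True by (auto simp: Cons tensor_length_def coder_map_def split: if_splits)
          qed
          then show ?thesis using coder_at_tsum[OF xs, of a w'] True by simp
        next
          case False
          then have "sum_list (map (\<lambda>i. ?g i w) xs) = sum_list (map (\<lambda>_. 0) xs)"
            by (intro arg_cong[where f = sum_list] map_cong) (auto simp: Cons tensor_length_def)
          then show ?thesis using False by simp
        qed
        finally show ?thesis unfolding sum_list_fun_apply .
      qed
    qed
    moreover have "sum_list (map ?g xs) \<in> tens_span s G UNIV"
    proof (rule conjunct2[OF lin_on_sum_list[of fscale fscale _ id]])
      show "?g i \<in> tens_span s G UNIV" if "i \<in> set xs" for i
      proof -
        obtain p q where i: "i = (p, q)" by (cases i)
        then have "p \<in> Sc s G UNIV" "q \<in> Sc s G UNIV" using that xs(1) by auto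
        then show ?thesis using Suc(1) tensor_length_tens_span[of q UNIV k]
          by (auto simp: i Sc_iff intro!: tcons_in_tens_span fs.subspace_add[OF subspace_tens_span])
      qed
    qed (auto simp: lin_on_def subspace_tens_span vector_space_fscale)
    ultimately show ?case by simp
  qed
  obtain N where N: "\<And>w. N \<le> length w \<Longrightarrow> t w = 0" using Sc_bounded[OF t] by blast
  have "coder_map s G \<theta> t = (\<Sum>k<N. tensor_length k (coder_map s G \<theta> t))"
    using coder_at_bounded[OF t N]
    by (intro ext) (auto simp: sum_fun_apply tensor_length_def coder_map_def not_less)
  also have "\<dots> \<in> tens_span s G UNIV"
    using *[OF t] by (intro fs.subspace_sum[OF subspace_tens_span]) auto
  finally show ?thesis .
qed

lemma hdual_tcomp:
  "\<phi> \<in> hdual s G m \<Longrightarrow> t \<in> Sc s G UNIV \<Longrightarrow> \<phi> (\<theta> t) = \<phi> (\<theta> (tcomp (m + 1) t))"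
  using deg_on_hdual[OF grsp_axioms grsp_axioms lin deg, of \<phi> m t] by simp

text \<open>Since \<open>\<theta>\<close> lowers degrees by one,
  \<open>\<phi> \<circ> \<theta>\<close> sees only words \<open>z\<close> of degree
  \<open>m + 1\<close>; the sign of moving \<open>b\<close> past \<open>z\<close> is then
  constant.\<close>

lemma move_letter:
  assumes u: "u \<in> Sc s G UNIV" and \<phi>: "\<phi> \<in> hdual s G m"
  shows "\<phi> (\<theta> (\<lambda>z. u (b # z @ w))) = koszul (fst b * (m + 1)) * \<phi> (\<theta> (\<lambda>z. u (z @ b # w)))"
proof -
  have in1: "(\<lambda>z. u (b # z @ w)) \<in> Sc s G UNIV"
    using C.column_in[OF C.row_in[OF u], of "[b]" w] by simp
  have in2: "(\<lambda>z. u (z @ b # w)) \<in> Sc s G UNIV" by (rule C.column_in[OF u])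
  have sym: "u (b # z @ w) = koszul (fst b * wdeg z) * u (z @ b # w)" for z
    using graded_symmetric_move[of u "[]" b z w] u by (simp add: Sc_iff)
  have "\<phi> (\<theta> (\<lambda>z. u (b # z @ w))) = \<phi> (\<theta> (tcomp (m + 1) (\<lambda>z. u (b # z @ w))))"
    by (rule hdual_tcomp[OF \<phi> in1])
  also have "tcomp (m + 1) (\<lambda>z. u (b # z @ w)) =
      fscale (koszul (fst b * (m + 1))) (tcomp (m + 1) (\<lambda>z. u (z @ b # w)))"
    by (rule ext) (simp add: tcomp_def fscale_def sym)
  also have "\<phi> (\<theta> \<dots>) = koszul (fst b * (m + 1)) * \<phi> (\<theta> (tcomp (m + 1) (\<lambda>z. u (z @ b # w))))"
    by (rule lin_on_scale[OF lin_hdual[OF \<phi>] tcomp_Sc[OF in2]])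
  also have "\<phi> (\<theta> (tcomp (m + 1) (\<lambda>z. u (z @ b # w)))) = \<phi> (\<theta> (\<lambda>z. u (z @ b # w)))"
    by (rule hdual_tcomp[OF \<phi> in2, symmetric])
  finally show ?thesis .
qed

lemma koszul_swap: "koszul (m * n) * (koszul m * koszul (m * (n + 1))) = (1 :: 'f)"
  by (auto simp: koszul_def)

text \<open>When two neighbouring letters are exchanged, the terms that hit one or the other trade
  places, up to the sign of \<open>move_letter\<close>; terms that hit neither are covered by the
  symmetry of \<open>t\<close>.\<close>

lemma graded_symmetric_coder_map:
  assumes t: "t \<in> Sc s G UNIV"
  shows "graded_symmetric (coder_map s G \<theta> t)"
proof -
  have two: "coder_at s G \<theta> (a # b # w) u = koszul (fst a * fst b) * coder_at s G \<theta> (b # a # w) u"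
    if u: "u \<in> Sc s G UNIV" for a b w u
  proof -
    let ?ev = "\<lambda>a x. if snd a \<in> hdual s G (fst a) then snd a (\<theta> x) else 0"
    have sym: "u (a # b # z) = koszul (fst a * fst b) * u (b # a # z)" for z
      using graded_symmetricD[of u "[]" "fst a" "snd a" "fst b" "snd b" z] u by (simp add: Sc_iff)
    have in2: "(\<lambda>z. u (b # a # z)) \<in> Sc s G UNIV" using C.row_in[OF u, of "[b, a]"] by simp
    have "(\<lambda>z. u (a # b # z)) = fscale (koszul (fst a * fst b)) (\<lambda>z. u (b # a # z))"
      by (simp add: fscale_def sym)
    then have last: "coder_at s G \<theta> w (\<lambda>z. u (a # b # z)) =
        koszul (fst a * fst b) * coder_at s G \<theta> w (\<lambda>z. u (b # a # z))"
      using lin_on_scale[OF lin_on_coder_at in2] by simp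
    have mv: "?ev c (\<lambda>z. u (e # z @ w)) = koszul (fst e * (fst c + 1)) * ?ev c (\<lambda>z. u (z @ e # w))" for c e
      using move_letter[OF u, of "snd c" "fst c" e w] by simp
    have "coder_at s G \<theta> (a # b # w) u = ?ev a (\<lambda>z. u (z @ b # w)) +
        koszul (fst a) * (?ev b (\<lambda>z. u (a # z @ w)) + koszul (fst b) * coder_at s G \<theta> w (\<lambda>z. u (a # b # z)))"
      by simp
    also have "\<dots> = ?ev a (\<lambda>z. u (z @ b # w)) +
        koszul (fst a) * (koszul (fst a * (fst b + 1)) * ?ev b (\<lambda>z. u (z @ a # w)) +
          koszul (fst b) * (koszul (fst a * fst b) * coder_at s G \<theta> w (\<lambda>z. u (b # a # z))))"
      unfolding last mv ..
    also have "\<dots> = koszul (fst a * fst b) * (?ev b (\<lambda>z. u (z @ a # w)) +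
        koszul (fst b) * (koszul (fst b * (fst a + 1)) * ?ev a (\<lambda>z. u (z @ b # w)) +
          koszul (fst a) * coder_at s G \<theta> w (\<lambda>z. u (b # a # z))))"
    proof -
      have k1: "koszul (fst a * fst b) * (koszul (fst b) * koszul (fst b * (fst a + 1))) = (1 :: 'f)"
        using koszul_swap[of "fst b" "fst a"] by (simp add: mult.commute)
      have k2: "koszul (fst a) * koszul (fst a * (fst b + 1)) = (koszul (fst a * fst b) :: 'f)"
        by (auto simp: koszul_def)
      \<comment> \<open>With the signs abstracted to variables, the identity is a consequence of the
        two relations \<open>k1\<close> and \<open>k2\<close>.\<close>
      have alg: "A + ka * (kab1 * B + kb * (kab * D)) = kab * (B + kb * (kba1 * A + ka * D))"
        if "kab * (kb * kba1) = 1" "ka * kab1 = kab" for A B D ka kb kab kab1 kba1 :: 'f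
        using that by algebra
      show ?thesis by (rule alg[OF k1 k2])
    qed
    also have "\<dots> = koszul (fst a * fst b) * coder_at s G \<theta> (b # a # w) u"
      unfolding mv[of a b, symmetric] by simp
    finally show ?thesis .
  qed
  show ?thesis
  proof (rule graded_symmetricI)
    fix w w' m n \<phi> \<psi>
    have sym: "t (z @ (m, \<phi>) # (n, \<psi>) # w') = koszul (m * n) * t (z @ (n, \<psi>) # (m, \<phi>) # w')" for z
      using t by (intro graded_symmetricD) (simp add: Sc_iff)
    have "(\<lambda>z. t (z @ (m, \<phi>) # (n, \<psi>) # w')) = fscale (koszul (m * n)) (\<lambda>z. t (z @ (n, \<psi>) # (m, \<phi>) # w'))"
      by (rule ext) (simp add: fscale_def sym)
    then have "coder_at s G \<theta> w (\<lambda>z. t (z @ (m, \<phi>) # (n, \<psi>) # w')) =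
        koszul (m * n) * coder_at s G \<theta> w (\<lambda>z. t (z @ (n, \<psi>) # (m, \<phi>) # w'))"
      using lin_on_scale[OF lin_on_coder_at C.column_in[OF t]] by simp
    then show "coder_map s G \<theta> t (w @ (m, \<phi>) # (n, \<psi>) # w') =
        koszul (m * n) * coder_map s G \<theta> t (w @ (n, \<psi>) # (m, \<phi>) # w')"
      unfolding coder_map_def coder_at_append[of s G \<theta> w]
      using two[OF C.row_in[OF t], of "(m, \<phi>)" "(n, \<psi>)" w' w]
      by (simp add: algebra_simps del: coder_at.simps)
  qed
qed

lemma homogeneous_coder_map:
  assumes "t \<in> Sc s G UNIV" "homogeneous n t"
  shows "homogeneous (n - 1) (coder_map s G \<theta> t)"
proof -
  have "wdeg w = n - 1" if "coder_at s G \<theta> w t \<noteq> 0" "t \<in> Sc s G UNIV" "homogeneous n t" for w t n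
    using that
  proof (induction w arbitrary: t n)
    case (Cons a w)
    show ?case
    proof (cases "coder_at s G \<theta> w (\<lambda>z. t (a # z)) = 0")
      case True
      then have a: "snd a \<in> hdual s G (fst a)" "snd a (\<theta> (\<lambda>z. t (z @ w))) \<noteq> 0"
        using Cons(2) by (auto split: if_splits)
      have "\<theta> (\<lambda>z. t (z @ w)) \<in> G (n - wdeg w + - 1)"
        using deg C.column_in[OF Cons(3)] homogeneous_column[OF Cons(4)] unfolding deg_on_def by blast
      then have "n - wdeg w + - 1 = fst a" using hdual_zero[OF a(1)] a(2) by blast
      then show ?thesis by simp
    next
      case False
      have "homogeneous (n - fst a) (\<lambda>z. t (a # z))"
        using homogeneous_row[OF Cons(4), of "[a]"] by simp
      from Cons(1)[OF False letter_in[OF Cons(3)] this] show ?thesis by simp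
    qed
  qed simp
  then show ?thesis using assms by (auto simp: homogeneous_def coder_map_def)
qed

lemma bilin_on_coderivation:
  assumes "lin_on fscale fscale (Sc s G UNIV) D"
  shows "bilin_on fscale (Sc s G UNIV) (Sc s G UNIV) (\<lambda>p q. tprod (D p) q + tprod (parity p) (D q))"
  using assms
  by (auto intro!: bilin_onI lin_onI simp: lin_on_def fun_eq_iff tprod_def fscale_def parity_def algebra_simps)

lemma diag_coder_map:
  assumes "t \<in> Sc s G UNIV"
  shows "diag (coder_map s G \<theta> t) =
    tlift (Sc s G UNIV) (Sc s G UNIV)
      (\<lambda>p q. tprod (coder_map s G \<theta> p) q + tprod (parity p) (coder_map s G \<theta> q)) (diag t)"
proof -
  obtain xs where xs: "set xs \<subseteq> Sc s G UNIV \<times> Sc s G UNIV" "diag t = tsum xs" using assms by (rule C.diag_tsum)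
  show ?thesis
    unfolding C.tlift_diag[OF bilin_on_coderivation[OF lin_on_coder_map] vector_space_fscale xs]
  proof (rule prod_fun_ext)
    fix x y
    have "koszul (wdeg x) * sum_list (map (\<lambda>(p, q). p x * coder_at s G \<theta> y q) xs) =
      sum_list (map (\<lambda>(p, q). koszul (wdeg x) * p x * coder_at s G \<theta> y q) xs)"
      unfolding sum_list_cmult[symmetric] by (simp add: case_prod_unfold mult.assoc)
    then show "diag (coder_map s G \<theta> t) (x, y) =
      sum_list (map (\<lambda>(p, q). tprod (coder_map s G \<theta> p) q + tprod (parity p) (coder_map s G \<theta> q)) xs) (x, y)"
      unfolding sum_list_fun_apply
      by (simp add: diag_def coder_map_def coder_at_append tprod_def parity_def case_prod_unfold sum_list_map_add
          C.lin_row[OF lin_on_coder_at vector_space_field xs] C.lin_column[OF lin_on_coder_at vector_space_field xs]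
          mult.commute[of "snd _ y"])
  qed
qed

text \<open>The co-Leibniz rule at the cut after the first letter is exactly the recursion of
  \<open>coder_at\<close>.\<close>

lemma coderivation_eq_coder_map:
  assumes D: "coderivation (Sc s G UNIV) D" "\<And>t. t \<in> Sc s G UNIV \<Longrightarrow> corestrict s G (D t) = \<theta> t"
    and t: "t \<in> Sc s G UNIV"
  shows "D t = coder_map s G \<theta> t"
proof -
  have D_in: "D t \<in> Sc s G UNIV" if "t \<in> Sc s G UNIV" for t using D(1) that by (auto simp: coderivation_def)
  have linD: "lin_on fscale fscale (Sc s G UNIV) D" using D(1) by (simp add: coderivation_def)
  have app: "D t (x @ y) = sum_list (map (\<lambda>(p, q). D p x * q y + koszul (wdeg x) * p x * D q y) xs)"
    if "t \<in> Sc s G UNIV" "set xs \<subseteq> Sc s G UNIV \<times> Sc s G UNIV" "diag t = tsum xs" for t xs x y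
  proof -
    have "D t (x @ y) = diag (D t) (x, y)" by (simp add: diag_def)
    also have "diag (D t) = sum_list (map (\<lambda>(p, q). tprod (D p) q + tprod (parity p) (D q)) xs)"
      using D(1) that(1) C.tlift_diag[OF bilin_on_coderivation[OF linD] vector_space_fscale that(2,3)]
      by (simp add: coderivation_def)
    finally show ?thesis unfolding sum_list_fun_apply by (simp add: tprod_def parity_def case_prod_unfold)
  qed
  have "D t w = coder_at s G \<theta> w t" if "t \<in> Sc s G UNIV" for w t
    using that
  proof (induction w arbitrary: t)
    case Nil
    obtain xs where xs: "set xs \<subseteq> Sc s G UNIV \<times> Sc s G UNIV" "diag t = tsum xs" using Nil by (rule C.diag_tsum)
    have lin_ev: "lin_on fscale (*) (Sc s G UNIV) (\<lambda>t. D t [])"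
      using linD by (auto simp: lin_on_def fscale_def)
    have "D t [] = sum_list (map (\<lambda>(p, q). D p [] * q [] + p [] * D q []) xs)"
      using app[OF Nil xs, of "[]" "[]"] by (simp add: koszul_def)
    also have "\<dots> = sum_list (map (\<lambda>(p, q). q [] * D p []) xs) + sum_list (map (\<lambda>(p, q). p [] * D q []) xs)"
      by (simp add: case_prod_unfold sum_list_map_add mult.commute)
    also have "sum_list (map (\<lambda>(p, q). q [] * D p []) xs) = D (\<lambda>z. t (z @ [])) []"
      by (rule C.lin_column[OF lin_ev vector_space_field xs, symmetric])
    also have "sum_list (map (\<lambda>(p, q). p [] * D q []) xs) = D (\<lambda>z. t ([] @ z)) []"
      by (rule C.lin_row[OF lin_ev vector_space_field xs, symmetric])
    \<comment> \<open>At the empty word both terms of the co-Leibniz rule give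
      \<open>D t []\<close>, with sign \<open>1\<close>; hence this value is zero.\<close>
    finally have "D t [] = D t [] + D t []" by simp
    then show ?case unfolding add_cancel_right_right by simp
  next
    case (Cons a w)
    obtain xs where xs: "set xs \<subseteq> Sc s G UNIV \<times> Sc s G UNIV" "diag t = tsum xs" using Cons(2) by (rule C.diag_tsum)
    have "D t (a # w) = sum_list (map (\<lambda>(p, q). D p [a] * q w + koszul (fst a) * p [a] * D q w) xs)"
      using app[OF Cons(2) xs, of "[a]" w] by simp
    also have "\<dots> = sum_list (map (\<lambda>(p, q). (if snd a \<in> hdual s G (fst a) then snd a (\<theta> p) else 0) * q w +
        koszul (fst a) * p [a] * coder_at s G \<theta> w q) xs)"
    proof (intro arg_cong[where f = sum_list] map_cong refl, clarify)
      fix p q assume "(p, q) \<in> set xs"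
      then have pq: "p \<in> Sc s G UNIV" "q \<in> Sc s G UNIV" using xs by auto
      have "D p [a] = (if snd a \<in> hdual s G (fst a) then snd a (\<theta> p) else 0)"
        using corestrict_apply[OF D_in[OF pq(1)], of "snd a" "fst a"] D(2)[OF pq(1)] Sc_hword[OF D_in[OF pq(1)], of "[a]"]
        by simp
      then show "D p [a] * q w + koszul (fst a) * p [a] * D q w =
        (if snd a \<in> hdual s G (fst a) then snd a (\<theta> p) else 0) * q w + koszul (fst a) * p [a] * coder_at s G \<theta> w q"
        using Cons(1)[OF pq(2)] by simp
    qed
    also have "\<dots> = coder_at s G \<theta> (a # w) t" by (rule coder_at_tsum[OF xs, symmetric])
    finally show ?case .
  qed
  then show ?thesis using t by (auto simp: coder_map_def)
qed

lemma coder_map_in: "t \<in> Sc s G UNIV \<Longrightarrow> coder_map s G \<theta> t \<in> Sc s G UNIV"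
  by (simp add: Sc_iff[of "coder_map s G \<theta> t"] coder_map_tens_span graded_symmetric_coder_map)

text \<open>As for morphisms, the explicit formula is a witness for the choice, and uniqueness
  transfers it to the chosen coderivation.\<close>

lemma coder_lift_eq:
  assumes t: "t \<in> Sc s G UNIV"
  shows "coder_lift s G \<theta> t = coder_map s G \<theta> t"
proof -
  let ?P = "\<lambda>D. coderivation (Sc s G UNIV) D \<and> (\<forall>t\<in>Sc s G UNIV. corestrict s G (D t) = \<theta> t)"
  have "coderivation (Sc s G UNIV) (coder_map s G \<theta>)"
    unfolding coderivation_def
    by (intro conjI allI ballI impI image_subsetI lin_on_coder_map coder_map_in homogeneous_coder_map diag_coder_map)
  moreover have "corestrict s G (coder_map s G \<theta> t) = \<theta> t" for t
    by (rule corestrict_eqI) (simp add: coder_map_def)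
  ultimately have "?P (coder_map s G \<theta>)" by simp
  then have "?P (coder_lift s G \<theta>)" unfolding coder_lift_def by (rule someI[where P = ?P])
  then show ?thesis by (intro coderivation_eq_coder_map[OF _ _ t]) simp_all
qed

end

section \<open>Polarization\<close>

text \<open>With \<open>S = R \<union> X\<close> the sum is the expansion of a product of factors
  \<open>1 + (- 1)\<close> over \<open>A - R\<close>.\<close>

lemma sum_signs_between:
  assumes "finite A" "R \<subseteq> A"
  shows "(\<Sum>S\<in>{S\<in>Pow A. R \<subseteq> S}. (- 1) ^ card (A - S)) = (if R = A then 1 else 0 :: 'f::comm_ring_1)"
proof -
  define B where "B = A - R"
  have fB: "finite B" using assms by (simp add: B_def)
  have "(\<Sum>S\<in>{S\<in>Pow A. R \<subseteq> S}. (- 1) ^ card (A - S)) = (\<Sum>X\<in>Pow B. (- 1 :: 'f) ^ card (B - X))"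
  proof (rule sum.reindex_bij_witness[of _ "\<lambda>X. R \<union> X" "\<lambda>S. S - R"])
    show "(- 1 :: 'f) ^ card (B - (S - R)) = (- 1) ^ card (A - S)" if "S \<in> {S\<in>Pow A. R \<subseteq> S}" for S
    proof -
      have "B - (S - R) = A - S" using that by (auto simp: B_def)
      then show ?thesis by simp
    qed
  qed (use assms(2) in \<open>auto simp: B_def\<close>)
  also have "\<dots> = (\<Prod>x\<in>B. 1 + (- 1))"
    by (subst prod_add[OF fB]) simp
  also have "\<dots> = (if R = A then 1 else 0)"
  proof (cases "B = {}")
    case False
    then have "R \<noteq> A" "card B \<noteq> 0" using fB by (auto simp: B_def)
    then show ?thesis by (simp add: power_0_left)
  qed (use assms in \<open>auto simp: B_def\<close>)
  finally show ?thesis .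
qed

text \<open>Ryser's formula for the permanent. Each product expands over maps from \<open>A\<close>
  to \<open>S\<close>; a map is counted for every \<open>S\<close> containing its image, and the
  signs cancel unless the image is all of \<open>A\<close>, that is, unless the map is a
  permutation.\<close>

lemma ryser_permanent:
  fixes a :: "'i \<Rightarrow> 'i \<Rightarrow> 'f::comm_ring_1"
  assumes A: "finite A"
  shows "(\<Sum>S\<in>Pow A. (- 1) ^ card (A - S) * (\<Prod>k\<in>A. \<Sum>i\<in>S. a i k)) = (\<Sum>\<sigma> | \<sigma> permutes A. \<Prod>k\<in>A. a (\<sigma> k) k)"
proof -
  let ?P = "\<lambda>g. \<Prod>k\<in>A. a (g k) k"
  have fin: "finite (A \<rightarrow>\<^sub>E A)" using A by (rule finite_PiE) (use A in auto)
  have "(\<Sum>S\<in>Pow A. (- 1) ^ card (A - S) * (\<Prod>k\<in>A. \<Sum>i\<in>S. a i k)) =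
      (\<Sum>S\<in>Pow A. \<Sum>g\<in>A \<rightarrow>\<^sub>E A. if g ` A \<subseteq> S then (- 1) ^ card (A - S) * ?P g else 0)"
  proof (rule sum.cong[OF refl])
    fix S assume S: "S \<in> Pow A"
    have "(\<Prod>k\<in>A. \<Sum>i\<in>S. a i k) = (\<Sum>g\<in>A \<rightarrow>\<^sub>E S. ?P g)"
      using A S by (intro prod_sum_PiE) (auto intro: finite_subset)
    also have "A \<rightarrow>\<^sub>E S = {g \<in> A \<rightarrow>\<^sub>E A. g ` A \<subseteq> S}" using S by (auto simp: PiE_iff image_subset_iff extensional_def)
    also have "(\<Sum>g\<in>\<dots>. ?P g) = (\<Sum>g\<in>A \<rightarrow>\<^sub>E A. if g ` A \<subseteq> S then ?P g else 0)"
      using fin by (simp add: sum.inter_filter)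
    finally show "(- 1) ^ card (A - S) * (\<Prod>k\<in>A. \<Sum>i\<in>S. a i k) =
      (\<Sum>g\<in>A \<rightarrow>\<^sub>E A. if g ` A \<subseteq> S then (- 1) ^ card (A - S) * ?P g else 0)"
      by (simp add: sum_distrib_left if_distrib cong: if_cong)
  qed
  also have "\<dots> = (\<Sum>g\<in>A \<rightarrow>\<^sub>E A. \<Sum>S\<in>Pow A. if g ` A \<subseteq> S then (- 1) ^ card (A - S) * ?P g else 0)"
    by (rule sum.swap)
  also have "\<dots> = (\<Sum>g\<in>A \<rightarrow>\<^sub>E A. if g ` A = A then ?P g else 0)"
  proof (rule sum.cong[OF refl])
    fix g assume g: "g \<in> A \<rightarrow>\<^sub>E A"
    have "(\<Sum>S\<in>Pow A. if g ` A \<subseteq> S then (- 1) ^ card (A - S) * ?P g else 0) =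
       (\<Sum>S\<in>{S\<in>Pow A. g ` A \<subseteq> S}. (- 1) ^ card (A - S)) * ?P g"
      using A by (simp add: sum.inter_filter[symmetric] sum_distrib_right)
    also have "\<dots> = (if g ` A = A then ?P g else 0)"
      using g by (subst sum_signs_between[OF A]) auto
    finally show "(\<Sum>S\<in>Pow A. if g ` A \<subseteq> S then (- 1) ^ card (A - S) * ?P g else 0) =
      (if g ` A = A then ?P g else 0)" .
  qed
  also have "\<dots> = (\<Sum>g\<in>{g \<in> A \<rightarrow>\<^sub>E A. g ` A = A}. ?P g)"
    using fin by (simp add: sum.inter_filter)
  also have "\<dots> = (\<Sum>\<sigma> | \<sigma> permutes A. ?P \<sigma>)"
  proof (rule sum.reindex_bij_witness[of _ "\<lambda>\<sigma>. restrict \<sigma> A" "\<lambda>g x. if x \<in> A then g x else x"])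
    fix g assume g: "g \<in> {g \<in> A \<rightarrow>\<^sub>E A. g ` A = A}"
    show "restrict (\<lambda>x. if x \<in> A then g x else x) A = g" using g by (auto simp: fun_eq_iff PiE_iff extensional_def)
    have "inj_on g A" using g A by (auto intro: eq_card_imp_inj_on)
    then have "bij_betw g A A" using g by (auto simp: bij_betw_def)
    then have "bij_betw (\<lambda>x. if x \<in> A then g x else x) A A" by (subst bij_betw_cong[of _ _ g]) auto
    then have "(\<lambda>x. if x \<in> A then g x else x) permutes A" by (rule bij_imp_permutes) auto
    then show "(\<lambda>x. if x \<in> A then g x else x) \<in> {\<sigma>. \<sigma> permutes A}" by simp
    show "?P (\<lambda>x. if x \<in> A then g x else x) = ?P g" by simp
  next
    fix \<sigma> assume "\<sigma> \<in> {\<sigma>. \<sigma> permutes A}"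
    then have s: "\<sigma> permutes A" by simp
    then show "(\<lambda>x. if x \<in> A then restrict \<sigma> A x else x) = \<sigma>" by (auto simp: fun_eq_iff permutes_def)
    show "restrict \<sigma> A \<in> {g \<in> A \<rightarrow>\<^sub>E A. g ` A = A}"
      using permutes_image[OF s] permutes_in_image[OF s] by auto
  qed
  finally show ?thesis .
qed

lemma pure_tensor_prod_nth:
  assumes "hword s G w" "length us = length w"
  shows "pure_tensor s G us w = (\<Prod>k<length w. snd (w ! k) (us ! k))"
proof -
  have "prod_list (map2 (\<lambda>u (n, \<phi>). \<phi> u) us w) = (\<Prod>k<length w. snd (w ! k) (us ! k))"
    using assms(2) by (simp add: prod.list_conv_set_nth atLeast0LessThan case_prod_unfold)
  then show ?thesis using assms by (simp add: pure_tensor_def)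
qed

locale grsp0 = grsp s G for s :: "'f::field_char_0 \<Rightarrow> 'a::ab_group_add \<Rightarrow> 'a" and G
begin

abbreviation tpower :: "nat \<Rightarrow> 'a \<Rightarrow> ('f, 'a) tens" where
  "tpower j v \<equiv> pure_tensor s G (replicate j v)"

text \<open>On homogeneous words both sides are the permanent of the matrix of values of the letters
  of \<open>w\<close> on the vectors \<open>us\<close>: permuting letters runs through its terms,
  and Ryser's formula writes it through powers of partial sums of \<open>us\<close>.\<close>

lemma symmetrized_pure_tensor:
  assumes "length us = length w"
  shows "(\<Sum>\<sigma> | \<sigma> permutes {..<length w}. pure_tensor s G us (permute_list (inv \<sigma>) w)) =
    (\<Sum>S\<in>Pow {..<length w}. (- 1) ^ card ({..<length w} - S) * tpower (length w) (\<Sum>i\<in>S. us ! i) w)"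
proof (cases "hword s G w")
  case True
  let ?A = "{..<length w}"
  have hd: "snd (w ! k) \<in> hdual s G (fst (w ! k))" if "k < length w" for k
    using True that by (fastforce simp: hword_def)
  have "(\<Sum>S\<in>Pow ?A. (- 1) ^ card (?A - S) * tpower (length w) (\<Sum>i\<in>S. us ! i) w) =
      (\<Sum>S\<in>Pow ?A. (- 1) ^ card (?A - S) * (\<Prod>k\<in>?A. \<Sum>i\<in>S. snd (w ! k) (us ! i)))"
    using True hdual_simps(6)[OF hd]
    by (intro sum.cong refl arg_cong[where f = "(*) _"]) (auto simp: pure_tensor_prod_nth intro!: prod.cong)
  also have "\<dots> = (\<Sum>\<sigma> | \<sigma> permutes ?A. \<Prod>k\<in>?A. snd (w ! k) (us ! \<sigma> k))"
    by (rule ryser_permanent) simp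
  also have "\<dots> = (\<Sum>\<sigma> | \<sigma> permutes ?A. pure_tensor s G us (permute_list (inv \<sigma>) w))"
  proof (rule sum.cong[OF refl])
    fix \<sigma> assume "\<sigma> \<in> {\<sigma>. \<sigma> permutes ?A}"
    then have \<sigma>: "\<sigma> permutes ?A" by simp
    then have inv: "inv \<sigma> permutes ?A" by (rule permutes_inv)
    have "hword s G (permute_list (inv \<sigma>) w)" using True inv by (simp add: hword_def)
    then have "pure_tensor s G us (permute_list (inv \<sigma>) w) = (\<Prod>k\<in>?A. snd (w ! inv \<sigma> k) (us ! k))"
      using assms inv by (simp add: pure_tensor_prod_nth permute_list_nth)
    also have "\<dots> = (\<Prod>k\<in>?A. snd (w ! inv \<sigma> (\<sigma> k)) (us ! \<sigma> k))"
      using prod.permute[OF \<sigma>, of "\<lambda>k. snd (w ! inv \<sigma> k) (us ! k)"] by (simp add: o_def)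
    also have "\<dots> = (\<Prod>k\<in>?A. snd (w ! k) (us ! \<sigma> k))"
      using permutes_inverses(2)[OF \<sigma>] by simp
    finally show "(\<Prod>k\<in>?A. snd (w ! k) (us ! \<sigma> k)) = pure_tensor s G us (permute_list (inv \<sigma>) w)" ..
  qed
  finally show ?thesis ..
next
  case False
  have "\<not> hword s G (permute_list (inv \<sigma>) w)" if "\<sigma> permutes {..<length w}" for \<sigma>
    using False permutes_inv[OF that] by (simp add: hword_def)
  then show ?thesis using False by (simp add: pure_tensor_def)
qed

text \<open>A symmetric tensor in degree zero is its own average over permutations, and the average
  of a pure tensor is a combination of powers by \<open>symmetrized_pure_tensor\<close>.
  Characteristic zero permits the division by the factorial.\<close>

lemma Sc_0_span_powers:
  assumes "t \<in> Sc s G (G 0)"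
  shows "t \<in> fs.span {tpower j v | j v. v \<in> G 0}"
proof -
  let ?W = "fs.span {tpower j v | j v. v \<in> G 0}"
  have W: "fs.subspace ?W" by (rule fs.subspace_span)
  define sym :: "('f, 'a) tens \<Rightarrow> ('f, 'a) tens" where
    "sym t = (\<lambda>w. (1 / fact (length w)) * (\<Sum>\<sigma> | \<sigma> permutes {..<length w}. t (permute_list (inv \<sigma>) w)))" for t
  have "sym t = t"
  proof
    fix w
    have "t (permute_list (inv \<sigma>) w) = t w" if "\<sigma> permutes {..<length w}" for \<sigma>
      using permutes_inv[OF that] by (intro Sc_0_perm[OF assms]) simp
    then have "(\<Sum>\<sigma> | \<sigma> permutes {..<length w}. t (permute_list (inv \<sigma>) w)) = fact (length w) * t w"
      using card_permutations[of "{..<length w}" "length w"] by simp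
    then show "sym t w = t w" by (simp add: sym_def)
  qed
  moreover have "sym t \<in> ?W"
  proof (rule tens_span_linear_image[of t "G 0" ?W sym])
    show "t \<in> tens_span s G (G 0)" using assms by (simp add: Sc_iff)
    show "sym 0 = 0" by (simp add: sym_def fun_eq_iff)
    show "sym (fscale c x + y) = fscale c (sym x) + sym y" for c x y
      by (simp add: sym_def fun_eq_iff fscale_def sum.distrib algebra_simps sum_distrib_left)
    fix us assume us: "set us \<subseteq> G 0"
    let ?j = "length us"
    have "sym (pure_tensor s G us) = (\<Sum>S\<in>Pow {..<?j}.
        fscale ((1 / fact ?j) * (- 1) ^ card ({..<?j} - S)) (tpower ?j (\<Sum>i\<in>S. us ! i)))"
    proof
      fix w
      show "sym (pure_tensor s G us) w = (\<Sum>S\<in>Pow {..<?j}.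
        fscale ((1 / fact ?j) * (- 1) ^ card ({..<?j} - S)) (tpower ?j (\<Sum>i\<in>S. us ! i))) w"
      proof (cases "length w = ?j")
        case True
        show ?thesis
          unfolding sum_fun_apply sym_def symmetrized_pure_tensor[OF True[symmetric]]
          unfolding sum_distrib_left by (simp add: True fscale_def mult.assoc)
      next
        case False
        then show ?thesis unfolding sum_fun_apply by (simp add: sym_def pure_tensor_def fscale_def)
      qed
    qed
    also have "\<dots> \<in> ?W"
    proof (intro fs.subspace_sum[OF W] fs.subspace_scale[OF W] fs.span_base)
      fix S assume "S \<in> Pow {..<?j}"
      then have "(\<Sum>i\<in>S. us ! i) \<in> G 0" using us by (intro subspace_sum[OF subspace_G]) (auto simp: subset_iff)
      then show "tpower ?j (\<Sum>i\<in>S. us ! i) \<in> {tpower j v | j v. v \<in> G 0}" by blast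
    qed
    finally show "sym (pure_tensor s G us) \<in> ?W" .
  qed (rule W)
  ultimately show ?thesis by simp
qed

lemma tpower_in_Sc:
  assumes v: "v \<in> U" shows "U \<subseteq> G 0 \<Longrightarrow> tpower j v \<in> Sc s G U"
  unfolding Sc_iff
proof (intro conjI graded_symmetricI)
  show "tpower j v \<in> tens_span s G U" by (rule pure_in_tens_span) (use v in auto)
  assume U: "U \<subseteq> G 0"
  fix w w' m n \<phi> \<psi>
  show "tpower j v (w @ (m, \<phi>) # (n, \<psi>) # w') = koszul (m * n) * tpower j v (w @ (n, \<psi>) # (m, \<phi>) # w')"
  proof (cases "hword s G (w @ (m, \<phi>) # (n, \<psi>) # w') \<and> j = length (w @ (m, \<phi>) # (n, \<psi>) # w')")
    case True
    \<comment> \<open>The sign can be \<open>-1\<close> only if both letters have nonzero degree,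
      and such letters vanish on \<open>v\<close>, which has degree zero.\<close>
    have eq: "koszul (m * n) = (1 :: 'f) \<or> \<phi> v * \<psi> v = 0"
      using hdual_zero[of \<phi> m v 0] hdual_zero[of \<psi> n v 0] True U v by (cases "m = 0"; cases "n = 0") (auto simp: koszul_def)
    have "tpower (length u) v u = prod_list (map (\<lambda>a. snd a v) u)" if "hword s G u" for u
      using that by (induction u) (auto simp: pure_tensor_Nil pure_tensor_Cons)
    from this[of "w @ (m, \<phi>) # (n, \<psi>) # w'"] this[of "w @ (n, \<psi>) # (m, \<phi>) # w'"]
    have "tpower j v (w @ (m, \<phi>) # (n, \<psi>) # w') = prod_list (map (\<lambda>a. snd a v) w) * (\<phi> v * \<psi> v) * prod_list (map (\<lambda>a. snd a v) w')"
      "tpower j v (w @ (n, \<psi>) # (m, \<phi>) # w') = prod_list (map (\<lambda>a. snd a v) w) * (\<phi> v * \<psi> v) * prod_list (map (\<lambda>a. snd a v) w')"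
      using True by (auto simp: algebra_simps)
    with eq show ?thesis by auto
  next
    case False
    then show ?thesis by (auto simp: pure_tensor_def)
  qed
qed

lemma lin_on_eq_powers:
  assumes "lin_on fscale sW (Sc s G (G 0)) f" "lin_on fscale sW (Sc s G (G 0)) g" "vector_space sW"
    and "\<And>j v. v \<in> G 0 \<Longrightarrow> f (tpower j v) = g (tpower j v)" and "t \<in> Sc s G (G 0)"
  shows "f t = g t"
  by (rule lin_on_span_eq[OF assms(1,2) subspace_Sc fs.vector_space_axioms assms(3) _ _ Sc_0_span_powers[OF assms(5)]])
    (use assms(4) tpower_in_Sc in auto)

end

section \<open>Polynomials as linear forms\<close>

text \<open>Finitely supported coefficient families are polynomials, and over an infinite field a
  polynomial is determined by its values.\<close>

lemma power_series_unique:
  fixes c c' :: "nat \<Rightarrow> 'f::field_char_0"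
  assumes "finite {j. c j \<noteq> 0}" "finite {j. c' j \<noteq> 0}"
    and "\<And>\<mu>. Sum_any (\<lambda>j. \<mu> ^ j * c j) = Sum_any (\<lambda>j. \<mu> ^ j * c' j)"
  shows "c j = c' j"
proof -
  let ?S = "{j. c j \<noteq> 0} \<union> {j. c' j \<noteq> 0}"
  define P where "P c = (\<Sum>j\<in>?S. monom (c j) j)" for c :: "nat \<Rightarrow> 'f"
  have fin: "finite ?S" using assms(1,2) by simp
  have poly: "poly (P c'') \<mu> = Sum_any (\<lambda>j. \<mu> ^ j * c'' j)" if "{j. c'' j \<noteq> 0} \<subseteq> ?S" for c'' \<mu>
    unfolding P_def using that fin
    by (subst Sum_any.expand_superset[OF fin]) (auto simp: poly_sum poly_monom mult.commute)
  have "poly (P c) = poly (P c')" using assms(3) by (auto simp: fun_eq_iff poly)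
  then have "P c = P c'" by (simp add: poly_eq_poly_eq_iff)
  moreover have "coeff (P c'') j = c'' j" if "{j. c'' j \<noteq> 0} \<subseteq> ?S" for c''
    using fin that by (auto simp: P_def coeff_sum)
  ultimately show ?thesis by (metis Un_upper1 Un_upper2)
qed

definition monomial :: "'a set \<Rightarrow> ('a \<Rightarrow> 'f::field) list \<Rightarrow> 'a \<Rightarrow> 'f" where
  "monomial U \<phi>s = on_set U (\<lambda>v. prod_list (map (\<lambda>\<phi>. \<phi> v) \<phi>s))"

lemma hpoly_eq: "hpoly s U j = fs.span {monomial U \<phi>s | \<phi>s. length \<phi>s = j \<and> (\<forall>\<phi>\<in>set \<phi>s. Vector_Spaces.linear s (*) \<phi>)}"
  by (simp add: hpoly_def monomial_def)

lemma monomial_in_hpoly: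
  "\<forall>\<phi>\<in>set \<phi>s. Vector_Spaces.linear s (*) \<phi> \<Longrightarrow> monomial U \<phi>s \<in> hpoly s U (length \<phi>s)"
  unfolding hpoly_eq by (rule fs.span_base) blast

lemma hpoly_subspace: "fs.subspace (hpoly s U j)"
  by (simp add: hpoly_def fs.subspace_span)

lemma monomial_in_polys:
  "\<forall>\<phi>\<in>set \<phi>s. Vector_Spaces.linear s (*) \<phi> \<Longrightarrow> monomial U \<phi>s \<in> polys s U"
  unfolding polys_def by (rule fs.span_base) (use monomial_in_hpoly in blast)

lemma polys_subspace: "fs.subspace (polys s U)"
  by (simp add: polys_def fs.subspace_span)

lemma polys_induct [consumes 1, case_names monomial zero add]:
  assumes "r \<in> polys s U"
    and "\<And>\<phi>s. \<forall>\<phi>\<in>set \<phi>s. Vector_Spaces.linear s (*) \<phi> \<Longrightarrow> P (monomial U \<phi>s)" "P 0"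
    "\<And>c x y. x \<in> polys s U \<Longrightarrow> y \<in> polys s U \<Longrightarrow> P x \<Longrightarrow> P y \<Longrightarrow> P (fscale c x + y)"
  shows "P r"
proof -
  have P: "fs.subspace {r \<in> polys s U. P r}"
  proof (rule fs.subspaceI)
    show z: "0 \<in> {r \<in> polys s U. P r}" using assms(3) fs.subspace_0[OF polys_subspace[of s U]] by simp
    fix x y assume "x \<in> {r \<in> polys s U. P r}" "y \<in> {r \<in> polys s U. P r}"
    then show "x + y \<in> {r \<in> polys s U. P r}"
      using assms(4)[of x y 1] fs.subspace_add[OF polys_subspace[of s U]] by simp
  next
    fix c x assume "x \<in> {r \<in> polys s U. P r}"
    then show "fscale c x \<in> {r \<in> polys s U. P r}"
      using assms(4)[of x 0 c] assms(3) fs.subspace_0[OF polys_subspace[of s U]] fs.subspace_scale[OF polys_subspace[of s U]] by simp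
  qed
  have "hpoly s U j \<subseteq> {r \<in> polys s U. P r}" for j
    unfolding hpoly_eq by (rule fs.span_minimal[OF _ P]) (use assms(2) monomial_in_polys in auto)
  then have "polys s U \<subseteq> {r \<in> polys s U. P r}"
    unfolding polys_def[of s U] by (intro fs.span_minimal[OF _ P[unfolded polys_def]]) (auto simp: polys_def)
  then show ?thesis using assms(1) by auto
qed

lemma monomial_mult_hpoly:
  assumes "\<forall>\<phi>\<in>set \<phi>s. Vector_Spaces.linear s (*) \<phi>" "c \<in> hpoly s U j"
  shows "(\<lambda>v. monomial U \<phi>s v * c v) \<in> hpoly s U (length \<phi>s + j)"
  using assms(2) unfolding hpoly_eq[of s U j]
proof (induction rule: fs.span_induct_alt)
  case base
  have "(\<lambda>v. monomial U \<phi>s v * 0 v) = 0" by (simp add: fun_eq_iff)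
  then show ?case by (simp only: fs.subspace_0[OF hpoly_subspace])
next
  case (step c x y)
  then obtain \<psi>s where x: "x = monomial U \<psi>s" "length \<psi>s = j" "\<forall>\<phi>\<in>set \<psi>s. Vector_Spaces.linear s (*) \<phi>" by blast
  have "(\<lambda>v. monomial U \<phi>s v * (fscale c x + y) v) =
      fscale c (monomial U (\<phi>s @ \<psi>s)) + (\<lambda>v. monomial U \<phi>s v * y v)"
    by (auto simp: x monomial_def on_set_def fscale_def fun_eq_iff algebra_simps)
  moreover have "monomial U (\<phi>s @ \<psi>s) \<in> hpoly s U (length \<phi>s + j)"
    using monomial_in_hpoly[of "\<phi>s @ \<psi>s" s U] assms(1) x by auto
  ultimately show ?case
    by (simp add: fs.subspace_add[OF hpoly_subspace] fs.subspace_scale[OF hpoly_subspace] step)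
qed

section \<open>Homogeneous parts of polynomials and their linear forms\<close>

context grsp0
begin

lemma hpoly_homogeneous:
  assumes "c \<in> hpoly s U j" "v \<in> U" "subspace U"
  shows "c (s \<mu> v) = \<mu> ^ j * c v"
  using assms(1) unfolding hpoly_eq
proof (induction rule: fs.span_induct_alt)
  case (step d x y)
  then obtain \<phi>s where x: "x = monomial U \<phi>s" "length \<phi>s = j" "\<forall>\<phi>\<in>set \<phi>s. Vector_Spaces.linear s (*) \<phi>" by blast
  have sv: "s \<mu> v \<in> U" using assms(2,3) by (simp add: subspace_scale)
  have "prod_list (map (\<lambda>\<phi>. \<phi> (s \<mu> v)) \<phi>s) = \<mu> ^ length \<phi>s * prod_list (map (\<lambda>\<phi>. \<phi> v) \<phi>s)"
    using x(3)
  proof (induction \<phi>s)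
    case (Cons \<phi> \<phi>s)
    then interpret \<phi>: Vector_Spaces.linear s "(*)" \<phi> by simp
    show ?case using Cons by (simp add: \<phi>.scale)
  qed simp
  then have "x (s \<mu> v) = \<mu> ^ j * x v" using x sv assms(2) by (simp add: monomial_def on_set_def)
  then show ?case using step by (simp add: fscale_def algebra_simps)
qed simp

lemma Sum_any_fun_apply: "finite {j. c j \<noteq> 0} \<Longrightarrow> Sum_any c v = Sum_any (\<lambda>j. c j v)" for c :: "nat \<Rightarrow> 'x \<Rightarrow> 'f"
proof -
  assume fin: "finite {j. c j \<noteq> 0}"
  have "Sum_any (\<lambda>j. c j v) = (\<Sum>j | c j \<noteq> 0. c j v)"
    using fin by (intro Sum_any.expand_superset) auto
  then show ?thesis by (simp add: Sum_any.expand_set sum_fun_apply)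
qed

text \<open>Along the line through \<open>v\<close> the \<open>j\<close>-th part is
  \<open>\<mu> ^ j\<close> times a constant, so its value at \<open>v\<close> is a coefficient of a
  polynomial in \<open>\<mu>\<close>.\<close>

lemma homogeneous_parts_unique:
  fixes c c' :: "nat \<Rightarrow> 'a \<Rightarrow> 'f"
  assumes "finite {j. c j \<noteq> 0}" "finite {j. c' j \<noteq> 0}" "\<And>x. x \<in> U \<Longrightarrow> Sum_any c x = Sum_any c' x" "subspace U"
    and "\<And>j \<mu> v. v \<in> U \<Longrightarrow> c j (s \<mu> v) = \<mu> ^ j * c j v" "\<And>j \<mu> v. v \<in> U \<Longrightarrow> c' j (s \<mu> v) = \<mu> ^ j * c' j v"
    and v: "v \<in> U"
  shows "c j v = c' j v"
proof (rule power_series_unique[where c = "\<lambda>j. c j v" and c' = "\<lambda>j. c' j v"])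
  show "finite {j. c j v \<noteq> 0}" by (rule finite_subset[OF _ assms(1)]) auto
  show "finite {j. c' j v \<noteq> 0}" by (rule finite_subset[OF _ assms(2)]) auto
  fix \<mu>
  have "s \<mu> v \<in> U" using v assms(4) by (simp add: subspace_scale)
  from assms(3)[OF this] show "Sum_any (\<lambda>j. \<mu> ^ j * c j v) = Sum_any (\<lambda>j. \<mu> ^ j * c' j v)"
    by (simp add: Sum_any_fun_apply[OF assms(1)] Sum_any_fun_apply[OF assms(2)] assms(5,6)[OF v])
qed

text \<open>The property from which \<open>poly_form\<close> selects. It fixes the form on
  \<open>Sc s G (G 0)\<close>, since \<open>y\<close> determines its homogeneous parts and the
  powers span.\<close>

definition represents :: "(('f, 'a) tens \<Rightarrow> 'f) \<Rightarrow> ('a \<Rightarrow> 'f) \<Rightarrow> bool" where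
  "represents L y \<longleftrightarrow> lin_on fscale (*) (Sc s G (G 0)) L \<and>
     (\<exists>c. (\<forall>j. c j \<in> hpoly s (G 0) j) \<and> finite {j. c j \<noteq> 0} \<and> y = Sum_any c \<and>
          (\<forall>j. \<forall>v\<in>G 0. L (tpower j v) = c j v))"

lemma represents_unique:
  assumes "represents L y" "represents L' y" "t \<in> Sc s G (G 0)"
  shows "L t = L' t"
proof -
  obtain c where c: "\<forall>j. c j \<in> hpoly s (G 0) j" "finite {j. c j \<noteq> 0}" "y = Sum_any c"
      "\<forall>j. \<forall>v\<in>G 0. L (tpower j v) = c j v"
    using assms(1) unfolding represents_def by blast
  obtain c' where c': "\<forall>j. c' j \<in> hpoly s (G 0) j" "finite {j. c' j \<noteq> 0}" "y = Sum_any c'"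
      "\<forall>j. \<forall>v\<in>G 0. L' (tpower j v) = c' j v"
    using assms(2) unfolding represents_def by blast
  have "c j v = c' j v" if "v \<in> G 0" for j v
    using homogeneous_parts_unique[OF c(2) c'(2) _ subspace_G _ _ that] c c'
      hpoly_homogeneous[OF _ _ subspace_G] by metis
  then show ?thesis
    using assms c(4) c'(4) unfolding represents_def
    by (intro lin_on_eq_powers[of "(*)" L L' t]) (auto simp: vector_space_field)
qed

lemma represents_poly_form:
  assumes "\<exists>L. represents L y" shows "represents (poly_form s G (G 0) y) y"
  using someI_ex[OF assms] unfolding poly_form_def represents_def by simp

lemma poly_form_eq: "represents L y \<Longrightarrow> t \<in> Sc s G (G 0) \<Longrightarrow> poly_form s G (G 0) y t = L t"
  using represents_unique represents_poly_form by blast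

lemma represents_add_scale:
  assumes "represents L x" "represents L' y"
  shows "represents (\<lambda>t. a * L t + L' t) (fscale a x + y)"
proof -
  obtain c where c: "\<forall>j. c j \<in> hpoly s (G 0) j" "finite {j. c j \<noteq> 0}" "x = Sum_any c"
      "\<forall>j. \<forall>v\<in>G 0. L (tpower j v) = c j v"
    using assms(1) unfolding represents_def by blast
  obtain c' where c': "\<forall>j. c' j \<in> hpoly s (G 0) j" "finite {j. c' j \<noteq> 0}" "y = Sum_any c'"
      "\<forall>j. \<forall>v\<in>G 0. L' (tpower j v) = c' j v"
    using assms(2) unfolding represents_def by blast
  let ?d = "\<lambda>j. fscale a (c j) + c' j"
  let ?S = "{j. c j \<noteq> 0} \<union> {j. c' j \<noteq> 0}"
  have fin: "finite ?S" using c c' by simp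
  have sub: "{j. ?d j \<noteq> 0} \<subseteq> ?S" by auto
  have "\<forall>j. ?d j \<in> hpoly s (G 0) j"
    using c(1) c'(1) fs.subspace_add[OF hpoly_subspace] fs.subspace_scale[OF hpoly_subspace] by blast
  moreover have "finite {j. ?d j \<noteq> 0}" using sub fin by (rule finite_subset)
  moreover have "fscale a x + y = Sum_any ?d"
  proof -
    have "Sum_any ?d = (\<Sum>j\<in>?S. ?d j)" by (rule Sum_any.expand_superset[OF fin sub])
    also have "\<dots> = fscale a (\<Sum>j\<in>?S. c j) + (\<Sum>j\<in>?S. c' j)" by (simp only: sum.distrib fs.scale_sum_right)
    also have "(\<Sum>j\<in>?S. c j) = x" unfolding c(3) by (rule Sum_any.expand_superset[OF fin, symmetric]) auto
    also have "(\<Sum>j\<in>?S. c' j) = y" unfolding c'(3) by (rule Sum_any.expand_superset[OF fin, symmetric]) auto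
    finally show ?thesis ..
  qed
  moreover have "\<forall>j. \<forall>v\<in>G 0. a * L (tpower j v) + L' (tpower j v) = ?d j v"
    using c(4) c'(4) by (simp add: fscale_def)
  moreover have "lin_on fscale (*) (Sc s G (G 0)) (\<lambda>t. a * L t + L' t)"
    using assms by (auto simp: represents_def lin_on_def algebra_simps)
  ultimately show ?thesis unfolding represents_def by (intro conjI exI[of _ ?d]) simp_all
qed

text \<open>Composition with the projection to degree zero makes an arbitrary functional a legal
  letter and keeps its values on \<open>G 0\<close>.\<close>

definition letters :: "('a \<Rightarrow> 'f) list \<Rightarrow> ('f, 'a) word" where
  "letters \<phi>s = map (\<lambda>\<phi>. (0, \<lambda>v. \<phi> (hcomp v 0))) \<phi>s"

lemma tpower_letters:
  assumes "\<forall>\<phi>\<in>set \<phi>s. Vector_Spaces.linear s (*) \<phi>" "v \<in> G 0"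
  shows "tpower (length \<phi>s) v (letters \<phi>s) = monomial (G 0) \<phi>s v"
  using assms
proof (induction \<phi>s)
  case Nil
  then show ?case by (simp add: letters_def pure_tensor_Nil monomial_def on_set_def)
next
  case (Cons \<phi> \<phi>s)
  then have "(\<lambda>v. \<phi> (hcomp v 0)) \<in> hdual s G 0" using linear_comp_hcomp_hdual by simp
  then show ?case using Cons by (simp add: letters_def pure_tensor_Cons monomial_def on_set_def hcomp_in)
qed

text \<open>Multiplication of polynomials is dual to the diagonal. The form of a monomial is
  evaluation at the word of its factors, so multiplying by it amounts to replacing \<open>t\<close>
  by one of its rows.\<close>

lemma represents_monomial_mult:
  assumes \<phi>s: "\<forall>\<phi>\<in>set \<phi>s. Vector_Spaces.linear s (*) \<phi>" and L: "represents L y"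
  shows "represents (\<lambda>t. L (\<lambda>z. t (letters \<phi>s @ z))) (\<lambda>v. monomial (G 0) \<phi>s v * y v)"
proof -
  interpret C: coalg "Sc s G (G 0)" by unfold_locales (rule subcoalgebra_Sc)
  let ?k = "length \<phi>s" and ?x = "letters \<phi>s"
  have lx: "length ?x = ?k" by (simp add: letters_def)
  obtain c where c: "\<forall>j. c j \<in> hpoly s (G 0) j" "finite {j. c j \<noteq> 0}" "y = Sum_any c"
      "\<forall>j. \<forall>v\<in>G 0. L (tpower j v) = c j v" and lin: "lin_on fscale (*) (Sc s G (G 0)) L"
    using L unfolding represents_def by blast
  \<comment> \<open>The monomial raises degrees by its number of factors; parts below that degree
    are zero.\<close>
  define d where "d n = (if ?k \<le> n then (\<lambda>v. monomial (G 0) \<phi>s v * c (n - ?k) v) else 0)" for n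
  have "d j \<in> hpoly s (G 0) j" for j
    using monomial_mult_hpoly[OF \<phi>s, of "c (j - ?k)" "G 0" "j - ?k"] c(1) fs.subspace_0[OF hpoly_subspace]
    by (auto simp: d_def)
  moreover have sub: "{j. d j \<noteq> 0} \<subseteq> (\<lambda>j. j + ?k) ` {j. c j \<noteq> 0}"
  proof
    fix j assume "j \<in> {j. d j \<noteq> 0}"
    then have "d j \<noteq> 0" by simp
    then have "?k \<le> j" by (auto simp: d_def split: if_splits)
    moreover have "c (j - ?k) \<noteq> 0"
    proof
      assume "c (j - ?k) = 0"
      then have "d j = 0" by (simp add: d_def fun_eq_iff)
      then show False using \<open>d j \<noteq> 0\<close> by simp
    qed
    ultimately show "j \<in> (\<lambda>j. j + ?k) ` {j. c j \<noteq> 0}" by (intro image_eqI[of _ _ "j - ?k"]) auto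
  qed
  moreover have fin: "finite ((\<lambda>j. j + ?k) ` {j. c j \<noteq> 0})" using c(2) by simp
  moreover have "(\<lambda>v. monomial (G 0) \<phi>s v * y v) = Sum_any d"
  proof
    fix v
    have "Sum_any d v = (\<Sum>j\<in>(\<lambda>j. j + ?k) ` {j. c j \<noteq> 0}. d j v)"
      by (simp only: Sum_any.expand_superset[OF fin sub] sum_fun_apply)
    also have "\<dots> = (\<Sum>j | c j \<noteq> 0. monomial (G 0) \<phi>s v * c j v)"
      by (subst sum.reindex) (auto simp: d_def inj_on_def)
    also have "\<dots> = monomial (G 0) \<phi>s v * y v"
      by (simp add: c(3) Sum_any.expand_set sum_fun_apply sum_distrib_left)
    finally show "monomial (G 0) \<phi>s v * y v = Sum_any d v" ..
  qed
  moreover have "L (\<lambda>z. tpower j v (?x @ z)) = d j v" if v: "v \<in> G 0" for j v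
  proof (cases "?k \<le> j")
    case True
    have "(\<lambda>z. tpower j v (?x @ z)) = fscale (monomial (G 0) \<phi>s v) (tpower (j - ?k) v)"
      using True tpower_letters[OF \<phi>s v] by (auto simp: pure_tensor_append lx fscale_def fun_eq_iff min_def)
    then show ?thesis
      using lin_on_scale[OF lin tpower_in_Sc[OF v]] c(4) v True by (simp add: d_def)
  next
    case False
    then have "(\<lambda>z. tpower j v (?x @ z)) = 0" by (auto simp: pure_tensor_append lx fun_eq_iff)
    then show ?thesis
      using lin_on_zero[OF lin subspace_Sc fs.vector_space_axioms vector_space_field] False by (simp add: d_def)
  qed
  moreover have "lin_on fscale (*) (Sc s G (G 0)) (\<lambda>t. L (\<lambda>z. t (?x @ z)))"
    using lin_on_add[OF lin C.row_in C.row_in] lin_on_scale[OF lin C.row_in]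
    by (auto intro!: lin_onI simp: plus_fun_def fscale_def)
  ultimately show ?thesis
    unfolding represents_def using finite_subset[OF sub fin] by blast
qed

lemma represents_one: "represents (\<lambda>t. t []) (monomial (G 0) [])"
  unfolding represents_def
proof (intro conjI exI[of _ "\<lambda>j. if j = 0 then monomial (G 0) [] else 0"] allI ballI)
  show "(if j = 0 then monomial (G 0) [] else 0) \<in> hpoly s (G 0) j" for j
    using monomial_in_hpoly[of "[]" s "G 0"] fs.subspace_0[OF hpoly_subspace[of s "G 0" j]] by simp
  have sub: "{j::nat. (if j = 0 then monomial (G 0) [] else 0) \<noteq> (0 :: 'a \<Rightarrow> 'f)} \<subseteq> {0}" by auto
  then show "finite {j::nat. (if j = 0 then monomial (G 0) [] else 0) \<noteq> (0 :: 'a \<Rightarrow> 'f)}" by (rule finite_subset) simp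
  show "monomial (G 0) [] = Sum_any (\<lambda>j::nat. if j = 0 then monomial (G 0) [] else (0 :: 'a \<Rightarrow> 'f))"
    by (subst Sum_any.expand_superset[OF _ sub]) auto
  show "tpower j v [] = (if j = 0 then monomial (G 0) [] else 0) v" if "v \<in> G 0" for j v
    using that by (cases j) (auto simp: pure_tensor_Nil pure_tensor_Cons monomial_def on_set_def)
qed (rule lin_on_eval)

lemma represents_zero: "represents (\<lambda>t. 0) 0"
  using represents_add_scale[OF represents_one represents_one, of "- 1"]
  by (simp add: fscale_def fun_eq_iff plus_fun_def zero_fun_def)

lemma polys_represents: "y \<in> polys s (G 0) \<Longrightarrow> \<exists>L. represents L y"
proof (induction rule: polys_induct)
  case (monomial \<phi>s)
  have "(\<lambda>v. monomial (G 0) \<phi>s v * monomial (G 0) [] v) = monomial (G 0) \<phi>s"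
    by (auto simp: monomial_def on_set_def)
  then show ?case using represents_monomial_mult[OF monomial represents_one] by metis
qed (use represents_zero represents_add_scale in blast)+

lemma represents_in_polys: "represents L y \<Longrightarrow> y \<in> polys s (G 0)"
proof -
  assume "represents L y"
  then obtain c where c: "\<forall>j. c j \<in> hpoly s (G 0) j" "y = Sum_any c" unfolding represents_def by blast
  have "hpoly s (G 0) j \<subseteq> polys s (G 0)" for j unfolding polys_def using fs.span_superset by blast
  then show ?thesis unfolding c(2) Sum_any.expand_set using c(1)
    by (intro fs.subspace_sum[OF polys_subspace]) blast
qed

section \<open>Coordinate coalgebras\<close>

text \<open>
  The polynomials all of whose monomial multiples annihilate \<open>t\<close>. This is an ideal, so the coordinate
  coalgebra depends only on the ideal and not on its generators.
\<close>

definition annihilator :: "('f, 'a) tens \<Rightarrow> ('a \<Rightarrow> 'f) set" where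
  "annihilator t = {g \<in> polys s (G 0). \<forall>x. poly_form s G (G 0) g (\<lambda>z. t (x @ z)) = 0}"

text \<open>The value of \<open>(Id \<otimes> y) \<Delta> t\<close> at a word \<open>x\<close> is
  the form of \<open>y\<close> on the row of \<open>t\<close> at \<open>x\<close>.\<close>

lemma coord_coalgebra_iff:
  assumes "Y \<subseteq> polys s (G 0)"
  shows "t \<in> coord_coalgebra s G (G 0) Y \<longleftrightarrow> t \<in> Sc s G (G 0) \<and> Y \<subseteq> annihilator t"
proof (cases "t \<in> Sc s G (G 0)")
  case True
  interpret C: coalg "Sc s G (G 0)" by unfold_locales (rule subcoalgebra_Sc)
  obtain xs where xs: "set xs \<subseteq> Sc s G (G 0) \<times> Sc s G (G 0)" "diag t = tsum xs" using True by (rule C.diag_tsum)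
  have "tlift (Sc s G (G 0)) (Sc s G (G 0)) (\<lambda>p q. fscale (poly_form s G (G 0) y q) p) (diag t) =
      (\<lambda>x. poly_form s G (G 0) y (\<lambda>z. t (x @ z)))" if "y \<in> Y" for y
  proof -
    have "represents (poly_form s G (G 0) y) y" using polys_represents assms that represents_poly_form by blast
    then have lin: "lin_on fscale (*) (Sc s G (G 0)) (poly_form s G (G 0) y)" by (simp add: represents_def)
    have bil: "bilin_on fscale (Sc s G (G 0)) (Sc s G (G 0)) (\<lambda>p q. fscale (poly_form s G (G 0) y q) p)"
      using lin by (auto intro!: bilin_onI lin_onI simp: lin_on_def fscale_def fun_eq_iff algebra_simps)
    show ?thesis
      unfolding C.tlift_diag[OF bil vector_space_fscale xs]
      by (rule ext) (simp add: sum_list_fun_apply C.lin_row[OF lin vector_space_field xs] case_prod_unfold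
          fscale_def mult.commute)
  qed
  then show ?thesis using True assms
    by (auto simp: coord_coalgebra_def annihilator_def fun_eq_iff)
qed (simp add: coord_coalgebra_def)

text \<open>Monomial multiples are built into the quantification over rows: the form of such a
  multiple on the row at \<open>x\<close> is the form of \<open>y\<close> on the row at
  \<open>x @ letters \<phi>s\<close>.\<close>

lemma annihilator_ideal:
  assumes t: "t \<in> Sc s G (G 0)" and Y: "Y \<subseteq> annihilator t"
  shows "poly_ideal s (G 0) Y \<subseteq> annihilator t"
proof -
  interpret C: coalg "Sc s G (G 0)" by unfold_locales (rule subcoalgebra_Sc)
  have rep: "represents (poly_form s G (G 0) g) g" if "g \<in> polys s (G 0)" for g
    using polys_represents[OF that] by (rule represents_poly_form)
  have comb: "fscale a g + g' \<in> annihilator t" if "g \<in> annihilator t" "g' \<in> annihilator t" for a g g'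
  proof -
    have "represents (\<lambda>t. a * poly_form s G (G 0) g t + poly_form s G (G 0) g' t) (fscale a g + g')"
      using that by (intro represents_add_scale rep) (auto simp: annihilator_def)
    from poly_form_eq[OF this C.row_in[OF t]] represents_in_polys[OF this]
    show ?thesis using that by (simp add: annihilator_def)
  qed
  have zero: "0 \<in> annihilator t"
    using poly_form_eq[OF represents_zero C.row_in[OF t]] represents_in_polys[OF represents_zero]
    by (simp add: annihilator_def)
  have sub: "fs.subspace (annihilator t)"
  proof (rule fs.subspaceI[OF zero])
    show "x + y \<in> annihilator t" if "x \<in> annihilator t" "y \<in> annihilator t" for x y
      using comb[OF that, of 1] by simp
    show "fscale c x \<in> annihilator t" if "x \<in> annihilator t" for c x
      using comb[OF that zero, of c] by simp
  qed
  have "(\<lambda>v. r v * y v) \<in> annihilator t" if r: "r \<in> polys s (G 0)" and y: "y \<in> annihilator t" for r y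
    using r
  proof (induction rule: polys_induct)
    case (monomial \<phi>s)
    have "represents (\<lambda>t. poly_form s G (G 0) y (\<lambda>z. t (letters \<phi>s @ z))) (\<lambda>v. monomial (G 0) \<phi>s v * y v)"
      using y by (intro represents_monomial_mult[OF monomial] rep) (auto simp: annihilator_def)
    note rep_m = this
    have "poly_form s G (G 0) (\<lambda>v. monomial (G 0) \<phi>s v * y v) (\<lambda>z. t (x @ z)) =
        poly_form s G (G 0) y (\<lambda>z. t ((x @ letters \<phi>s) @ z))" for x
      using poly_form_eq[OF rep_m C.row_in[OF t]] by simp
    then show ?case using y represents_in_polys[OF rep_m] by (simp add: annihilator_def del: append_assoc)
  next
    case zero
    have "(\<lambda>v. 0 v * y v) = 0" by (simp add: fun_eq_iff)
    then show ?case using \<open>0 \<in> annihilator t\<close> by simp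
  next
    case (add c r r')
    have "(\<lambda>v. (fscale c r + r') v * y v) = fscale c (\<lambda>v. r v * y v) + (\<lambda>v. r' v * y v)"
      by (simp add: fun_eq_iff fscale_def algebra_simps)
    then show ?case using comb[OF add(3,4)] by simp
  qed
  then show ?thesis unfolding poly_ideal_def using Y by (intro fs.span_minimal[OF _ sub]) auto
qed

text \<open>The constant polynomial is \<open>monomial (G 0) []\<close>, extended by zero;
  multiplying by it reproduces exactly the functions that vanish off \<open>G 0\<close>.\<close>

lemma in_poly_ideal: "y \<in> Y \<Longrightarrow> (\<And>v. v \<notin> G 0 \<Longrightarrow> y v = 0) \<Longrightarrow> y \<in> poly_ideal s (G 0) Y"
  unfolding poly_ideal_def
proof (rule fs.span_base, intro CollectI exI conjI)
  assume "\<And>v. v \<notin> G 0 \<Longrightarrow> y v = 0"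
  then show "y = (\<lambda>v. monomial (G 0) [] v * y v)" by (auto simp: fun_eq_iff monomial_def on_set_def)
  show "monomial (G 0) [] \<in> polys s (G 0)" by (rule monomial_in_polys) simp
qed

lemma polys_outside: "y \<in> polys s U \<Longrightarrow> v \<notin> U \<Longrightarrow> y v = 0"
  by (induction rule: polys_induct) (auto simp: monomial_def on_set_def fscale_def)

text \<open>Via the ideal, \<open>Y\<close> is exchanged for the components
  \<open>\<chi> \<circ> f\<close>. Such a component has the parts \<open>\<chi> \<circ> f1\<close>
  and \<open>\<chi> \<circ> f2\<close>, so on powers, hence everywhere, its linear form is
  \<open>\<chi> \<circ> F\<close>; and the functionals \<open>\<chi>\<close> separate
  points.\<close>

lemma coord_coalgebra_zero_locus:
  assumes gen: "generators s (G 0) (zero_locus_ideal s (G 0) f) Y"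
    and f: "\<And>v. v \<in> G 0 \<Longrightarrow> f v = f1 v + f2 v"
    and f1: "\<And>\<mu> v. v \<in> G 0 \<Longrightarrow> f1 (s \<mu> v) = s \<mu> (f1 v)"
    and f2: "\<And>\<mu> v. v \<in> G 0 \<Longrightarrow> f2 (s \<mu> v) = s (\<mu> ^ 2) (f2 v)"
    and F: "lin_on fscale s (Sc s G (G 0)) F"
      "\<And>j v. v \<in> G 0 \<Longrightarrow> F (tpower j v) = (if j = 1 then f1 v else if j = 2 then f2 v else 0)"
  shows "t \<in> coord_coalgebra s G (G 0) Y \<longleftrightarrow> t \<in> Sc s G (G 0) \<and> (\<forall>x. F (\<lambda>z. t (x @ z)) = 0)"
proof (cases "t \<in> Sc s G (G 0)")
  case True
  interpret C: coalg "Sc s G (G 0)" by unfold_locales (rule subcoalgebra_Sc)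
  let ?Z = "{on_set (G 0) (\<lambda>v. \<chi> (f v)) | \<chi>. Vector_Spaces.linear s (*) \<chi>}"
  have Y: "Y \<subseteq> polys s (G 0)" and YZ: "poly_ideal s (G 0) Y = poly_ideal s (G 0) ?Z"
    using gen by (auto simp: generators_def zero_locus_ideal_def)
  have Z_ideal: "?Z \<subseteq> poly_ideal s (G 0) ?Z" by (rule subsetI, rule in_poly_ideal) (auto simp: on_set_def)
  have Y_ideal: "Y \<subseteq> poly_ideal s (G 0) Y" using Y polys_outside by (blast intro: in_poly_ideal)
  have Z: "?Z \<subseteq> polys s (G 0)"
  proof -
    \<comment> \<open>The components of \<open>f\<close> are not known to be polynomials beforehand.
      They lie in the ideal generated by \<open>Y\<close>, and membership in
      \<open>annihilator 0\<close> comprises being a polynomial.\<close>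
    have "Y \<subseteq> annihilator 0"
    proof
      fix y assume "y \<in> Y"
      then have y: "represents (poly_form s G (G 0) y) y" using Y polys_represents represents_poly_form by blast
      then have "poly_form s G (G 0) y 0 = 0"
        using lin_on_zero[OF _ subspace_Sc fs.vector_space_axioms vector_space_field] by (auto simp: represents_def)
      then show "y \<in> annihilator 0" using represents_in_polys[OF y] by (simp add: annihilator_def zero_fun_def)
    qed
    then have "poly_ideal s (G 0) Y \<subseteq> annihilator 0"
      by (rule annihilator_ideal[OF fs.subspace_0[OF subspace_Sc]])
    then show ?thesis using Z_ideal unfolding YZ by (auto simp: annihilator_def)
  qed
  have form: "poly_form s G (G 0) (on_set (G 0) (\<lambda>v. \<chi> (f v))) t = \<chi> (F t)"
    if \<chi>: "Vector_Spaces.linear s (*) \<chi>" and t: "t \<in> Sc s G (G 0)" for \<chi> t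
  proof -
    interpret \<chi>: Vector_Spaces.linear s "(*)" \<chi> by fact
    let ?y = "on_set (G 0) (\<lambda>v. \<chi> (f v))"
    have rep: "represents (poly_form s G (G 0) ?y) ?y"
      using Z \<chi> by (intro represents_poly_form polys_represents) blast
    then obtain c where c: "\<forall>j. c j \<in> hpoly s (G 0) j" "finite {j. c j \<noteq> 0}" "?y = Sum_any c"
      "\<forall>j. \<forall>v\<in>G 0. poly_form s G (G 0) ?y (tpower j v) = c j v" unfolding represents_def by blast
    define c' where "c' j v = (if j = 1 then \<chi> (f1 v) else if j = 2 then \<chi> (f2 v) else 0)" for j :: nat and v
    have sub: "{j. c' j \<noteq> 0} \<subseteq> {1, 2}" by (auto simp: c'_def fun_eq_iff split: if_splits)
    have eq: "c j v = c' j v" if v: "v \<in> G 0" for j v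
    proof (rule homogeneous_parts_unique[OF c(2) finite_subset[OF sub] _ subspace_G _ _ v])
      show "Sum_any c x = Sum_any c' x" if "x \<in> G 0" for x
      proof -
        have "Sum_any c' x = c' 1 x + c' 2 x"
          by (subst Sum_any.expand_superset[OF _ sub]) (simp_all add: sum_fun_apply)
        also have "\<dots> = \<chi> (f x)" by (simp add: c'_def f[OF that] \<chi>.add)
        also have "\<dots> = ?y x" using that by (simp add: on_set_def)
        finally show ?thesis using c(3) by simp
      qed
      show "c j (s \<mu> v) = \<mu> ^ j * c j v" if "v \<in> G 0" for j \<mu> v
        using hpoly_homogeneous[OF _ that subspace_G] c(1) by blast
      show "c' j (s \<mu> v) = \<mu> ^ j * c' j v" if "v \<in> G 0" for j \<mu> v
        by (simp add: c'_def f1[OF that] f2[OF that] \<chi>.scale)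
    qed simp
    show ?thesis
    proof (rule lin_on_eq_powers[OF _ _ vector_space_field _ t])
      show "lin_on fscale (*) (Sc s G (G 0)) (poly_form s G (G 0) ?y)" using rep by (simp add: represents_def)
      show "lin_on fscale (*) (Sc s G (G 0)) (\<lambda>t. \<chi> (F t))" by (rule lin_on_compose[OF F(1) \<chi>])
      show "poly_form s G (G 0) ?y (tpower j v) = \<chi> (F (tpower j v))" if "v \<in> G 0" for j v
        using c(4) that eq[OF that] F(2)[OF that] by (simp add: c'_def \<chi>.zero)
    qed
  qed
  have "Y \<subseteq> annihilator t \<longleftrightarrow> ?Z \<subseteq> annihilator t"
    using annihilator_ideal[OF True, of Y] annihilator_ideal[OF True, of ?Z] Y_ideal Z_ideal unfolding YZ by blast
  also have "\<dots> \<longleftrightarrow> (\<forall>\<chi>. Vector_Spaces.linear s (*) \<chi> \<longrightarrow> (\<forall>x. \<chi> (F (\<lambda>z. t (x @ z))) = 0))"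
    using Z form[OF _ C.row_in[OF True]] by (auto simp: annihilator_def)
  also have "\<dots> \<longleftrightarrow> (\<forall>x. F (\<lambda>z. t (x @ z)) = 0)"
  proof
    assume *: "\<forall>\<chi>. Vector_Spaces.linear s (*) \<chi> \<longrightarrow> (\<forall>x. \<chi> (F (\<lambda>z. t (x @ z))) = 0)"
    show "\<forall>x. F (\<lambda>z. t (x @ z)) = 0"
    proof
      fix x show "F (\<lambda>z. t (x @ z)) = 0"
      proof (rule linear_eqI)
        fix \<psi> assume \<psi>: "Vector_Spaces.linear s (*) \<psi>"
        then interpret \<psi>: Vector_Spaces.linear s "(*)" \<psi> .
        show "\<psi> (F (\<lambda>z. t (x @ z))) = \<psi> 0" using * \<psi> by (simp add: \<psi>.zero)
      qed
    qed
  next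
    assume *: "\<forall>x. F (\<lambda>z. t (x @ z)) = 0"
    show "\<forall>\<chi>. Vector_Spaces.linear s (*) \<chi> \<longrightarrow> (\<forall>x. \<chi> (F (\<lambda>z. t (x @ z))) = 0)"
    proof (intro allI impI)
      fix \<chi> x assume "Vector_Spaces.linear s (*) \<chi>"
      then interpret \<chi>: Vector_Spaces.linear s "(*)" \<chi> .
      show "\<chi> (F (\<lambda>z. t (x @ z))) = 0" using * by (simp add: \<chi>.zero)
    qed
  qed
  finally show ?thesis using coord_coalgebra_iff[OF Y, of t] True by blast
qed (simp add: coord_coalgebra_def)

end

section \<open>Restriction to subcoalgebras\<close>

context coalg
begin

text \<open>
  On an element without components of length at least \<open>N + 1\<close>, the reduced diagonal involves only
  elements without components of length at least \<open>N\<close>.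
\<close>

lemma tlift_reduced:
  fixes \<beta> \<beta>' :: "_ \<Rightarrow> _ \<Rightarrow> 'w::ab_group_add"
  assumes W: "vector_space sW" and \<beta>: "bilin_on sW C C \<beta>" and \<beta>': "bilin_on sW C C \<beta>'"
    and e: "e = (\<lambda>w. if w = [] then 1 else 0)" and one: "e \<in> C"
    and unit: "\<And>p. p \<in> C \<Longrightarrow> \<beta> e p = 0" "\<And>p. p \<in> C \<Longrightarrow> \<beta> p e = 0"
      "\<And>p. p \<in> C \<Longrightarrow> \<beta>' e p = 0" "\<And>p. p \<in> C \<Longrightarrow> \<beta>' p e = 0"
    and eq: "\<And>p q. p \<in> C \<Longrightarrow> q \<in> C \<Longrightarrow> (\<And>w. N \<le> length w \<Longrightarrow> p w = 0) \<Longrightarrow>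
      (\<And>w. N \<le> length w \<Longrightarrow> q w = 0) \<Longrightarrow> \<beta> p q = \<beta>' p q"
    and t: "t \<in> C" "\<And>w. Suc N \<le> length w \<Longrightarrow> t w = 0"
  shows "tlift C C \<beta> (diag t) = tlift C C \<beta>' (diag t)"
proof -
  interpret W: vector_space sW by fact
  obtain xs where xs: "set xs \<subseteq> C \<times> C" "diag t = tsum xs" using t(1) by (rule diag_tsum)
  define r where "r p = p - fscale (p []) e" for p :: "('f, 'a) tens"
  have r_apply: "r p w = (if w = [] then 0 else p w)" for p w
    by (simp add: r_def fscale_def e)
  have r_in: "r p \<in> C" if "p \<in> C" for p
    unfolding r_def by (intro fs.subspace_diff[OF subspace] fs.subspace_scale[OF subspace] that one)
  \<comment> \<open>Two nonempty words of total length at most \<open>N\<close> are each shorter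
    than \<open>N\<close>; so the reduced diagonal has its rows and columns in \<open>D\<close>, the
    range where \<open>eq\<close> applies.\<close>
  define D where "D = {p \<in> C. \<forall>w. N \<le> length w \<longrightarrow> p w = 0}"
  have D: "fs.subspace D"
    unfolding D_def
  proof (rule fs.subspaceI)
    show "0 \<in> {p \<in> C. \<forall>w. N \<le> length w \<longrightarrow> p w = 0}" using fs.subspace_0[OF subspace] by simp
  qed (use fs.subspace_add[OF subspace] fs.subspace_scale[OF subspace] in \<open>auto simp: fscale_def\<close>)
  define rs where "rs = map (\<lambda>(p, q). (r p, r q)) xs"
  have rs_C: "set rs \<subseteq> C \<times> C" using xs(1) r_in by (auto simp: rs_def)
  have rs: "tsum rs (x, y) = (if x = [] \<or> y = [] then 0 else t (x @ y))" for x y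
  proof -
    have "tsum rs (x, y) = (if x = [] \<or> y = [] then 0 else tsum xs (x, y))"
      by (simp add: rs_def tsum_apply case_prod_unfold o_def r_apply)
    then show ?thesis by (simp add: xs(2)[symmetric] diag_def)
  qed
  have "(\<lambda>x. tsum rs (x, y)) \<in> D" for y
  proof (cases "y = []")
    case True
    then have "(\<lambda>x. tsum rs (x, y)) = 0" by (simp add: rs fun_eq_iff)
    then show ?thesis by (simp only: fs.subspace_0[OF D])
  next
    case False
    then have "(\<lambda>x. tsum rs (x, y)) = r (\<lambda>x. t (x @ y))" by (auto simp: rs r_apply fun_eq_iff)
    moreover have "t (w @ y) = 0" if "N \<le> length w" for w
      using that False by (intro t(2)) (cases y, auto)
    ultimately show ?thesis
      using r_in[OF column_in[OF t(1)]] by (auto simp: D_def r_apply)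
  qed
  moreover have "(\<lambda>y. tsum rs (x, y)) \<in> D" for x
  proof (cases "x = []")
    case True
    then have "(\<lambda>y. tsum rs (x, y)) = 0" by (simp add: rs fun_eq_iff)
    then show ?thesis by (simp only: fs.subspace_0[OF D])
  next
    case False
    then have "(\<lambda>y. tsum rs (x, y)) = r (\<lambda>y. t (x @ y))" by (auto simp: rs r_apply fun_eq_iff)
    moreover have "t (x @ w) = 0" if "N \<le> length w" for w
      using that False by (intro t(2)) (cases x, auto)
    ultimately show ?thesis
      using r_in[OF row_in[OF t(1)]] by (auto simp: D_def r_apply)
  qed
  ultimately obtain ys where ys: "set ys \<subseteq> D \<times> D" "tsum rs = tsum ys"
    using tsum_rows_columns[OF D D] by blast
  have DC: "D \<subseteq> C" by (auto simp: D_def)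
  have reduce: "tlift C C b (diag t) = sum_list (map (\<lambda>(p, q). b p q) ys)"
    if b: "bilin_on sW C C b" "\<And>p. p \<in> C \<Longrightarrow> b e p = 0" "\<And>p. p \<in> C \<Longrightarrow> b p e = 0" for b
  proof -
    have "b (r p) (r q) = b p q" if "p \<in> C" "q \<in> C" for p q
    proof -
      have "b (r p) (r q) = b p (r q) - b (fscale (p []) e) (r q)"
        unfolding r_def[of p] using b(1) r_in[OF that(2)] that fs.subspace_scale[OF subspace one]
        by (intro lin_on_diff[OF _ _ _ subspace fs.vector_space_axioms W]) (auto simp: bilin_on_def)
      also have "b (fscale (p []) e) (r q) = sW (p []) (b e (r q))"
        using b(1) r_in[OF that(2)]
        by (intro lin_on_scale[where f = "\<lambda>x. b x (r q)", OF _ one]) (auto simp: bilin_on_def)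
      also have "\<dots> = 0" using b(2)[OF r_in[OF that(2)]] by simp
      also have "b p (r q) = b p q - b p (fscale (q []) e)"
        unfolding r_def using b(1) that fs.subspace_scale[OF subspace one]
        by (intro lin_on_diff[OF _ _ _ subspace fs.vector_space_axioms W]) (auto simp: bilin_on_def)
      also have "b p (fscale (q []) e) = sW (q []) (b p e)"
        using b(1) that by (intro lin_on_scale[where f = "b p", OF _ one]) (auto simp: bilin_on_def)
      also have "\<dots> = 0" using b(3)[OF that(1)] by simp
      finally show ?thesis by simp
    qed
    then have "sum_list (map (\<lambda>(p, q). b p q) xs) = sum_list (map (\<lambda>(p, q). b p q) rs)"
      unfolding rs_def map_map using xs(1) by (intro arg_cong[where f = sum_list] map_cong) auto
    also have "\<dots> = tlift C C b (tsum rs)"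
      by (rule tlift_tsum[OF subspace subspace W b(1) rs_C, symmetric]) simp
    also have "\<dots> = sum_list (map (\<lambda>(p, q). b p q) ys)"
      using ys DC by (intro tlift_tsum[OF subspace subspace W b(1)]) auto
    finally show ?thesis using tlift_diag[OF b(1) W xs] by simp
  qed
  have "sum_list (map (\<lambda>(p, q). \<beta> p q) ys) = sum_list (map (\<lambda>(p, q). \<beta>' p q) ys)"
    using ys(1) eq by (intro arg_cong[where f = sum_list] map_cong) (auto simp: D_def)
  then show ?thesis using reduce[OF \<beta> unit(1,2)] reduce[OF \<beta>' unit(3,4)] by simp
qed

lemma coalgebra_map_restrict:
  assumes F: "coalgebra_map C C' F" and D: "subcoalgebra D" "D \<subseteq> C" "F ` D \<subseteq> D'"
  shows "coalgebra_map D D' F"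
proof -
  have lin: "lin_on fscale fscale C F" using F by (simp add: coalgebra_map_def)
  have "diag (F t) = tlift D D (\<lambda>p q. tprod (F p) (F q)) (diag t)" if "t \<in> D" for t
    using tlift_smaller[OF D(1,2) that bilin_on_tprod[OF lin lin] vector_space_fscale] F that D(2)
    by (auto simp: coalgebra_map_def)
  then show ?thesis using F D lin_on_subset[OF lin D(2)] by (auto simp: coalgebra_map_def)
qed

lemma coalgebra_map_cong:
  assumes F: "coalgebra_map C C' F" and eq: "\<And>t. t \<in> C \<Longrightarrow> F t = F' t"
  shows "coalgebra_map C C' F'"
proof -
  have lin: "lin_on fscale fscale C F" using F by (simp add: coalgebra_map_def)
  have lin': "lin_on fscale fscale C F'"
    by (rule lin_on_cong[OF lin subspace fs.vector_space_axioms eq])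
  have "tlift C C (\<lambda>p q. tprod (F p) (F q)) (diag t) = tlift C C (\<lambda>p q. tprod (F' p) (F' q)) (diag t)"
    if "t \<in> C" for t
  proof -
    obtain xs where xs: "set xs \<subseteq> C \<times> C" "diag t = tsum xs" using \<open>t \<in> C\<close> by (rule diag_tsum)
    have "sum_list (map (\<lambda>(p, q). tprod (F p) (F q)) xs) = sum_list (map (\<lambda>(p, q). tprod (F' p) (F' q)) xs)"
      using xs(1) eq by (intro arg_cong[where f = sum_list] map_cong) auto
    then show ?thesis
      using tlift_diag[OF bilin_on_tprod[OF lin lin] vector_space_fscale xs]
        tlift_diag[OF bilin_on_tprod[OF lin' lin'] vector_space_fscale xs] by simp
  qed
  then show ?thesis using F lin' eq by (auto simp: coalgebra_map_def)
qed

end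

context grsp
begin

text \<open>A row of a row is a row, and in degree zero columns equal rows; so a linear condition
  imposed on all rows is stable under both and cuts out a subcoalgebra.\<close>

lemma Sc_0_subcoalgebra_rows:
  assumes L: "lin_on fscale sW (Sc s G (G 0)) L" and W: "vector_space sW"
  shows "subcoalgebra {t \<in> Sc s G (G 0). \<forall>x. L (\<lambda>z. t (x @ z)) = 0}" (is "subcoalgebra ?C")
proof (rule subcoalgebraI)
  interpret C: coalg "Sc s G (G 0)" by unfold_locales (rule subcoalgebra_Sc)
  interpret W: vector_space sW by fact
  have L0: "L (\<lambda>z. 0) = 0"
    using lin_on_zero[OF L subspace_Sc fs.vector_space_axioms W] by (simp add: zero_fun_def)
  show "fs.subspace ?C"
  proof (rule fs.subspaceI)
    show "0 \<in> ?C" using L0 fs.subspace_0[OF subspace_Sc] by simp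
    show "x + y \<in> ?C" if "x \<in> ?C" "y \<in> ?C" for x y
    proof -
      have "x \<in> Sc s G (G 0)" "y \<in> Sc s G (G 0)" using that by auto
      then have "L (\<lambda>z. (x + y) (u @ z)) = L (\<lambda>z. x (u @ z)) + L (\<lambda>z. y (u @ z))" for u
        using lin_on_add[OF L C.row_in C.row_in, of x y u u] by (simp add: plus_fun_def)
      then show ?thesis using that fs.subspace_add[OF subspace_Sc] by auto
    qed
    show "fscale c x \<in> ?C" if "x \<in> ?C" for c x
    proof -
      have "x \<in> Sc s G (G 0)" using that by auto
      then have "L (\<lambda>z. (fscale c x) (u @ z)) = sW c (L (\<lambda>z. x (u @ z)))" for u
        using lin_on_scale[OF L C.row_in, of x c u] by (simp add: fscale_def)
      then show ?thesis using that fs.subspace_scale[OF subspace_Sc] by auto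
    qed
  qed
  fix t u assume t: "t \<in> ?C"
  then have t': "t \<in> Sc s G (G 0)" by simp
  show "\<exists>xs. diag t = tsum xs" using t' C.diag_tsum by blast
  show row: "(\<lambda>z. t (u @ z)) \<in> ?C"
    using t C.row_in[OF t'] by (auto simp flip: append_assoc)
  have "(\<lambda>z. t (z @ u)) = (\<lambda>z. t (u @ z))"
    by (rule ext) (rule Sc_0_perm[OF t'], simp add: union_commute)
  then show "(\<lambda>z. t (z @ u)) \<in> ?C" using row by simp
qed

end

context colift
begin

text \<open>Comultiplicativity in row form: rows of a lift are lifts of partial evaluations. A
  condition on all rows of an image thus reduces to a condition on lifts themselves.\<close>

lemma row_lift_map:
  assumes "t \<in> C"
  shows "(\<lambda>y. lift_map s G f t (x @ y)) = lift_map s G f (\<lambda>y. lift_at s G f x (\<lambda>z. t (z @ y)))"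
  by (rule ext) (simp add: lift_map_def lift_at_append fubini[OF assms lin_on_lift_at lin_on_lift_at])

end

lemma coder_at_sum:
  assumes "grsp s G" "finite J"
  shows "(\<Sum>j\<in>J. coder_at s G (\<theta> j) w t) = coder_at s G (\<lambda>u. \<Sum>j\<in>J. \<theta> j u) w t"
proof (induction w arbitrary: t)
  case (Cons a w)
  interpret grsp s G by fact
  show ?case
    by (simp add: sum.distrib Cons[symmetric] sum_distrib_left hdual_simps(6))
qed simp

text \<open>Only partial evaluations of \<open>t\<close> are fed to \<open>\<theta>\<close>, and
  they inherit the length bound.\<close>

lemma (in grsp) coder_at_cong:
  assumes eq: "\<And>u. u \<in> Sc s G UNIV \<Longrightarrow> (\<And>w. N \<le> length w \<Longrightarrow> u w = 0) \<Longrightarrow> \<theta> u = \<theta>' u"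
    and t: "t \<in> Sc s G UNIV" "\<And>w. N \<le> length w \<Longrightarrow> t w = 0"
  shows "coder_at s G \<theta> w t = coder_at s G \<theta>' w t"
  using t
proof (induction w arbitrary: t)
  case (Cons a w)
  interpret C: coalg "Sc s G UNIV" by unfold_locales (rule subcoalgebra_Sc)
  have "\<theta> (\<lambda>z. t (z @ w)) = \<theta>' (\<lambda>z. t (z @ w))"
    using Cons.prems by (intro eq C.column_in) auto
  moreover have "coder_at s G \<theta> w (\<lambda>z. t (a # z)) = coder_at s G \<theta>' w (\<lambda>z. t (a # z))"
    using C.row_in[OF Cons.prems(1), of "[a]"] Cons.prems(2) by (intro Cons.IH) auto
  ultimately show ?case by simp
qed simp

section \<open>Induced morphisms\<close>

definition pull :: "('a \<Rightarrow> 'b) \<Rightarrow> ('f, 'b) word \<Rightarrow> ('f, 'a) word" where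
  "pull f = map (\<lambda>(n, \<psi>). (n, \<psi> \<circ> f))"

lemma pull_simps [simp]: "pull f [] = []" "pull f (a # w) = (fst a, snd a \<circ> f) # pull f w"
  "pull f (v @ w) = pull f v @ pull f w" "length (pull f w) = length w"
  by (auto simp: pull_def case_prod_unfold)

lemma Sc_map_pull: "Sc_map s' G' f t w = (if hword s' G' w then t (pull f w) else 0)"
  by (simp add: Sc_map_def pull_def)

lemma lin_on_Sc_map: "lin_on fscale fscale S (Sc_map s' G' f)"
  by (auto simp: lin_on_def Sc_map_def fun_eq_iff fscale_def)

lemma row_Sc_map:
  "(\<lambda>z. Sc_map s' G' f t (x @ z)) = (if hword s' G' x then Sc_map s' G' f (\<lambda>z. t (pull f x @ z)) else 0)"
  by (auto simp: Sc_map_pull fun_eq_iff)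

lemma Sc_map_in_Sc:
  assumes "grsp s G" "grsp s' G'" "Vector_Spaces.linear s s' f" "degree_map G G' 0 f" "f ` U \<subseteq> U'"
    and t: "t \<in> Sc s G U"
  shows "Sc_map s' G' f t \<in> Sc s' G' U'"
  unfolding Sc_iff
proof (intro conjI graded_symmetricI)
  interpret V: grsp s G by fact
  interpret V': grsp s' G' by fact
  show "Sc_map s' G' f t \<in> tens_span s' G' U'"
  proof (rule V.tens_span_linear_image[of t U _ "Sc_map s' G' f"])
    show "t \<in> tens_span s G U" using t by (simp add: Sc_iff)
    show "Sc_map s' G' f (pure_tensor s G us) \<in> tens_span s' G' U'" if "set us \<subseteq> U" for us
      unfolding Sc_map_pure_tensor[OF assms(3,4)] using that assms(5) by (intro V'.pure_in_tens_span) auto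
  qed (auto simp: Sc_map_def fun_eq_iff fscale_def V'.subspace_tens_span)
  fix w w' m n \<phi> \<psi>
  have "graded_symmetric t" using t by (simp add: Sc_iff)
  then show "Sc_map s' G' f t (w @ (m, \<phi>) # (n, \<psi>) # w') = koszul (m * n) * Sc_map s' G' f t (w @ (n, \<psi>) # (m, \<phi>) # w')"
    using graded_symmetricD[of t "pull f w" m "\<phi> \<circ> f" n "\<psi> \<circ> f" "pull f w'"] by (auto simp: Sc_map_pull)
qed

lemma corestrict_Sc_map:
  assumes "grsp s G" "grsp s' G'" "Vector_Spaces.linear s s' f" "degree_map G G' 0 f"
    and t: "t \<in> Sc s G U"
  shows "corestrict s' G' (Sc_map s' G' f t) = f (corestrict s G t)"
proof -
  interpret V: grsp s G by fact
  interpret V': grsp s' G' by fact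
  show ?thesis
  proof (rule V'.corestrict_eqI)
    fix n \<psi> assume \<psi>: "\<psi> \<in> hdual s' G' n"
    then have "\<psi> \<circ> f \<in> hdual s G n"
      using assms(3,4) unfolding hdual_def degree_map_def
      by (auto simp: image_subset_iff intro: Vector_Spaces.linear_compose)
    then show "Sc_map s' G' f t [(n, \<psi>)] = \<psi> (f (corestrict s G t))"
      using V.corestrict_apply[OF t] \<psi> by (simp add: Sc_map_pull)
  qed
qed

lemma diag_Sc_map: "diag t = tsum xs \<Longrightarrow>
    diag (Sc_map s' G' f t) = tsum (map (\<lambda>(p, q). (Sc_map s' G' f p, Sc_map s' G' f q)) xs)"
proof (rule prod_fun_ext)
  fix x y assume xs: "diag t = tsum xs"
  have "t (pull f x @ pull f y) = sum_list (map (\<lambda>(p, q). p (pull f x) * q (pull f y)) xs)"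
    using fun_cong[OF xs, of "(pull f x, pull f y)"] by (simp add: diag_def tsum_apply)
  then show "diag (Sc_map s' G' f t) (x, y) = tsum (map (\<lambda>(p, q). (Sc_map s' G' f p, Sc_map s' G' f q)) xs) (x, y)"
    by (cases "hword s' G' x"; cases "hword s' G' y")
      (simp_all add: diag_def Sc_map_pull tsum_apply case_prod_unfold o_def)
qed

lemma coalgebra_map_Sc_map:
  assumes "subcoalgebra C" "Sc_map s' G' f ` C \<subseteq> C'"
  shows "coalgebra_map C C' (Sc_map s' G' f)"
proof -
  interpret coalg C by unfold_locales fact
  have "diag (Sc_map s' G' f t) = tlift C C (\<lambda>p q. tprod (Sc_map s' G' f p) (Sc_map s' G' f q)) (diag t)"
    if "t \<in> C" for t
  proof -
    obtain xs where xs: "set xs \<subseteq> C \<times> C" "diag t = tsum xs" using \<open>t \<in> C\<close> by (rule diag_tsum)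
    show ?thesis
      unfolding tlift_diag[OF bilin_on_tprod[OF lin_on_Sc_map lin_on_Sc_map] vector_space_fscale xs] diag_Sc_map[OF xs(2)]
      by (simp add: tsum_def case_prod_unfold o_def)
  qed
  then show ?thesis
    using assms(2) lin_on_Sc_map by (auto simp: coalgebra_map_def counit_def Sc_map_pull)
qed

section \<open>The twisting cochain\<close>

text \<open>Total lengths are traded for pairs of lengths; \<open>2 * N \<le> M\<close> puts the
  whole square of indices below \<open>N\<close> under the last antidiagonal.\<close>

lemma sum_antidiagonals:
  fixes g :: "nat \<Rightarrow> nat \<Rightarrow> 'w::comm_monoid_add"
  assumes "\<And>i j. N \<le> i \<or> N \<le> j \<Longrightarrow> g i j = 0" "2 * N \<le> M"
  shows "(\<Sum>l\<in>{2..<M}. \<Sum>i\<in>{1..<l}. g i (l - i)) = (\<Sum>i\<in>{1..<N}. \<Sum>j\<in>{1..<N}. g i j)"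
proof -
  have "(\<Sum>l\<in>{2..<M}. \<Sum>i\<in>{1..<l}. g i (l - i)) = (\<Sum>(l, i)\<in>Sigma {2..<M} (\<lambda>l. {1..<l}). g i (l - i))"
    by (rule sum.Sigma) auto
  also have "\<dots> = (\<Sum>(i, j)\<in>{(i, j). 1 \<le> i \<and> 1 \<le> j \<and> i + j < M}. g i j)"
    by (rule sum.reindex_bij_witness[of _ "\<lambda>(i, j). (i + j, i)" "\<lambda>(l, i). (i, l - i)"]) auto
  also have "\<dots> = (\<Sum>(i, j)\<in>{1..<N} \<times> {1..<N}. g i j)"
  proof (rule sum.mono_neutral_right)
    show "finite {(i, j). 1 \<le> i \<and> 1 \<le> j \<and> i + j < M}"
      by (rule finite_subset[of _ "{..<M} \<times> {..<M}"]) auto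
    show "\<forall>x\<in>{(i, j). 1 \<le> i \<and> 1 \<le> j \<and> i + j < M} - {1..<N} \<times> {1..<N}. (case x of (i, j) \<Rightarrow> g i j) = 0"
    proof
      fix x assume x: "x \<in> {(i, j). 1 \<le> i \<and> 1 \<le> j \<and> i + j < M} - {1..<N} \<times> {1..<N}"
      obtain i j where ij: "x = (i, j)" by force
      then have "N \<le> i \<or> N \<le> j" using x by auto
      then show "(case x of (i, j) \<Rightarrow> g i j) = 0" using assms(1) ij by simp
    qed
  qed (use assms(2) in auto)
  also have "\<dots> = (\<Sum>i\<in>{1..<N}. \<Sum>j\<in>{1..<N}. g i j)"
    by (rule sum.cartesian_product[symmetric])
  finally show ?thesis .
qed

locale twisting =
  fixes s :: "'f::field_char_0 \<Rightarrow> 'a::ab_group_add \<Rightarrow> 'a"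
    and G :: "int \<Rightarrow> 'a set"
    and d :: "'a \<Rightarrow> 'a"
    and br :: "'a \<Rightarrow> 'a \<Rightarrow> 'a"
    and sH :: "'f \<Rightarrow> 'b::ab_group_add \<Rightarrow> 'b"
    and GH :: "int \<Rightarrow> 'b set"
    and nab :: "'b \<Rightarrow> 'a"
    and p :: "'a \<Rightarrow> 'b"
    and h :: "'a \<Rightarrow> 'a"
  assumes dg: "dg_lie s G d br"
    and conc: "concentrated G {-1, -2}"
    and contr: "contraction s G d sH GH nab p h"
begin

sublocale V: grsp0 s "susp G"
  using dg graded_space_susp by unfold_locales (auto simp: dg_lie_def)

sublocale H: grsp0 sH "susp GH"
  using contr graded_space_susp by unfold_locales (auto simp: contraction_def)

sublocale d: Vector_Spaces.linear s s d using dg by (simp add: dg_lie_def)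
sublocale nab: Vector_Spaces.linear sH s nab using contr by (simp add: contraction_def)
sublocale p: Vector_Spaces.linear s sH p using contr by (simp add: contraction_def)
sublocale h: Vector_Spaces.linear s s h using contr by (simp add: contraction_def)

lemma subspace_G: "V.subspace (G n)"
  using V.subspace_G[of "n + 1"] by (simp add: susp_def)

lemma br_right: "Vector_Spaces.linear s s (br x)" and br_left: "Vector_Spaces.linear s s (\<lambda>x. br x y)"
  using dg unfolding dg_lie_def by blast+

lemma br_simps:
  "br x (y + z) = br x y + br x z" "br (x + y) z = br x z + br y z"
  "br x (s c y) = s c (br x y)" "br (s c x) y = s c (br x y)" "br x 0 = 0" "br 0 y = 0"
  "br x (sum g A) = (\<Sum>i\<in>A. br x (g i))" "br (sum g A) y = (\<Sum>i\<in>A. br (g i) y)"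
proof -
  interpret r: Vector_Spaces.linear s s "br x" for x by (rule br_right)
  interpret l: Vector_Spaces.linear s s "\<lambda>x. br x y" for y by (rule br_left)
  show "br x (y + z) = br x y + br x z" "br (x + y) z = br x z + br y z"
    "br x (s c y) = s c (br x y)" "br (s c x) y = s c (br x y)" "br x 0 = 0" "br 0 y = 0"
    "br x (sum g A) = (\<Sum>i\<in>A. br x (g i))" "br (sum g A) y = (\<Sum>i\<in>A. br (g i) y)"
    by (simp_all add: r.add r.scale r.zero r.sum l.add l.scale l.zero l.sum)
qed

lemma br_deg: "x \<in> G m \<Longrightarrow> y \<in> G n \<Longrightarrow> br x y \<in> G (m + n)"
  using dg unfolding dg_lie_def by blast

lemma h_deg: "x \<in> G n \<Longrightarrow> h x \<in> G (n + 1)"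
  using contr unfolding contraction_def degree_map_def
  by (metis (no_types, lifting) add.right_neutral image_subset_iff)

lemma d_deg: "x \<in> G n \<Longrightarrow> d x \<in> G (n - 1)"
proof -
  have "degree_map G G (- 1) d" using dg unfolding dg_lie_def by blast
  then show "x \<in> G n \<Longrightarrow> d x \<in> G (n - 1)" by (auto simp: degree_map_def)
qed

lemma p_deg: "x \<in> G n \<Longrightarrow> p x \<in> GH n"
  using contr unfolding contraction_def degree_map_def
  by (metis (no_types, lifting) add.right_neutral image_subset_iff)

lemma nab_deg: "u \<in> GH n \<Longrightarrow> nab u \<in> G n"
  using contr unfolding contraction_def degree_map_def
  by (metis (no_types, lifting) add.right_neutral image_subset_iff)

lemma identities: "d (d x) = 0" "d (nab u) = 0" "p (d x) = 0" "p (nab u) = u" "d (h x) + h (d x) = x - nab (p x)"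
    "p (h x) = 0" "h (nab u) = 0" "h (h x) = 0"
proof -
  show "d (d x) = 0" using dg unfolding dg_lie_def by blast
qed (use contr[unfolded contraction_def] in blast)+

text \<open>Applying \<open>h\<close> to the homotopy identity kills \<open>nab (p x)\<close> and
  \<open>h (d x)\<close>. This relation makes the brackets \<open>br\<close> and
  \<open>bracket_a\<close> yield the same cochain.\<close>

lemma hdh: "h (d (h x)) = h x"
proof -
  have "h (d (h x)) = h (x - nab (p x) - h (d x))" using identities(5)[of x] by (metis add_diff_cancel_right')
  then show ?thesis by (simp add: h.diff identities)
qed

section \<open>Convolution brackets and the parts of the cochain\<close>

abbreviation C where "C \<equiv> Sc sH (susp GH) UNIV"
abbreviation T where "T l \<equiv> tau_part s br sH GH nab h l"
abbreviation conv where "conv \<equiv> conv_bracket C br"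

sublocale C: coalg "Sc sH (susp GH) UNIV"
  by unfold_locales (rule H.subcoalgebra_Sc)

lemma parity_linear: "parity (x + y) = parity x + parity y" "parity (fscale c x) = fscale c (parity x)"
  for x :: "('f, 'c) tens"
  by (auto simp: parity_def fun_eq_iff fscale_def algebra_simps)

lemma bilin_conv:
  assumes a: "lin_on fscale s C a" and b: "lin_on fscale s C b"
  shows "bilin_on s C C (\<lambda>x y. br (a (parity x)) (b y))"
proof (rule bilin_onI)
  show "lin_on fscale s C (\<lambda>x. br (a (parity x)) (b q))" for q
    using H.parity_Sc lin_on_add[OF a] lin_on_scale[OF a] by (intro lin_onI) (simp_all add: parity_linear br_simps)
  show "lin_on fscale s C (\<lambda>q. br (a (parity p)) (b q))" for p
    using lin_on_add[OF b] lin_on_scale[OF b] by (intro lin_onI) (simp_all add: br_simps)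
qed

lemma lin_on_conv:
  assumes "lin_on fscale s C a" "lin_on fscale s C b"
  shows "lin_on fscale s C (conv a b)"
proof -
  have "conv a b = (\<lambda>t. tlift C C (\<lambda>p q. br (a (parity p)) (b q)) (diag t))"
    by (rule ext) (simp add: conv_bracket_def)
  then show ?thesis using C.lin_on_tlift[OF bilin_conv[OF assms] V.vector_space_axioms] by simp
qed

lemma conv_tsum:
  assumes "lin_on fscale s C a" "lin_on fscale s C b" "set xs \<subseteq> C \<times> C" "diag t = tsum xs"
  shows "conv a b t = sum_list (map (\<lambda>(p, q). br (a (parity p)) (b q)) xs)"
  unfolding conv_bracket_def by (rule C.tlift_diag[OF bilin_conv[OF assms(1,2)] V.vector_space_axioms assms(3,4)])

lemma conv_deg:
  assumes a: "lin_on fscale s C a" "deg_on C (susp G) 0 a" and b: "lin_on fscale s C b" "deg_on C (susp G) 0 b"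
    and t: "t \<in> C" "homogeneous n t"
  shows "conv a b t \<in> G (n - 2)"
proof -
  obtain xs where xs: "set xs \<subseteq> C \<times> C" "diag t = tsum xs"
    "\<And>u v. (u, v) \<in> set xs \<Longrightarrow> \<exists>k. homogeneous k u \<and> homogeneous (n - k) v"
    using H.diag_homogeneous[OF t] by blast
  have "br (a (parity u)) (b v) \<in> G (n - 2)" if uv: "(u, v) \<in> set xs" for u v
  proof -
    obtain k where k: "homogeneous k u" "homogeneous (n - k) v" using xs(3)[OF uv] by blast
    have "homogeneous k (parity u)" using k(1) by (auto simp: homogeneous_def parity_def)
    moreover have "u \<in> C" "v \<in> C" using uv xs(1) by auto
    ultimately have "a (parity u) \<in> G (k - 1)" "b v \<in> G (n - k - 1)"
      using a(2) b(2) k(2) H.parity_Sc by (auto simp: deg_on_def susp_def)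
    from br_deg[OF this] show ?thesis by simp
  qed
  then have "\<forall>x\<in>set (map (\<lambda>(p, q). br (a (parity p)) (b q)) xs). x \<in> G (n - 2)" by auto
  moreover have "sum_list ys \<in> G m" if "\<forall>x\<in>set ys. x \<in> G m" for ys m
    using that by (induction ys) (auto simp: V.subspace_0[OF subspace_G] intro: V.subspace_add[OF subspace_G])
  ultimately have "sum_list (map (\<lambda>(p, q). br (a (parity p)) (b q)) xs) \<in> G (n - 2)" by blast
  then show ?thesis using conv_tsum[OF a(1) b(1) xs(1,2)] by simp
qed

lemma T_0: "T 0 = (\<lambda>t. 0)" and T_1: "T (Suc 0) = (\<lambda>t. nab (corestrict sH (susp GH) t))"
  and T_step: "2 \<le> l \<Longrightarrow> T l t = s (1 / 2) (h (\<Sum>i\<in>{1..<l}. conv (T i) (T (l - i)) (tensor_length l t)))"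
  by (subst tau_part.simps, simp)+

lemma homogeneous_tensor_length: "homogeneous n t \<Longrightarrow> homogeneous n (tensor_length l t)"
  by (auto simp: homogeneous_def tensor_length_def)

lemma tensor_length_linear: "tensor_length l (x + y) = tensor_length l x + tensor_length l y"
  "tensor_length l (fscale c x) = fscale c (tensor_length l x)" for x :: "('f, 'c) tens"
  by (auto simp: tensor_length_def fun_eq_iff fscale_def)

lemma lin_on_conv_length:
  assumes "lin_on fscale s C a" "lin_on fscale s C b"
  shows "lin_on fscale s C (\<lambda>t. conv a b (tensor_length l t))"
proof (rule lin_onI)
  note l = lin_on_conv[OF assms]
  show "conv a b (tensor_length l (x + y)) = conv a b (tensor_length l x) + conv a b (tensor_length l y)"
    if "x \<in> C" "y \<in> C" for x y
    unfolding tensor_length_linear by (rule lin_on_add[OF l H.tensor_length_Sc[OF that(1)] H.tensor_length_Sc[OF that(2)]])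
  show "conv a b (tensor_length l (fscale c x)) = s c (conv a b (tensor_length l x))" if "x \<in> C" for c x
    unfolding tensor_length_linear by (rule lin_on_scale[OF l H.tensor_length_Sc[OF that]])
qed

lemma lin_on_sum_fun:
  assumes "\<And>i. i \<in> I \<Longrightarrow> lin_on fscale s C (g i)"
  shows "lin_on fscale s C (\<lambda>t. \<Sum>i\<in>I. g i t)"
  using assms by (intro lin_onI) (simp_all add: lin_on_def sum.distrib V.scale_sum_right)

text \<open>Degree \<open>0\<close> refers to the suspended grading of the target, that is, to
  degree \<open>-1\<close> in \<open>G\<close>. Linearity accompanies it in the induction because
  the degree of a bracket is read off from a presentation of the diagonal.\<close>

lemma T_lin_deg: "lin_on fscale s C (T l) \<and> deg_on C (susp G) 0 (T l)"
proof (induction l rule: less_induct)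
  case (less l)
  consider "l = 0" | "l = Suc 0" | "2 \<le> l" by linarith
  then show ?case
  proof cases
    case 1
    then show ?thesis
      by (auto simp: T_0 lin_on_def deg_on_def V.subspace_0[OF V.subspace_G])
  next
    case 2
    have "corestrict sH (susp GH) t \<in> susp GH n" if "t \<in> C" "homogeneous n t" for n t
    proof (rule H.in_GI)
      fix m \<phi> assume m: "m \<noteq> n" and \<phi>: "\<phi> \<in> hdual sH (susp GH) m"
      have "t [(m, \<phi>)] = 0" using that(2) m by (auto simp: homogeneous_def)
      then show "\<phi> (corestrict sH (susp GH) t) = 0" using H.corestrict_apply[OF that(1) \<phi>] by simp
    qed
    then have "deg_on C (susp G) 0 (T l)"
      using 2 nab_deg by (auto simp: T_1 deg_on_def susp_def)
    moreover have "lin_on fscale s C (T l)"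
      unfolding 2 T_1 by (rule lin_on_compose[OF H.lin_on_corestrict nab.linear_axioms])
    ultimately show ?thesis by blast
  next
    case 3
    have T: "T l = (\<lambda>t. s (1 / 2) (h (\<Sum>i\<in>{1..<l}. conv (T i) (T (l - i)) (tensor_length l t))))"
      by (rule ext) (rule T_step[OF 3])
    have lin: "lin_on fscale s C (\<lambda>t. \<Sum>i\<in>{1..<l}. conv (T i) (T (l - i)) (tensor_length l t))"
      using less 3 by (intro lin_on_sum_fun lin_on_conv_length) auto
    have "lin_on fscale s C (T l)"
      unfolding T using lin by (auto simp: lin_on_def h.add h.scale V.scale_right_distrib mult.commute)
    moreover have "deg_on C (susp G) 0 (T l)"
      unfolding deg_on_def
    proof (intro allI ballI impI)
      fix n t assume t: "t \<in> C" "homogeneous n t"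
      have "conv (T i) (T (l - i)) (tensor_length l t) \<in> G (n - 2)" if "i \<in> {1..<l}" for i
        using less that by (intro conv_deg H.tensor_length_Sc homogeneous_tensor_length t) auto
      then have "(\<Sum>i\<in>{1..<l}. conv (T i) (T (l - i)) (tensor_length l t)) \<in> G (n - 2)"
        by (rule V.subspace_sum[OF subspace_G])
      from h_deg[OF this] have "T l t \<in> G (n - 1)"
        unfolding T by (intro V.subspace_scale[OF subspace_G]) simp
      then show "T l t \<in> susp G (n + 0)" by (simp add: susp_def)
    qed
    ultimately show ?thesis by blast
  qed
qed

lemma T_lin: "lin_on fscale s C (T l)" and T_deg: "deg_on C (susp G) 0 (T l)"
  using T_lin_deg by auto

lemma lin_zero: "lin_on fscale s C f \<Longrightarrow> f 0 = 0"
  by (rule lin_on_zero[OF _ C.subspace fs.vector_space_axioms V.vector_space_axioms])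

lemma T_local:
  assumes t: "t \<in> C" "\<And>w. length w = l \<Longrightarrow> t w = 0"
  shows "T l t = 0"
proof -
  consider "l = 0" | "l = Suc 0" | "2 \<le> l" by linarith
  then show ?thesis
  proof cases
    case 2
    have "corestrict sH (susp GH) t = 0"
      by (rule H.corestrict_eqI) (use t(2) 2 in \<open>simp add: H.hdual_simps\<close>)
    then show ?thesis using 2 by (simp add: T_1 nab.zero)
  next
    case 3
    have "tensor_length l t = 0" using t(2) by (simp add: tensor_length_def fun_eq_iff)
    then show ?thesis
      using 3 by (simp only: T_step lin_zero[OF lin_on_conv[OF T_lin T_lin]]) (simp add: h.zero)
  qed (simp add: T_0)
qed

lemma T_tensor_length:
  assumes t: "t \<in> C"
  shows "T l (tensor_length l t) = T l t"
proof -
  have "T l (t - tensor_length l t) = 0"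
    using fs.subspace_diff[OF C.subspace t H.tensor_length_Sc[OF t]]
    by (rule T_local) (simp add: tensor_length_def)
  then show ?thesis
    using lin_on_diff[OF T_lin t H.tensor_length_Sc[OF t] C.subspace fs.vector_space_axioms V.vector_space_axioms]
    by simp
qed

lemma parity_tensor_length: "parity (tensor_length l t) = tensor_length l (parity t)"
  for t :: "('f, 'c) tens"
  by (auto simp: parity_def tensor_length_def)

text \<open>\<open>T i\<close> sees only tensors of length \<open>i\<close> and \<open>T j\<close>
  only those of length \<open>j\<close>, so the truncation in the recursion changes nothing.\<close>

lemma conv_tensor_length:
  assumes t: "t \<in> C"
  shows "conv (T i) (T j) (tensor_length (i + j) t) = conv (T i) (T j) t"
proof -
  let ?u = "t - tensor_length (i + j) t"
  have u: "?u \<in> C" by (rule fs.subspace_diff[OF C.subspace t H.tensor_length_Sc[OF t]])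
  obtain xs where xs: "set xs \<subseteq> C \<times> C" "diag ?u = tsum xs" using u by (rule C.diag_tsum)
  let ?ys = "map (\<lambda>(p, q). (tensor_length i p, tensor_length j q)) xs"
  \<comment> \<open>Truncating the factors to lengths \<open>i\<close> and \<open>j\<close> leaves
    the values of \<open>?u\<close> on words of length \<open>i + j\<close>, which are zero.\<close>
  have "tsum ?ys = 0"
  proof (rule prod_fun_ext)
    fix x y
    have "tsum ?ys (x, y) = (if length x = i \<and> length y = j then tsum xs (x, y) else 0)"
      by (cases "length x = i"; cases "length y = j") (simp_all add: tsum_apply case_prod_unfold o_def tensor_length_def)
    also have "\<dots> = 0" by (simp add: xs(2)[symmetric] diag_def tensor_length_def)
    finally show "tsum ?ys (x, y) = 0 (x, y)" by simp
  qed
  moreover have "set ?ys \<subseteq> C \<times> C" using xs(1) H.tensor_length_Sc by auto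
  ultimately have "0 = sum_list (map (\<lambda>(p, q). br (T i (parity p)) (T j q)) ?ys)"
    using bilin_on_tsum_zero[OF C.subspace C.subspace V.vector_space_axioms bilin_conv[OF T_lin T_lin]] by metis
  also have "\<dots> = sum_list (map (\<lambda>(p, q). br (T i (parity p)) (T j q)) xs)"
    unfolding map_map using xs(1) H.parity_Sc
    by (intro arg_cong[where f = sum_list] map_cong) (auto simp: T_tensor_length parity_tensor_length)
  also have "\<dots> = conv (T i) (T j) ?u" by (rule conv_tsum[OF T_lin T_lin xs, symmetric])
  also have "\<dots> = conv (T i) (T j) t - conv (T i) (T j) (tensor_length (i + j) t)"
    by (rule lin_on_diff[OF lin_on_conv[OF T_lin T_lin] t H.tensor_length_Sc[OF t] C.subspace
          fs.vector_space_axioms V.vector_space_axioms])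
  finally show ?thesis by simp
qed

section \<open>The total cochain\<close>

abbreviation \<tau> where "\<tau> \<equiv> tau s br sH GH nab h"

text \<open>Parts beyond the length of \<open>t\<close> vanish, so the formal sum is finite, and any
  larger upper limit may be used to match other sums.\<close>

lemma tau_sum:
  assumes t: "t \<in> C" "\<And>w. N \<le> length w \<Longrightarrow> t w = 0"
  shows "\<tau> t = (\<Sum>l\<in>{1..<N}. T l t)"
proof -
  have zero: "T l t = 0" if "N \<le> l" for l
    using t that by (intro T_local) auto
  have "\<tau> t = (\<Sum>j\<in>{0..<N - 1}. T (Suc j) t)"
    unfolding tau_def
  proof (rule Sum_any.expand_superset)
    show "{j. T (Suc j) t \<noteq> 0} \<subseteq> {0..<N - 1}"
    proof
      fix j assume "j \<in> {j. T (Suc j) t \<noteq> 0}"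
      then have "\<not> N \<le> Suc j" using zero by blast
      then show "j \<in> {0..<N - 1}" by simp
    qed
  qed simp
  also have "\<dots> = (\<Sum>l\<in>{1..<N}. T l t)"
    by (cases N) (simp_all add: sum.shift_bounds_Suc_ivl del: sum.op_ivl_Suc)
  finally show ?thesis .
qed

lemma bounded_two:
  assumes "x \<in> C" "y \<in> C"
  obtains N where "\<And>w. N \<le> length w \<Longrightarrow> x w = 0" "\<And>w. N \<le> length w \<Longrightarrow> y w = 0"
proof -
  obtain N N' where "\<forall>w. N \<le> length w \<longrightarrow> x w = 0" "\<forall>w. N' \<le> length w \<longrightarrow> y w = 0"
    using H.Sc_bounded assms by metis
  then show thesis using that[of "max N N'"] by simp
qed

lemma tau_lin: "lin_on fscale s C \<tau>"
proof (rule lin_onI)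
  fix x y assume xy: "x \<in> C" "y \<in> C"
  then obtain N where N: "\<And>w. N \<le> length w \<Longrightarrow> x w = 0" "\<And>w. N \<le> length w \<Longrightarrow> y w = 0"
    using bounded_two[OF xy] by blast
  have "\<tau> (x + y) = (\<Sum>l\<in>{1..<N}. T l (x + y))"
    using fs.subspace_add[OF C.subspace xy] N by (intro tau_sum) auto
  also have "\<dots> = (\<Sum>l\<in>{1..<N}. T l x) + (\<Sum>l\<in>{1..<N}. T l y)"
    using lin_on_add[OF T_lin xy] by (simp add: sum.distrib)
  finally show "\<tau> (x + y) = \<tau> x + \<tau> y" using tau_sum[OF xy(1) N(1)] tau_sum[OF xy(2) N(2)] by simp
next
  fix c x assume x: "x \<in> C"
  obtain N where N: "\<And>w. N \<le> length w \<Longrightarrow> x w = 0" using bounded_two[OF x x] by blast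
  have "\<tau> (fscale c x) = (\<Sum>l\<in>{1..<N}. T l (fscale c x))"
    using fs.subspace_scale[OF C.subspace x] N by (intro tau_sum) (auto simp: fscale_def)
  also have "\<dots> = s c (\<Sum>l\<in>{1..<N}. T l x)"
    using lin_on_scale[OF T_lin x] by (simp add: V.scale_sum_right)
  finally show "\<tau> (fscale c x) = s c (\<tau> x)" using tau_sum[OF x N] by simp
qed

lemma tau_deg: "deg_on C (susp G) 0 \<tau>"
  unfolding deg_on_def
proof (intro allI ballI impI)
  fix n t assume t: "t \<in> C" "homogeneous n t"
  obtain N where N: "\<And>w. N \<le> length w \<Longrightarrow> t w = 0" using bounded_two[OF t(1) t(1)] by blast
  have "(\<Sum>l\<in>{1..<N}. T l t) \<in> susp G (n + 0)"
    using T_deg t by (intro V.subspace_sum[OF V.subspace_G]) (auto simp: deg_on_def)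
  then show "\<tau> t \<in> susp G (n + 0)" by (simp only: tau_sum[OF t(1) N])
qed

lemma tau_unit:
  assumes "t \<in> C" "\<And>w. w \<noteq> [] \<Longrightarrow> t w = 0"
  shows "\<tau> t = 0"
proof -
  have "t w = 0" if "1 \<le> length w" for w using that assms(2) by (cases w) auto
  from tau_sum[OF assms(1) this] show ?thesis by simp
qed

text \<open>One bound serves all factors of a presentation of the diagonal, and the product of two
  finite sums is regrouped by total length. All large limits are allowed, so that one can be chosen
  to fit the expansion of another quantity.\<close>

lemma conv_tau:
  assumes t: "t \<in> C"
  obtains M where "\<And>M'. M \<le> M' \<Longrightarrow>
    conv \<tau> \<tau> t = (\<Sum>l\<in>{2..<M'}. \<Sum>i\<in>{1..<l}. conv (T i) (T (l - i)) (tensor_length l t))"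
proof -
  obtain xs where xs: "set xs \<subseteq> C \<times> C" "diag t = tsum xs" using t by (rule C.diag_tsum)
  have "\<exists>N. \<forall>(u, v)\<in>set xs. \<forall>w. N \<le> length w \<longrightarrow> u w = 0 \<and> v w = 0"
    using xs(1)
  proof (induction xs)
    case (Cons x xs)
    then obtain N where N: "\<forall>(u, v)\<in>set xs. \<forall>w. N \<le> length w \<longrightarrow> u w = 0 \<and> v w = 0" by auto
    have x: "fst x \<in> C" "snd x \<in> C" using Cons(2) by auto
    obtain N' where "\<And>w. N' \<le> length w \<Longrightarrow> fst x w = 0" "\<And>w. N' \<le> length w \<Longrightarrow> snd x w = 0"
      using bounded_two[OF x] by blast
    then show ?case using N by (intro exI[of _ "max N N'"]) (auto simp: case_prod_unfold)
  qed simp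
  then obtain N where N: "\<And>u v w. (u, v) \<in> set xs \<Longrightarrow> N \<le> length w \<Longrightarrow> u w = 0"
    "\<And>u v w. (u, v) \<in> set xs \<Longrightarrow> N \<le> length w \<Longrightarrow> v w = 0" by blast
  have "conv \<tau> \<tau> t = (\<Sum>l\<in>{2..<M}. \<Sum>i\<in>{1..<l}. conv (T i) (T (l - i)) (tensor_length l t))" if M: "2 * N \<le> M" for M
  proof -
    have swap: "(\<Sum>l\<in>A. sum_list (map (\<lambda>x. g l x) ys)) = sum_list (map (\<lambda>x. \<Sum>l\<in>A. g l x) ys)"
      for A :: "nat set" and g :: "nat \<Rightarrow> _ \<Rightarrow> 'a" and ys :: "(('f, 'b) tens \<times> ('f, 'b) tens) list"
      by (induction ys) (simp_all add: sum.distrib)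
    have "conv (T i) (T (l - i)) (tensor_length l t) = sum_list (map (\<lambda>(u, v). br (T i (parity u)) (T (l - i) v)) xs)"
      if "i \<in> {1..<l}" for i l
      using conv_tensor_length[OF t, of i "l - i"] conv_tsum[OF T_lin T_lin xs] that by simp
    then have "(\<Sum>l\<in>{2..<M}. \<Sum>i\<in>{1..<l}. conv (T i) (T (l - i)) (tensor_length l t)) =
       (\<Sum>l\<in>{2..<M}. \<Sum>i\<in>{1..<l}. sum_list (map (\<lambda>(u, v). br (T i (parity u)) (T (l - i) v)) xs))"
      by simp
    also have "\<dots> = sum_list (map (\<lambda>x. \<Sum>l\<in>{2..<M}. \<Sum>i\<in>{1..<l}. case x of (u, v) \<Rightarrow> br (T i (parity u)) (T (l - i) v)) xs)"
      by (simp only: swap)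
    also have "\<dots> = sum_list (map (\<lambda>(u, v). br (\<tau> (parity u)) (\<tau> v)) xs)"
    proof (intro arg_cong[where f = sum_list] map_cong refl, clarify)
      fix u v assume uv: "(u, v) \<in> set xs"
      then have u: "parity u \<in> C" and v: "v \<in> C" using xs(1) H.parity_Sc by auto
      have Nu: "parity u w = 0" if "N \<le> length w" for w using N(1)[OF uv that] by (simp add: parity_def)
      note Nv = N(2)[OF uv]
      have zero: "br (T i (parity u)) (T j v) = 0" if "N \<le> i \<or> N \<le> j" for i j
      proof -
        have "T i (parity u) = 0" if "N \<le> i" using that by (intro T_local[OF u] Nu) simp
        moreover have "T j v = 0" if "N \<le> j" using that by (intro T_local[OF v] Nv) simp
        ultimately show ?thesis using \<open>N \<le> i \<or> N \<le> j\<close> by (auto simp: br_simps)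
      qed
      have "(\<Sum>l\<in>{2..<M}. \<Sum>i\<in>{1..<l}. br (T i (parity u)) (T (l - i) v)) =
          (\<Sum>i\<in>{1..<N}. \<Sum>j\<in>{1..<N}. br (T i (parity u)) (T j v))"
        by (rule sum_antidiagonals[OF zero M])
      also have "\<dots> = (\<Sum>i\<in>{1..<N}. br (T i (parity u)) (\<tau> v))"
        by (simp only: tau_sum[OF v Nv] br_simps(7))
      also have "\<dots> = br (\<tau> (parity u)) (\<tau> v)"
        by (simp only: tau_sum[OF u Nu] br_simps(8))
      finally show "(\<Sum>l\<in>{2..<M}. \<Sum>i\<in>{1..<l}. br (T i (parity u)) (T (l - i) v)) = br (\<tau> (parity u)) (\<tau> v)" .
    qed
    also have "\<dots> = conv \<tau> \<tau> t" by (rule conv_tsum[OF tau_lin tau_lin xs, symmetric])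
    finally show ?thesis ..
  qed
  then show thesis using that by blast
qed

text \<open>Summing the recursions of all parts removes the lengths; what remains is the equation of
  the variety with \<open>\<tau>\<close> in place of the point.\<close>

lemma tau_recursion:
  assumes t: "t \<in> C"
  shows "\<tau> t = nab (corestrict sH (susp GH) t) + s (1 / 2) (h (conv \<tau> \<tau> t))"
proof -
  obtain M where M: "\<And>M'. M \<le> M' \<Longrightarrow>
    conv \<tau> \<tau> t = (\<Sum>l\<in>{2..<M'}. \<Sum>i\<in>{1..<l}. conv (T i) (T (l - i)) (tensor_length l t))"
    using conv_tau[OF t] by blast
  obtain N where N: "\<And>w. N \<le> length w \<Longrightarrow> t w = 0" using bounded_two[OF t t] by blast
  \<comment> \<open>Large enough for both expansions; the \<open>2\<close> allows the part of length
    one to be split off.\<close>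
  define K where "K = max 2 (max M N)"
  have "\<tau> t = (\<Sum>l\<in>{1..<K}. T l t)" using N by (intro tau_sum[OF t]) (simp add: K_def)
  also have "{1..<K} = insert 1 {2..<K}" by (auto simp: K_def)
  also have "(\<Sum>l\<in>insert 1 {2..<K}. T l t) = T 1 t + (\<Sum>l\<in>{2..<K}. T l t)" by (subst sum.insert) auto
  also have "(\<Sum>l\<in>{2..<K}. T l t) =
      (\<Sum>l\<in>{2..<K}. s (1 / 2) (h (\<Sum>i\<in>{1..<l}. conv (T i) (T (l - i)) (tensor_length l t))))"
    by (intro sum.cong refl T_step) simp
  also have "\<dots> = s (1 / 2) (h (conv \<tau> \<tau> t))"
    using M[of K] by (simp add: K_def h.sum V.scale_sum_right)
  finally show ?thesis by (simp add: T_1)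
qed

section \<open>The differential of the homology coalgebra\<close>

text \<open>The corestriction of the summand of the differential that shortens tensors by
  \<open>l - 1\<close>; hence \<open>DD_part j\<close> belongs to
  \<open>theta_part (Suc j)\<close>.\<close>

definition theta_part :: "nat \<Rightarrow> ('f, 'b) tens \<Rightarrow> 'b" where
  "theta_part l t = sH (1 / 2) (p (\<Sum>i\<in>{1..<l}. conv (T i) (T (l - i)) (tensor_length l t)))"

definition \<theta> :: "('f, 'b) tens \<Rightarrow> 'b" where
  "\<theta> t = sH (1 / 2) (p (conv \<tau> \<tau> t))"

lemma theta_lin: "lin_on fscale sH C \<theta>"
  using lin_on_conv[OF tau_lin tau_lin]
  by (auto simp: lin_on_def \<theta>_def p.add p.scale H.scale_right_distrib mult.commute)

lemma theta_part_lin: "lin_on fscale sH C (theta_part l)"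
proof -
  have "lin_on fscale s C (\<lambda>t. \<Sum>i\<in>{1..<l}. conv (T i) (T (l - i)) (tensor_length l t))"
    by (intro lin_on_sum_fun lin_on_conv_length T_lin)
  then show ?thesis
    by (auto simp: lin_on_def theta_part_def p.add p.scale H.scale_right_distrib mult.commute)
qed

lemma theta_part_local: "t \<in> C \<Longrightarrow> (\<And>w. length w = l \<Longrightarrow> t w = 0) \<Longrightarrow> theta_part l t = 0"
proof -
  assume "\<And>w. length w = l \<Longrightarrow> t w = 0"
  then have "tensor_length l t = 0" by (simp add: tensor_length_def fun_eq_iff)
  then show ?thesis
    by (simp only: theta_part_def lin_zero[OF lin_on_conv[OF T_lin T_lin]]) (simp add: p.zero)
qed

lemma half_p_deg: "x \<in> G (n - 2) \<Longrightarrow> sH (1 / 2) (p x) \<in> susp GH (n + - 1)"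
  using p_deg[of x "n - 2"] H.subspace_scale[OF H.subspace_G[of "n - 1"]] by (simp add: susp_def)

lemma theta_deg: "deg_on C (susp GH) (- 1) \<theta>"
  unfolding deg_on_def \<theta>_def
  using half_p_deg[OF conv_deg[OF tau_lin tau_deg tau_lin tau_deg]] by blast

lemma theta_part_deg: "deg_on C (susp GH) (- 1) (theta_part l)"
  unfolding deg_on_def theta_part_def
proof (intro allI ballI impI half_p_deg V.subspace_sum[OF subspace_G])
  fix n t i assume "t \<in> C" "homogeneous n t"
  then show "conv (T i) (T (l - i)) (tensor_length l t) \<in> G (n - 2)"
    by (intro conv_deg T_lin T_deg H.tensor_length_Sc homogeneous_tensor_length)
qed

lemma theta_sum:
  assumes t: "t \<in> C" "\<And>w. N \<le> length w \<Longrightarrow> t w = 0"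
  shows "\<theta> t = (\<Sum>j<N. theta_part (Suc (Suc j)) t)"
proof -
  obtain M where M: "\<And>M'. M \<le> M' \<Longrightarrow>
    conv \<tau> \<tau> t = (\<Sum>l\<in>{2..<M'}. \<Sum>i\<in>{1..<l}. conv (T i) (T (l - i)) (tensor_length l t))"
    using conv_tau[OF t(1)] by blast
  define K where "K = max M N"
  have "\<theta> t = (\<Sum>l\<in>{2..<Suc (Suc K)}. theta_part l t)"
  proof -
    have "conv \<tau> \<tau> t = (\<Sum>l\<in>{2..<Suc (Suc K)}. \<Sum>i\<in>{1..<l}. conv (T i) (T (l - i)) (tensor_length l t))"
      by (rule M) (simp add: K_def)
    then show ?thesis by (simp only: \<theta>_def theta_part_def p.sum H.scale_sum_right)
  qed
  also have "\<dots> = (\<Sum>j\<in>{0..<K}. theta_part (Suc (Suc j)) t)"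
    by (simp only: numeral_2_eq_2 sum.shift_bounds_Suc_ivl)
  also have "\<dots> = (\<Sum>j<N. theta_part (Suc (Suc j)) t)"
  proof (rule sum.mono_neutral_right)
    show "\<forall>i\<in>{0..<K} - {..<N}. theta_part (Suc (Suc i)) t = 0"
      using t by (auto intro!: theta_part_local)
  qed (auto simp: K_def)
  finally show ?thesis .
qed

lemma coderiv_theta_part: "2 \<le> l \<Longrightarrow> coderiv sH (susp GH) (theta_part l)"
proof unfold_locales
  fix t assume "2 \<le> l" and t: "t \<in> C" "\<And>w. w \<noteq> [] \<Longrightarrow> t w = 0"
  then show "theta_part l t = 0" by (intro theta_part_local t) auto
qed (rule theta_part_lin theta_part_deg)+

text \<open>\<open>coder_at\<close> is additive in the corestriction, and on a tensor of bounded
  length almost all \<open>theta_part\<close> vanish; so the sum of the coderivations is the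
  coderivation of the summed corestriction.\<close>

lemma DD_eq:
  assumes t: "t \<in> C"
  shows "DD s br sH GH nab p h t = coder_map sH (susp GH) \<theta> t"
proof -
  obtain N where N: "\<And>w. N \<le> length w \<Longrightarrow> t w = 0" using bounded_two[OF t t] by blast
  have part: "DD_part s br sH GH nab p h (Suc j) t = coder_map sH (susp GH) (theta_part (Suc (Suc j))) t" for j
  proof -
    interpret coderiv sH "susp GH" "theta_part (Suc (Suc j))" by (rule coderiv_theta_part) simp
    show ?thesis
      using coder_lift_eq[OF t] unfolding DD_part_def theta_part_def[abs_def] .
  qed
  have zero: "coder_map sH (susp GH) (theta_part (Suc (Suc j))) t = 0" if "N \<le> j" for j
  proof
    fix w
    have "coder_at sH (susp GH) (theta_part (Suc (Suc j))) w t = coder_at sH (susp GH) (\<lambda>u. 0) w t"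
      using that by (intro H.coder_at_cong[OF _ t N] theta_part_local) auto
    also have "\<dots> = 0" by (induction w arbitrary: t) (auto simp: H.hdual_simps)
    finally show "coder_map sH (susp GH) (theta_part (Suc (Suc j))) t w = 0 w" by (simp add: coder_map_def)
  qed
  have "DD s br sH GH nab p h t = (\<Sum>j<N. coder_map sH (susp GH) (theta_part (Suc (Suc j))) t)"
    unfolding DD_def part
  proof (rule Sum_any.expand_superset)
    show "{j. coder_map sH (susp GH) (theta_part (Suc (Suc j))) t \<noteq> 0} \<subseteq> {..<N}"
      using zero by (auto simp: not_less[symmetric] simp del: not_less)
  qed simp
  also have "\<dots> = coder_map sH (susp GH) \<theta> t"
  proof
    fix w
    have "(\<Sum>j<N. coder_map sH (susp GH) (theta_part (Suc (Suc j))) t) w =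
        coder_at sH (susp GH) (\<lambda>u. \<Sum>j<N. theta_part (Suc (Suc j)) u) w t"
      unfolding sum_fun_apply coder_map_def by (rule coder_at_sum[OF H.grsp_axioms]) simp
    also have "\<dots> = coder_at sH (susp GH) \<theta> w t"
    proof (rule H.coder_at_cong[OF _ t N])
      show "(\<Sum>j<N. theta_part (Suc (Suc j)) u) = \<theta> u" if "u \<in> C" "\<And>w. N \<le> length w \<Longrightarrow> u w = 0" for u
        using theta_sum[OF that] by simp
    qed
    finally show "(\<Sum>j<N. coder_map sH (susp GH) (theta_part (Suc (Suc j))) t) w = coder_map sH (susp GH) \<theta> t w"
      by (simp add: coder_map_def)
  qed
  finally show ?thesis .
qed

end

section \<open>The formal inverse of the projection to the tangent space\<close>

context twisting
begin

abbreviation Sv where "Sv \<equiv> Sc sH (susp GH) (susp GH 0)"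
abbreviation SV where "SV \<equiv> Sc s (susp G) (susp G 0)"
abbreviation F where "F \<equiv> lift_map s (susp G) \<tau>"
abbreviation cor where "cor \<equiv> corestrict s (susp G)"
abbreviation Scpi where "Scpi \<equiv> Sc_map sH (susp GH) p"

lemma Sv_C: "t \<in> Sv \<Longrightarrow> t \<in> C"
  using H.Sc_mono[of "susp GH 0" UNIV] by auto

sublocale Sv: coalg "Sc sH (susp GH) (susp GH 0)" by unfold_locales (rule H.subcoalgebra_Sc)
sublocale SV: coalg "Sc s (susp G) (susp G 0)" by unfold_locales (rule V.subcoalgebra_Sc)

sublocale LC: colift "Sc sH (susp GH) UNIV" s "susp G" "tau s br sH GH nab h"
  by unfold_locales (use H.Sc_bounded tau_lin tau_unit in auto)

sublocale L0: colift "Sc sH (susp GH) (susp GH 0)" s "susp G" "tau s br sH GH nab h"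
  by unfold_locales (use Sv_C H.Sc_bounded tau_unit lin_on_subset[OF tau_lin H.Sc_mono] in auto)

subsection \<open>Independence of the bracket\<close>

text \<open>The two brackets differ by \<open>d h\<close>, and every step of the recursion ends with
  \<open>h\<close>; so \<open>h d h = h\<close> absorbs the difference.\<close>

lemma tau_part_a: "t \<in> C \<Longrightarrow> tau_part s (bracket_a d h br) sH GH nab h l t = T l t"
proof (induction l arbitrary: t rule: less_induct)
  case (less l)
  consider "l = 0" | "l = Suc 0" | "2 \<le> l" by linarith
  then show ?case
  proof cases
    case 3
    let ?Ta = "tau_part s (bracket_a d h br) sH GH nab h"
    have u: "tensor_length l t \<in> C" by (rule H.tensor_length_Sc[OF less.prems])
    have conv_a: "conv_bracket C (bracket_a d h br) (?Ta i) (?Ta (l - i)) (tensor_length l t) =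
        d (h (conv (T i) (T (l - i)) (tensor_length l t)))" if i: "i \<in> {1..<l}" for i
    proof -
      obtain xs where xs: "set xs \<subseteq> C \<times> C" "diag (tensor_length l t) = tsum xs" using u by (rule C.diag_tsum)
      have eq: "?Ta i x = T i x" "?Ta (l - i) x = T (l - i) x" if "x \<in> C" for x
        using i by (auto intro!: less.IH that)
      let ?b = "\<lambda>x y. bracket_a d h br (?Ta i (parity x)) (?Ta (l - i) y)"
      have bil: "bilin_on s C C ?b"
      proof (rule bilin_onI)
        show "lin_on fscale s C (\<lambda>x. ?b x y)" if "y \<in> C" for y
          by (rule lin_on_cong[OF _ C.subspace fs.vector_space_axioms,
                of s "\<lambda>x. d (h (br (T i (parity x)) (T (l - i) y)))"])
            (use bilin_conv[OF T_lin[of i] T_lin[of "l - i"]] that in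
              \<open>auto simp: bilin_on_def lin_on_def d.add d.scale h.add h.scale bracket_a_def eq H.parity_Sc\<close>)
        show "lin_on fscale s C (?b x)" if "x \<in> C" for x
          by (rule lin_on_cong[OF _ C.subspace fs.vector_space_axioms,
                of s "\<lambda>y. d (h (br (T i (parity x)) (T (l - i) y)))"])
            (use bilin_conv[OF T_lin[of i] T_lin[of "l - i"]] that in
              \<open>auto simp: bilin_on_def lin_on_def d.add d.scale h.add h.scale bracket_a_def eq H.parity_Sc\<close>)
      qed
      have "conv_bracket C (bracket_a d h br) (?Ta i) (?Ta (l - i)) (tensor_length l t) =
          sum_list (map (\<lambda>(x, y). ?b x y) xs)"
        unfolding conv_bracket_def by (rule C.tlift_diag[OF bil V.vector_space_axioms xs])
      also have "\<dots> = sum_list (map (\<lambda>i'. d (h (case i' of (x, y) \<Rightarrow> br (T i (parity x)) (T (l - i) y)))) xs)"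
        using xs(1) H.parity_Sc
        by (intro arg_cong[where f = sum_list] map_cong) (auto simp: bracket_a_def eq)
      also have "\<dots> = d (h (sum_list (map (\<lambda>(x, y). br (T i (parity x)) (T (l - i) y)) xs)))"
        by (induction xs) (simp_all add: d.add h.add d.zero h.zero)
      finally show ?thesis using conv_tsum[OF T_lin T_lin xs] by simp
    qed
    have "?Ta l t = s (1 / 2) (h (\<Sum>i\<in>{1..<l}. conv_bracket C (bracket_a d h br) (?Ta i) (?Ta (l - i)) (tensor_length l t)))"
      using 3 by (subst tau_part.simps) simp
    also have "\<dots> = s (1 / 2) (\<Sum>i\<in>{1..<l}. h (conv (T i) (T (l - i)) (tensor_length l t)))"
      by (simp add: conv_a h.sum hdh)
    also have "\<dots> = T l t" by (simp add: T_step[OF 3] h.sum)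
    finally show ?thesis .
  qed (subst (1 2) tau_part.simps, simp)+
qed

lemma tau_a: "t \<in> C \<Longrightarrow> tau s (bracket_a d h br) sH GH nab h t = \<tau> t"
  by (simp add: tau_def tau_part_a)

text \<open>The recursion of \<open>lift_at\<close> evaluates the cochain only on elements of
  \<open>C\<close>, where the cochains of both brackets agree.\<close>

lemma tau_bar_eq:
  assumes t: "t \<in> C"
  shows "tau_bar s G d br sH GH nab h t = F t"
proof -
  let ?ta = "tau s (bracket_a d h br) sH GH nab h"
  have lin: "lin_on fscale s C ?ta"
    by (rule lin_on_cong[OF tau_lin C.subspace fs.vector_space_axioms]) (rule tau_a[symmetric])
  have "colift C s (susp G) ?ta"
    by unfold_locales (use lin H.Sc_bounded tau_a tau_unit in auto)
  moreover have "deg_on C (susp G) 0 ?ta"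
    using tau_deg tau_a by (auto simp: deg_on_def)
  ultimately have "tau_bar s G d br sH GH nab h t = lift_map s (susp G) ?ta t"
    unfolding tau_bar_def using coalgebra_lift_eq[OF H.grsp_axioms _ _ t] by blast
  also have "lift_at s (susp G) ?ta w t = lift_at s (susp G) \<tau> w t" if "t \<in> C" for w t
    using that
  proof (induction w arbitrary: t)
    case (Cons a w)
    have "lift_at s (susp G) ?ta w (\<lambda>z'. t (z @ z')) = lift_at s (susp G) \<tau> w (\<lambda>z'. t (z @ z'))" for z
      by (rule Cons.IH) (rule C.row_in[OF Cons.prems])
    then show ?case using tau_a[OF LC.lift_inner_in[OF Cons.prems]] by simp
  qed simp
  from this[OF t] have "lift_map s (susp G) ?ta t = F t" by (simp add: lift_map_def)
  finally show ?thesis .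
qed

subsection \<open>The defining equations on the symmetric coalgebra\<close>

lemma tau_in: "t \<in> Sv \<Longrightarrow> \<tau> t \<in> susp G 0"
  using tau_deg H.homogeneous_0 Sv_C by (force simp: deg_on_def)

lemma F_in_SV:
  assumes t: "t \<in> Sv" shows "F t \<in> SV"
proof -
  have "\<tau> ` Sv \<subseteq> susp G 0" using tau_in by auto
  then have "F t \<in> tens_span s (susp G) (susp G 0)" by (rule L0.lift_map_tens_span[OF t])
  moreover have "graded_symmetric (F t)"
    by (rule graded_symmetric_lift_map[OF H.grsp_axioms LC.colift_axioms tau_deg Sv_C[OF t]])
  ultimately show ?thesis by (simp add: Sc_iff)
qed

text \<open>Twice the map \<open>Q\<close> of the quadratic form: on \<open>v \<otimes> v\<close> it
  gives \<open>br v v\<close>, and the factor one half is placed in \<open>Mh\<close> and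
  \<open>Jh\<close>.\<close>

definition Qh :: "('f, 'a) tens \<Rightarrow> 'a" where
  "Qh t = tlift SV SV (\<lambda>x y. br (cor x) (cor y)) (diag t)"

lemma bilin_cor: "bilin_on s SV SV (\<lambda>x y. br (cor x) (cor y))"
  using lin_on_add[OF V.lin_on_corestrict] lin_on_scale[OF V.lin_on_corestrict]
  by (intro bilin_onI lin_onI) (simp_all add: br_simps)

lemma Qh_lin: "lin_on fscale s SV Qh"
  unfolding Qh_def[abs_def] by (rule SV.lin_on_tlift[OF bilin_cor V.vector_space_axioms])

lemma Qh_tsum: "set xs \<subseteq> SV \<times> SV \<Longrightarrow> diag t = tsum xs \<Longrightarrow> Qh t = sum_list (map (\<lambda>(x, y). br (cor x) (cor y)) xs)"
  unfolding Qh_def by (rule SV.tlift_diag[OF bilin_cor V.vector_space_axioms])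

lemma Qh_tpower:
  assumes v: "v \<in> susp G 0"
  shows "Qh (V.tpower j v) = (if j = 2 then br v v else 0)"
proof -
  let ?xs = "map (\<lambda>i. (V.tpower i v, V.tpower (j - i) v)) [0..<Suc j]"
  have "diag (V.tpower j v) = tsum ?xs"
    unfolding V.diag_pure_tensor by (rule arg_cong[where f = tsum]) (auto simp: min_def)
  moreover have "set ?xs \<subseteq> SV \<times> SV" unfolding set_map using V.tpower_in_Sc[OF v] by blast
  ultimately have "Qh (V.tpower j v) = sum_list (map (\<lambda>(x, y). br (cor x) (cor y)) ?xs)"
    by (intro Qh_tsum)
  also have "\<dots> = (\<Sum>i\<in>{0..<Suc j}. br (cor (V.tpower i v)) (cor (V.tpower (j - i) v)))"
    by (simp only: map_map o_def case_prod_conv interv_sum_list_conv_sum_set_nat set_upt)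
  also have "\<dots> = (\<Sum>i\<in>{0..<Suc j}. if i = 1 then (if j = 2 then br v v else 0) else 0)"
    by (rule sum.cong) (auto simp: V.corestrict_pure br_simps)
  also have "\<dots> = (if j = 2 then br v v else 0)" by auto
  finally show ?thesis .
qed

text \<open>The adjoint is comultiplicative with corestriction \<open>\<tau>\<close>, and in degree
  zero the sign of the convolution bracket is trivial.\<close>

lemma Qh_F:
  assumes t: "t \<in> Sv" shows "Qh (F t) = conv \<tau> \<tau> t"
proof -
  obtain xs where xs: "set xs \<subseteq> Sv \<times> Sv" "diag t = tsum xs" using t by (rule Sv.diag_tsum)
  let ?ys = "map (\<lambda>(x, y). (F x, F y)) xs"
  have "diag (F t) = sum_list (map (\<lambda>(x, y). tprod (F x) (F y)) xs)"
    unfolding L0.diag_lift_map[OF t]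
    by (rule Sv.tlift_diag[OF bilin_on_tprod[OF L0.lin_on_lift_map L0.lin_on_lift_map] vector_space_fscale xs])
  then have "diag (F t) = tsum ?ys" by (simp add: tsum_def case_prod_unfold o_def)
  moreover have "set ?ys \<subseteq> SV \<times> SV" using xs(1) F_in_SV by auto
  ultimately have "Qh (F t) = sum_list (map (\<lambda>(x, y). br (cor x) (cor y)) ?ys)" by (intro Qh_tsum)
  also have "\<dots> = sum_list (map (\<lambda>(x, y). br (\<tau> (parity x)) (\<tau> y)) xs)"
    unfolding map_map using xs(1)
    by (intro arg_cong[where f = sum_list] map_cong) (auto simp: L0.corestrict_lift_map H.parity_0)
  also have "\<dots> = conv \<tau> \<tau> t"
    using xs Sv_C by (intro conv_tsum[OF tau_lin tau_lin, symmetric]) auto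
  finally show ?thesis .
qed

lemma cor_in: "t \<in> SV \<Longrightarrow> cor t \<in> G (- 1)"
  using V.corestrict_in[OF _ V.subspace_G, of t 0] by (simp add: susp_def)

lemma Qh_in:
  assumes t: "t \<in> SV" shows "Qh t \<in> G (- 2)"
proof -
  obtain xs where xs: "set xs \<subseteq> SV \<times> SV" "diag t = tsum xs" using t by (rule SV.diag_tsum)
  have "br (cor x) (cor y) \<in> G (- 2)" if "x \<in> SV" "y \<in> SV" for x y
    using br_deg[OF cor_in[OF that(1)] cor_in[OF that(2)]] by simp
  then have "sum_list (map (\<lambda>(x, y). br (cor x) (cor y)) xs) \<in> G (- 2)"
    using xs(1) by (induction xs) (auto simp: V.subspace_0[OF subspace_G] intro: V.subspace_add[OF subspace_G])
  then show ?thesis using Qh_tsum[OF xs] by simp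
qed

text \<open>In the linear term of \<open>M_map\<close> the signs of the suspended \<open>h\<close>
  and \<open>d\<close> cancel; in the quadratic term three signs leave a minus, and
  \<open>h d h\<close> is shortened to \<open>h\<close>.\<close>

definition Mh :: "('f, 'a) tens \<Rightarrow> 'a" where
  "Mh t = h (d (cor t)) - s (1 / 2) (h (Qh t))"

definition Jh :: "('f, 'a) tens \<Rightarrow> 'a" where
  "Jh t = s (1 / 2) (Qh t) - d (cor t)"

lemma Mh_lin: "lin_on fscale s SV Mh"
  using V.lin_on_corestrict[of "susp G 0"] Qh_lin
  by (auto simp: lin_on_def Mh_def d.add d.scale h.add h.scale V.scale_right_distrib V.scale_right_diff_distrib mult.commute)

lemma Jh_lin: "lin_on fscale s SV Jh"
  using V.lin_on_corestrict[of "susp G 0"] Qh_lin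
  by (auto simp: lin_on_def Jh_def d.add d.scale V.scale_right_distrib V.scale_right_diff_distrib mult.commute)

text \<open>In the top degree \<open>-1\<close> the homotopy vanishes, so one term of the homotopy
  identity drops out; in the bottom degree \<open>-2\<close> it is \<open>d\<close> that
  vanishes.\<close>

lemma hd_deg: "x \<in> G (- 1) \<Longrightarrow> h (d x) = x - nab (p x)"
proof -
  assume "x \<in> G (- 1)"
  then have "h x \<in> G 0" using h_deg by fastforce
  then have "h x = 0" using conc by (simp add: concentrated_def)
  then show ?thesis using identities(5)[of x] by (simp add: d.zero)
qed

lemma dh_deg: "x \<in> G (- 2) \<Longrightarrow> d (h x) = x - nab (p x)"
proof -
  assume "x \<in> G (- 2)"
  then have "d x \<in> G (- 3)" using d_deg by fastforce
  then have "d x = 0" using conc by (simp add: concentrated_def)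
  then show ?thesis using identities(5)[of x] by (simp add: h.zero)
qed

text \<open>Replacing \<open>h d\<close> by \<open>Id - \<nabla> \<pi>\<close> brings the equation
  into the fixed-point form of \<open>tau_recursion\<close>.\<close>

lemma Mh_zero_iff:
  assumes "t \<in> SV" shows "Mh t = 0 \<longleftrightarrow> cor t = nab (p (cor t)) + s (1 / 2) (h (Qh t))"
  unfolding Mh_def hd_deg[OF cor_in[OF assms]] by (simp add: diff_eq_eq add.commute)

text \<open>Along the splitting of the target into boundaries and homology, \<open>h\<close> detects
  the first component of \<open>Jh t\<close> and \<open>p\<close> the second; conversely
  \<open>d\<close> and \<open>nab\<close> reassemble \<open>Jh t\<close> from them.\<close>

lemma Jh_zero_iff:
  assumes t: "t \<in> SV" shows "Jh t = 0 \<longleftrightarrow> Mh t = 0 \<and> p (Qh t) = 0"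
proof -
  have M: "Mh t = - h (Jh t)" by (simp add: Mh_def Jh_def h.diff h.scale)
  have P: "p (Jh t) = sH (1 / 2) (p (Qh t))" by (simp add: Jh_def p.diff p.scale identities)
  have dhd: "d (h (d (cor t))) = d (cor t)" using hd_deg[OF cor_in[OF t]] by (simp add: d.diff identities)
  have J: "Jh t = s (1 / 2) (nab (p (Qh t))) - d (Mh t)"
    by (simp add: Jh_def Mh_def d.diff d.scale dhd dh_deg[OF Qh_in[OF t]] V.scale_right_diff_distrib)
  show ?thesis
  proof
    assume "Jh t = 0"
    then show "Mh t = 0 \<and> p (Qh t) = 0" using M P by (simp add: h.zero p.zero)
  next
    assume "Mh t = 0 \<and> p (Qh t) = 0"
    then show "Jh t = 0" using J by (simp add: d.zero nab.zero)
  qed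
qed

text \<open>With corestriction \<open>\<tau>\<close> and quadratic term
  \<open>conv \<tau> \<tau>\<close>, the fixed-point form of the equation is the recursion of
  \<open>\<tau>\<close>, since \<open>p (\<tau> t)\<close> is the corestriction of
  \<open>t\<close>.\<close>

lemma Mh_F: "t \<in> Sv \<Longrightarrow> Mh (F t) = 0"
proof -
  assume t: "t \<in> Sv"
  have c: "corestrict sH (susp GH) t = p (\<tau> t)"
    using tau_recursion[OF Sv_C[OF t]] by (metis add.right_neutral identities(4,6) p.add p.scale H.scale_zero_right)
  show ?thesis
    unfolding Mh_zero_iff[OF F_in_SV[OF t]] Qh_F[OF t] L0.corestrict_lift_map[OF t]
    using tau_recursion[OF Sv_C[OF t]] c by simp
qed

section \<open>The coalgebras as solution sets of equations on rows\<close>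

definition CM :: "('f, 'a) tens set" where
  "CM = {t \<in> SV. \<forall>x. Mh (\<lambda>z. t (x @ z)) = 0}"

definition CV :: "('f, 'a) tens set" where
  "CV = {t \<in> SV. \<forall>x. Jh (\<lambda>z. t (x @ z)) = 0}"

definition Ck :: "('f, 'b) tens set" where
  "Ck = {t \<in> Sv. \<forall>x. \<theta> (\<lambda>z. t (x @ z)) = 0}"

lemma subcoalgebra_CM: "subcoalgebra CM"
  unfolding CM_def by (rule V.Sc_0_subcoalgebra_rows[OF Mh_lin V.vector_space_axioms])

lemma subcoalgebra_CV: "subcoalgebra CV"
  unfolding CV_def by (rule V.Sc_0_subcoalgebra_rows[OF Jh_lin V.vector_space_axioms])

lemma subcoalgebra_Ck: "subcoalgebra Ck"
  unfolding Ck_def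
  by (rule H.Sc_0_subcoalgebra_rows[OF lin_on_subset[OF theta_lin H.Sc_mono[OF subset_UNIV]] H.vector_space_axioms])

sublocale CM: coalg CM by unfold_locales (rule subcoalgebra_CM)

lemma CM_SV: "t \<in> CM \<Longrightarrow> t \<in> SV"
  by (simp add: CM_def)

lemma CV_iff: "t \<in> CV \<longleftrightarrow> t \<in> CM \<and> (\<forall>x. p (Qh (\<lambda>z. t (x @ z))) = 0)"
  using Jh_zero_iff[OF SV.row_in] by (auto simp: CV_def CM_def)

lemma coord_coalgebra_M:
  assumes "generators s (susp G 0) (zero_locus_ideal s (susp G 0) (M_map s d br h)) Y"
  shows "coord_coalgebra s (susp G) (susp G 0) Y = CM"
proof -
  have "t \<in> coord_coalgebra s (susp G) (susp G 0) Y \<longleftrightarrow> t \<in> SV \<and> (\<forall>x. Mh (\<lambda>z. t (x @ z)) = 0)" for t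
  proof (rule V.coord_coalgebra_zero_locus[OF assms, of "\<lambda>v. h (d v)" "\<lambda>v. - h (s (1 / 2) (br v v))"])
    show "M_map s d br h v = h (d v) + - h (s (1 / 2) (br v v))" for v
      by (simp add: M_map_def susp_odd_def quad_def d.neg h.neg hdh)
    show "Mh (V.tpower j v) = (if j = 1 then h (d v) else if j = 2 then - h (s (1 / 2) (br v v)) else 0)"
      if "v \<in> susp G 0" for j v
      using Qh_tpower[OF that, of j] by (simp add: Mh_def V.corestrict_pure h.zero d.zero h.scale)
  qed (simp_all add: d.scale h.scale br_simps power2_eq_square Mh_lin mult.commute mult.left_commute)
  then show ?thesis by (auto simp: CM_def)
qed

lemma coord_coalgebra_V:
  assumes "generators s (susp G 0) (zero_locus_ideal s (susp G 0) (J_map s d br)) Y"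
  shows "coord_coalgebra s (susp G) (susp G 0) Y = CV"
proof -
  have "t \<in> coord_coalgebra s (susp G) (susp G 0) Y \<longleftrightarrow> t \<in> SV \<and> (\<forall>x. Jh (\<lambda>z. t (x @ z)) = 0)" for t
  proof (rule V.coord_coalgebra_zero_locus[OF assms, of "\<lambda>v. - d v" "\<lambda>v. s (1 / 2) (br v v)"])
    show "J_map s d br v = - d v + s (1 / 2) (br v v)" for v
      by (simp add: J_map_def susp_odd_def quad_def)
    show "Jh (V.tpower j v) = (if j = 1 then - d v else if j = 2 then s (1 / 2) (br v v) else 0)"
      if "v \<in> susp G 0" for j v
      using Qh_tpower[OF that, of j] by (simp add: Jh_def V.corestrict_pure d.zero)
  qed (simp_all add: d.scale br_simps power2_eq_square Jh_lin mult.commute mult.left_commute)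
  then show ?thesis by (auto simp: CV_def)
qed

text \<open>Each term of the differential applies \<open>\<theta>\<close> to \<open>t\<close> with
  letters fixed on both sides, which is a row by permutation invariance. Conversely, a final letter
  of degree \<open>-1\<close> isolates the value of \<open>\<theta>\<close> on a single row.\<close>

lemma kuranishi_eq: "kuranishi_coalgebra s br sH GH nab p h = Ck"
proof -
  have "DD s br sH GH nab p h t = 0 \<longleftrightarrow> (\<forall>x. \<theta> (\<lambda>z. t (x @ z)) = 0)" if t: "t \<in> Sv" for t
  proof -
    have theta0: "\<theta> (\<lambda>z. 0) = 0"
      using lin_on_zero[OF theta_lin C.subspace fs.vector_space_axioms H.vector_space_axioms] by (simp add: zero_fun_def)
    have coder0: "coder_at sH (susp GH) \<theta> w (\<lambda>z. 0) = 0" for w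
      by (induction w) (auto simp: theta0 H.hdual_simps)
    have "coder_at sH (susp GH) \<theta> w (\<lambda>z. t (x @ z)) = 0" if "\<forall>x. \<theta> (\<lambda>z. t (x @ z)) = 0" for w x
    proof (induction w arbitrary: x)
      case (Cons a w)
      have "(\<lambda>z. t (x @ z @ w)) = (\<lambda>z. t ((x @ w) @ z))"
        by (rule ext) (rule H.Sc_0_perm[OF t], simp)
      then have "\<theta> (\<lambda>z. t (x @ z @ w)) = 0" using that by metis
      moreover have "coder_at sH (susp GH) \<theta> w (\<lambda>z. t ((x @ [a]) @ z)) = 0" by (rule Cons)
      ultimately show ?case by (auto simp: H.hdual_simps)
    qed simp
    from this[of _ "[]"] have "coder_map sH (susp GH) \<theta> t = 0" if "\<forall>x. \<theta> (\<lambda>z. t (x @ z)) = 0"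
      using that by (simp add: coder_map_def fun_eq_iff)
    moreover have "\<theta> (\<lambda>z. t (x @ z)) = 0" if D: "coder_map sH (susp GH) \<theta> t = 0" for x
    proof (rule H.hdual_separating)
      fix n \<phi> assume \<phi>: "\<phi> \<in> hdual sH (susp GH) n"
      have row: "(\<lambda>z. t (x @ z)) \<in> Sv" by (rule Sv.row_in[OF t])
      show "\<phi> (\<theta> (\<lambda>z. t (x @ z))) = \<phi> 0"
      \<comment> \<open>On tensors of degree zero \<open>\<theta>\<close> takes values in degree
        \<open>-1\<close>, so functionals of other degrees give zero.\<close>
      proof (cases "n = - 1")
        case False
        have "\<theta> (\<lambda>z. t (x @ z)) \<in> susp GH (0 + - 1)"
          using theta_deg Sv_C[OF row] H.homogeneous_0[OF row] unfolding deg_on_def by blast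
        then show ?thesis using H.hdual_zero[OF \<phi>] False by (simp add: H.hdual_simps(3)[OF \<phi>])
      next
        case True
        \<comment> \<open>\<open>t\<close> vanishes on words with a letter of nonzero degree, so
          only the term in which \<open>\<theta>\<close> hits the last letter survives.\<close>
        have "t (z @ [(n, \<phi>)]) = 0" for z
          using H.tens_span_degree_0[of t "z @ [(n, \<phi>)]"] t True by (auto simp: Sc_iff)
        then have "coder_at sH (susp GH) \<theta> x (\<lambda>z. t (z @ [(n, \<phi>)])) = 0" by (simp add: coder0)
        moreover have "coder_at sH (susp GH) \<theta> (x @ [(n, \<phi>)]) t = 0"
          using fun_cong[OF D, of "x @ [(n, \<phi>)]"] by (simp add: coder_map_def)
        ultimately have "koszul (wdeg x) * \<phi> (\<theta> (\<lambda>z. t (x @ z))) = 0"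
          using \<phi> by (simp add: coder_at_append)
        then show ?thesis by (simp add: H.hdual_simps(3)[OF \<phi>] koszul_def split: if_splits)
      qed
    qed
    ultimately show ?thesis using DD_eq[OF Sv_C[OF t]] by auto
  qed
  then show ?thesis by (auto simp: kuranishi_coalgebra_def Ck_def)
qed

subsection \<open>The two maps are mutually inverse\<close>

lemma row_F: "t \<in> Sv \<Longrightarrow> (\<lambda>z. F t (x @ z)) = F (\<lambda>y. lift_at s (susp G) \<tau> x (\<lambda>z. t (z @ y)))"
  by (rule L0.row_lift_map)

lemma row_F_in: "t \<in> Sv \<Longrightarrow> (\<lambda>y. lift_at s (susp G) \<tau> x (\<lambda>z. t (z @ y))) \<in> Sv"
  by (rule Sv.partial_column_in[OF _ L0.lin_on_lift_at])

lemma F_in_CM: "t \<in> Sv \<Longrightarrow> F t \<in> CM"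
  using F_in_SV Mh_F row_F row_F_in by (simp add: CM_def)

section \<open>The projection on symmetric coalgebras and the two composites\<close>

lemma p_lin: "Vector_Spaces.linear s sH p" and p_deg0: "degree_map (susp G) (susp GH) 0 p"
  using contr by (auto simp: contraction_def degree_map_def susp_def)

lemma Scpi_in: "t \<in> SV \<Longrightarrow> Scpi t \<in> Sv"
  using p_deg by (intro Sc_map_in_Sc[OF V.grsp_axioms H.grsp_axioms p_lin p_deg0]) (auto simp: susp_def)

lemma p_tau: "t \<in> Sv \<Longrightarrow> p (\<tau> t) = corestrict sH (susp GH) t"
  using tau_recursion[OF Sv_C, of t] by (metis add.right_neutral identities(4,6) p.add p.scale H.scale_zero_right)

lemma pull_hdual: "\<psi> \<in> hdual sH (susp GH) n \<Longrightarrow> \<psi> \<circ> p \<in> hdual s (susp G) n"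
  using p_lin p_deg0 unfolding hdual_def degree_map_def
  by (auto simp: image_subset_iff intro: Vector_Spaces.linear_compose)

text \<open>Since \<open>p \<circ> \<tau>\<close> is the corestriction, each step of
  \<open>lift_at\<close> at a letter pulled back along \<open>p\<close> reads off one letter of
  \<open>t\<close>.\<close>

lemma Scpi_F:
  assumes t: "t \<in> Sv" shows "Scpi (F t) = t"
proof -
  have "lift_at s (susp G) \<tau> (pull p w) t = t w" if "hword sH (susp GH) w" "t \<in> Sv" for w t
    using that
  proof (induction w arbitrary: t)
    case (Cons a w)
    have a: "snd a \<in> hdual sH (susp GH) (fst a)" using Cons.prems(1) by simp
    have "lift_at s (susp G) \<tau> (pull p w) (\<lambda>z'. t (z @ z')) = t (z @ w)" for z
      using Cons.prems by (intro Cons.IH Sv.row_in) auto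
    then have "lift_at s (susp G) \<tau> (pull p (a # w)) t = snd a (p (\<tau> (\<lambda>z. t (z @ w))))"
      using pull_hdual[OF a] by simp
    also have "\<dots> = t (a # w)"
      using p_tau[OF Sv.column_in[OF Cons.prems(2)]] H.corestrict_apply[OF Sv.column_in[OF Cons.prems(2)] a] by simp
    finally show ?case .
  qed simp
  then show ?thesis
    using t H.Sc_hword[OF t] by (auto simp: Sc_map_pull lift_map_def fun_eq_iff)
qed

lemma pure_Nil_in_CM: "pure_tensor s (susp G) [] \<in> CM"
proof -
  have "Mh (pure_tensor s (susp G) []) = 0"
    using Qh_tpower[of 0 0] V.subspace_0[OF V.subspace_G] by (simp add: Mh_def V.corestrict_pure h.zero d.zero)
  moreover have "Mh (\<lambda>z. 0) = 0"
    using lin_on_zero[OF Mh_lin SV.subspace fs.vector_space_axioms V.vector_space_axioms] by (simp add: zero_fun_def)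
  moreover have "(\<lambda>z. pure_tensor s (susp G) [] (x @ z)) = (if x = [] then pure_tensor s (susp G) [] else (\<lambda>z. 0))" for x
    by (auto simp: pure_tensor_Nil)
  ultimately show ?thesis using V.pure_Nil_in_Sc by (simp add: CM_def)
qed

text \<open>
  Both sides satisfy the recursion that the equation of the variety amounts to; induct on the length
  of the components.
\<close>

lemma tau_Scpi:
  assumes "t \<in> CM" "\<And>w. N \<le> length w \<Longrightarrow> t w = 0"
  shows "\<tau> (Scpi t) = cor t"
  using assms
proof (induction N arbitrary: t)
  case 0
  then have "t = 0" by (simp add: fun_eq_iff)
  moreover have "Scpi 0 = 0" by (simp add: Sc_map_pull fun_eq_iff)
  moreover have "\<tau> 0 = 0" by (rule lin_zero[OF tau_lin])
  moreover have "cor 0 = 0" by (rule V.corestrict_eqI) (simp add: V.hdual_simps)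
  ultimately show ?case by metis
next
  case (Suc N)
  let ?e = "pure_tensor s (susp G) []"
  let ?b = "\<lambda>x y. br (\<tau> (Scpi x)) (\<tau> (Scpi y))"
  have tS: "lin_on fscale s CM (\<lambda>x. \<tau> (Scpi x))"
    using lin_on_add[OF tau_lin] lin_on_scale[OF tau_lin] lin_on_Sc_map[of UNIV sH "susp GH" p] Sv_C Scpi_in CM_SV
    by (intro lin_onI) (simp_all add: lin_on_def)
  have b: "bilin_on s CM CM ?b"
    using lin_on_add[OF tS] lin_on_scale[OF tS] by (intro bilin_onI lin_onI) (simp_all add: br_simps)
  have sub: "CM \<subseteq> SV" by (auto simp: CM_SV)
  have b': "bilin_on s CM CM (\<lambda>x y. br (cor x) (cor y))" by (rule bilin_on_subset[OF bilin_cor sub sub])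
  have cor_e: "cor ?e = 0" by (simp add: V.corestrict_pure)
  have tau_e: "\<tau> (Scpi ?e) = 0"
    by (rule tau_unit) (use Scpi_in CM_SV pure_Nil_in_CM Sv_C in \<open>auto simp: Sc_map_pull pure_tensor_Nil pull_def\<close>)
  \<comment> \<open>Both bilinear maps vanish when one argument is the unit, so only the reduced
    diagonal counts, and its factors are short enough for the induction hypothesis.\<close>
  have eq: "tlift CM CM ?b (diag t) = tlift CM CM (\<lambda>x y. br (cor x) (cor y)) (diag t)"
    by (rule CM.tlift_reduced[OF V.vector_space_axioms b b' pure_tensor_Nil pure_Nil_in_CM _ _ _ _ _ Suc.prems])
      (simp_all add: cor_e tau_e br_simps Suc.IH)
  also have "\<dots> = Qh t"
    unfolding Qh_def by (rule SV.tlift_smaller[OF subcoalgebra_CM sub Suc.prems(1) bilin_cor V.vector_space_axioms])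
  finally have Q: "tlift CM CM ?b (diag t) = Qh t" .
  obtain xs where xs: "set xs \<subseteq> CM \<times> CM" "diag t = tsum xs" using Suc.prems(1) by (rule CM.diag_tsum)
  have "conv \<tau> \<tau> (Scpi t) = sum_list (map (\<lambda>(x, y). br (\<tau> (parity x)) (\<tau> y)) (map (\<lambda>(x, y). (Scpi x, Scpi y)) xs))"
    using xs(1) CM_SV Scpi_in Sv_C by (intro conv_tsum[OF tau_lin tau_lin _ diag_Sc_map[OF xs(2)]]) auto
  also have "\<dots> = sum_list (map (\<lambda>(x, y). ?b x y) xs)"
    unfolding map_map using xs(1) H.parity_0[OF Scpi_in[OF CM_SV]]
    by (intro arg_cong[where f = sum_list] map_cong) auto
  also have "\<dots> = Qh t" using CM.tlift_diag[OF b V.vector_space_axioms xs] Q by simp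
  finally have conv: "conv \<tau> \<tau> (Scpi t) = Qh t" .
  have t: "t \<in> SV" using Suc.prems(1) by (rule CM_SV)
  \<comment> \<open>The element is its own row at the empty word.\<close>
  have "Mh (\<lambda>z. t ([] @ z)) = 0" using Suc.prems(1) by (simp only: CM_def mem_Collect_eq)
  then have "cor t = nab (p (cor t)) + s (1 / 2) (h (Qh t))" using Mh_zero_iff[OF t] by simp
  then show ?case
    using tau_recursion[OF Sv_C[OF Scpi_in[OF t]]] conv
      corestrict_Sc_map[OF V.grsp_axioms H.grsp_axioms p_lin p_deg0 t] by simp
qed

text \<open>By \<open>tau_Scpi\<close> the composite has the corestriction of the identity on
  \<open>CM\<close>; closure of \<open>CM\<close> under rows and columns carries this through words
  letter by letter.\<close>

lemma F_Scpi:
  assumes t: "t \<in> CM" shows "F (Scpi t) = t"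
proof -
  have "lift_at s (susp G) \<tau> w (Scpi t) = t w" if "t \<in> CM" for w t
    using that
  proof (induction w arbitrary: t)
    case Nil
    then show ?case by (simp add: Sc_map_pull)
  next
    case (Cons a w)
    show ?case
    proof (cases "snd a \<in> hdual s (susp G) (fst a)")
      case True
      \<comment> \<open>Pulled back along \<open>p\<close>, the prefix \<open>z\<close> fixes a row
        of \<open>t\<close>, again in \<open>CM\<close>, to which the induction hypothesis
        applies.\<close>
      have "lift_at s (susp G) \<tau> w (\<lambda>z'. Scpi t (z @ z')) = Scpi (\<lambda>z. t (z @ w)) z" for z
      proof (cases "hword sH (susp GH) z")
        case True
        then show ?thesis
          using Cons.IH[OF CM.row_in[OF Cons.prems, of "pull p z"]] by (simp add: row_Sc_map Sc_map_pull[where w = z])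
      next
        case False
        then show ?thesis
          unfolding row_Sc_map
          using lin_on_zero[OF LC.lin_on_lift_at C.subspace fs.vector_space_axioms vector_space_field]
          by (simp add: Sc_map_pull zero_fun_def)
      qed
      then have "lift_at s (susp G) \<tau> (a # w) (Scpi t) = snd a (\<tau> (Scpi (\<lambda>z. t (z @ w))))"
        using True by simp
      also have "\<tau> (Scpi (\<lambda>z. t (z @ w))) = cor (\<lambda>z. t (z @ w))"
      proof -
        have col: "(\<lambda>z. t (z @ w)) \<in> CM" by (rule CM.column_in[OF Cons.prems])
        obtain N where "\<forall>w'. N \<le> length w' \<longrightarrow> t (w' @ w) = 0"
          using V.Sc_bounded[OF CM_SV[OF col]] by blast
        then show ?thesis by (intro tau_Scpi[OF col, of N]) simp
      qed
      also have "snd a \<dots> = t (a # w)"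
        using V.corestrict_apply[OF SV.column_in[OF CM_SV[OF Cons.prems]] True, of w] by simp
      finally show ?thesis .
    next
      case False
      then show ?thesis using V.Sc_hword[OF CM_SV[OF Cons.prems], of "a # w"] by simp
    qed
  qed
  then show ?thesis using t by (simp add: lift_map_def fun_eq_iff)
qed

lemma theta_F: "t \<in> Sv \<Longrightarrow> \<theta> t = sH (1 / 2) (p (Qh (F t)))"
  by (simp add: \<theta>_def Qh_F)

text \<open>On the image \<open>\<theta>\<close> corresponds to half of \<open>p \<circ> Qh\<close>,
  but rows have to be matched: rows of \<open>t\<close> are projections of rows of
  \<open>F t\<close>, whereas rows of \<open>F t\<close> are images of partial evaluations of
  \<open>t\<close>.\<close>

lemma F_in_CV_iff:
  assumes t: "t \<in> Sv" shows "F t \<in> CV \<longleftrightarrow> t \<in> Ck"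
proof
  assume V: "F t \<in> CV"
  have "\<theta> (\<lambda>z. t (x @ z)) = 0" for x
  proof (cases "hword sH (susp GH) x")
    case True
    \<comment> \<open>Rows of \<open>F t\<close> at pulled back words suffice, because
      \<open>Scpi\<close> recovers \<open>t\<close> from \<open>F t\<close>.\<close>
    let ?u = "\<lambda>z. F t (pull p x @ z)"
    have u: "?u \<in> CM" by (rule CM.row_in[OF F_in_CM[OF t]])
    have "(\<lambda>z. t (x @ z)) = (\<lambda>z. Scpi (F t) (x @ z))" by (simp add: Scpi_F[OF t])
    also have "\<dots> = Scpi ?u" using True by (simp add: row_Sc_map)
    finally have "\<theta> (\<lambda>z. t (x @ z)) = sH (1 / 2) (p (Qh ?u))"
      using theta_F[OF Scpi_in[OF CM_SV[OF u]]] F_Scpi[OF u] by simp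
    then show ?thesis using V by (simp add: CV_iff)
  next
    case False
    then have "(\<lambda>z. t (x @ z)) = 0" using H.Sc_hword[OF t] by (auto simp: fun_eq_iff)
    then show ?thesis
      using lin_on_zero[OF theta_lin C.subspace fs.vector_space_axioms H.vector_space_axioms] by simp
  qed
  then show "t \<in> Ck" using t by (simp add: Ck_def)
next
  assume k: "t \<in> Ck"
  have "p (Qh (\<lambda>z. F t (x @ z))) = 0" for x
  proof -
    let ?t' = "\<lambda>y. lift_at s (susp G) \<tau> x (\<lambda>z. t (z @ y))"
    \<comment> \<open>\<open>?t'\<close> is a partial evaluation and not itself a row; exchanging
      the order of evaluation applies \<open>\<theta>\<close> to rows of \<open>t\<close>, where it
      vanishes.\<close>
    have "\<theta> ?t' = 0"
    proof (rule H.linear_eqI)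
      fix \<psi> assume \<psi>: "Vector_Spaces.linear sH (*) \<psi>"
      then interpret \<psi>: Vector_Spaces.linear sH "(*)" \<psi> .
      have lin: "lin_on fscale (*) C (\<lambda>t. \<psi> (\<theta> t))" by (rule lin_on_compose[OF theta_lin \<psi>])
      have "\<psi> (\<theta> ?t') = lift_at s (susp G) \<tau> x (\<lambda>z. \<psi> (\<theta> (\<lambda>y. t (z @ y))))"
        by (rule C.fubini[OF Sv_C[OF t] LC.lin_on_lift_at lin, symmetric])
      also have "\<dots> = 0"
        using k lin_on_zero[OF LC.lin_on_lift_at C.subspace fs.vector_space_axioms vector_space_field]
        by (simp add: Ck_def \<psi>.zero zero_fun_def)
      finally show "\<psi> (\<theta> ?t') = \<psi> 0" by (simp add: \<psi>.zero)
    qed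
    then show ?thesis using theta_F[OF row_F_in[OF t]] row_F[OF t] by simp
  qed
  then show "F t \<in> CV" using F_in_CM[OF t] by (simp add: CV_iff)
qed

end

theorem theorem5p1:
  fixes s :: "'f::field_char_0 \<Rightarrow> 'a::ab_group_add \<Rightarrow> 'a"
    and G :: "int \<Rightarrow> 'a set"
    and d :: "'a \<Rightarrow> 'a"
    and br :: "'a \<Rightarrow> 'a \<Rightarrow> 'a"
    and sH :: "'f \<Rightarrow> 'b::ab_group_add \<Rightarrow> 'b"
    and GH :: "int \<Rightarrow> 'b set"
    and nab :: "'b \<Rightarrow> 'a"
    and p :: "'a \<Rightarrow> 'b"
    and h :: "'a \<Rightarrow> 'a"
    and YM YV :: "('a \<Rightarrow> 'f) set"
  assumes "dg_lie s G d br"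
    and "concentrated G {-1, -2}"
    and "contraction s G d sH GH nab p h"
    and "\<exists>B. finite B \<and> module.span s B = susp G 0"
    and "generators s (susp G 0) (zero_locus_ideal s (susp G 0) (M_map s d br h)) YM"
    and "generators s (susp G 0) (zero_locus_ideal s (susp G 0) (J_map s d br)) YV"
  shows
    "(let Sv0 = Sc sH (susp GH) (susp GH 0);
          CM = coord_coalgebra s (susp G) (susp G 0) YM;
          CV = coord_coalgebra s (susp G) (susp G 0) YV;
          Ck = kuranishi_coalgebra s br sH GH nab p h;
          taubar = tau_bar s G d br sH GH nab h;
          Scpi = Sc_map sH (susp GH) p
      in (coalgebra_iso Sv0 CM taubar \<and>
          coalgebra_iso CM Sv0 Scpi \<and>
          (\<forall>t\<in>Sv0. Scpi (taubar t) = t) \<and>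
          (\<forall>t\<in>CM. taubar (Scpi t) = t)) \<and>
         (Ck \<subseteq> Sv0 \<and> CV \<subseteq> CM \<and> coalgebra_iso Ck CV taubar))"
proof -
  interpret twisting s G d br sH GH nab p h by (rule twisting.intro[OF assms(1-3)])
  let ?tb = "tau_bar s G d br sH GH nab h"
  have tb: "?tb t = F t" if "t \<in> Sv" for t using tau_bar_eq[OF Sv_C[OF that]] .
  have "coalgebra_map Sv CM F" by (rule L0.coalgebra_map_lift_map) (auto simp: F_in_CM)
  then have map: "coalgebra_map Sv CM ?tb" by (rule Sv.coalgebra_map_cong) (simp add: tb)
  have bij: "bij_betw ?tb Sv CM"
    by (rule bij_betw_byWitness[of _ Scpi]) (auto simp: tb Scpi_F F_Scpi F_in_CM Scpi_in CM_SV)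
  have map': "coalgebra_map CM Sv Scpi"
    by (rule coalgebra_map_Sc_map[OF subcoalgebra_CM]) (auto simp: Scpi_in CM_SV)
  have bij': "bij_betw Scpi CM Sv"
    by (rule bij_betw_byWitness[of _ ?tb]) (auto simp: tb Scpi_F F_Scpi F_in_CM Scpi_in CM_SV)
  have Ck: "Ck \<subseteq> Sv" by (auto simp: Ck_def)
  have CV: "CV \<subseteq> CM" by (auto simp: CV_iff)
  have "?tb ` Ck = CV"
  proof
    show "?tb ` Ck \<subseteq> CV" using Ck F_in_CV_iff by (auto simp: tb subset_iff)
    show "CV \<subseteq> ?tb ` Ck"
    proof
      fix u assume u: "u \<in> CV"
      \<comment> \<open>The preimage of \<open>u\<close> under the isomorphism already found lies in
        \<open>Ck\<close>, because \<open>F_in_CV_iff\<close> is an equivalence.\<close>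
      then have "Scpi u \<in> Sv" "F (Scpi u) = u" using CV Scpi_in CM_SV F_Scpi by auto
      then show "u \<in> ?tb ` Ck" using u F_in_CV_iff[of "Scpi u"] by (intro image_eqI[of _ _ "Scpi u"]) (auto simp: tb)
    qed
  qed
  then have bij'': "bij_betw ?tb Ck CV" using bij_betw_subset[OF bij Ck] by simp
  have map'': "coalgebra_map Ck CV ?tb"
    using bij'' by (intro Sv.coalgebra_map_restrict[OF map subcoalgebra_Ck Ck]) (simp add: bij_betw_def)
  show ?thesis
    unfolding Let_def coord_coalgebra_M[OF assms(5)] coord_coalgebra_V[OF assms(6)] kuranishi_eq coalgebra_iso_def
    using map bij map' bij' map'' bij'' Ck CV subcoalgebra_CM subcoalgebra_CV subcoalgebra_Ck Sv.subcoalgebra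
    by (simp add: tb Scpi_F F_Scpi Scpi_in CM_SV)
qed

end
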